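(* Let $d\ge1$, $T>0$, $\alpha>0$, $\beta>1$, and let $g:(0,\infty)\to\mathbb{R}$ be smooth and non-decreasing. Let $u,m\in C^\infty(\mathbb{T}^d\times[0,T])$ with $m>0$ (both periodic in $x$) solve the first-order mean-field game with congestion $$\begin{cases}-u_t+m^{\alpha(1-\beta)}\dfrac{|Du|^\beta}{\beta}=g(m),\\[2mm] m_t-\operatorname{div}\big(m^{1+\alpha(1-\beta)}\,Du\,|Du|^{\beta-2}\big)=0,\end{cases}\qquad(x,t)\in\mathbb{T}^d\times(0,T),$$ and write $m^0=m(\cdot,0)$ and $m^T=m(\cdot,T)$. Assume that either $\beta\ge2$ and $\alpha<\dfrac{2}{\beta-1}$, or $1<\beta<2$ and $\alpha<2$. Then, for all $t\in[0,T]$, $$\|m(\cdot,t)\|_{L^\infty(\mathbb{T}^d)}\le\max\big\{\|m^0\|_{L^\infty(\mathbb{T}^d)},\ \|m^T\|_{L^\infty(\mathbb{T}^d)}\big\}.$$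
   Context: $\mathbb{T}^d=\mathbb{R}^d/\mathbb{Z}^d$ is the $d$-dimensional flat torus (of Lebesgue measure $1$); functions on $\mathbb{T}^d$ are identified with $\mathbb{Z}^d$-periodic functions on $\mathbb{R}^d$. $D$ and $\operatorname{div}$ denote the gradient and divergence in the space variable $x$; the subscript $t$ denotes the time derivative. The vector field $Du|Du|^{\beta-2}$ is the gradient of $p\mapsto|p|^\beta/\beta$ evaluated at $p=Du$, so it equals $0$ where $Du=0$. *)

theory Defs
  imports "HOL-Analysis.Analysis" "HOL-Probability.Essential_Supremum"
begin

text \<open>
  Differentiation is taken within \<open>S\<close>. On a set such as \<open>UNIV \<times> {0..T}\<close> with \<open>T > 0\<close> (convex,
  with nonempty interior) the derivative within the set is unique, and at the boundary
  it is one-sided.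
\<close>

primrec Ck_on :: "nat \<Rightarrow> ('a::euclidean_space \<Rightarrow> 'b::real_normed_vector) \<Rightarrow> 'a set \<Rightarrow> bool" where
  "Ck_on 0 f S \<longleftrightarrow> continuous_on S f"
| "Ck_on (Suc k) f S \<longleftrightarrow>
     (\<exists>f'. (\<forall>x\<in>S. (f has_derivative f' x) (at x within S)) \<and>
           (\<forall>b\<in>Basis. Ck_on k (\<lambda>x. f' x b) S))"

definition Cinfinity_on :: "('a::euclidean_space \<Rightarrow> 'b::real_normed_vector) \<Rightarrow> 'a set \<Rightarrow> bool" where
  "Cinfinity_on f S \<longleftrightarrow> (\<forall>k. Ck_on k f S)"

text \<open>Functions on the flat torus are functions on \<open>real ^ 'n\<close> that are invariant under \<open>\<int>\<^sup>n\<close>.\<close>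

definition torus_periodic :: "(real ^ 'n \<Rightarrow> 'b) \<Rightarrow> bool" where
  "torus_periodic f \<longleftrightarrow> (\<forall>x k. (\<forall>i. k $ i \<in> \<int>) \<longrightarrow> f (x + k) = f x)"

text \<open>The closed unit cube is a fundamental domain up to a Lebesgue null set.\<close>

definition torus_Linfty_norm :: "(real ^ 'n \<Rightarrow> real) \<Rightarrow> ereal" where
  "torus_Linfty_norm f = esssup (lebesgue_on (cbox 0 1)) (\<lambda>x. ereal \<bar>f x\<bar>)"

definition gradient :: "(real ^ 'n \<Rightarrow> real) \<Rightarrow> real ^ 'n \<Rightarrow> real ^ 'n" where
  "gradient f x = (\<chi> i. frechet_derivative f (at x) (axis i 1))"

definition divergence :: "(real ^ 'n \<Rightarrow> real ^ 'n) \<Rightarrow> real ^ 'n \<Rightarrow> real" where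
  "divergence F x = trace (jacobian F (at x))"

definition Dx :: "((real ^ 'n) \<times> real \<Rightarrow> real) \<Rightarrow> real ^ 'n \<Rightarrow> real \<Rightarrow> real ^ 'n" where
  "Dx w x t = gradient (\<lambda>y. w (y, t)) x"

definition Dt :: "((real ^ 'n) \<times> real \<Rightarrow> real) \<Rightarrow> real ^ 'n \<Rightarrow> real \<Rightarrow> real" where
  "Dt w x t = deriv (\<lambda>s. w (x, s)) t"

text \<open>The flux is \<open>0\<close> where \<open>Du = 0\<close>, also for \<open>\<beta> < 2\<close>, because of the factor \<open>Du\<close>.\<close>

definition flux :: "real \<Rightarrow> real \<Rightarrow> ((real ^ 'n) \<times> real \<Rightarrow> real) \<Rightarrow> ((real ^ 'n) \<times> real \<Rightarrow> real) \<Rightarrow>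
    real \<Rightarrow> real ^ 'n \<Rightarrow> real ^ 'n" where
  "flux \<alpha> \<beta> u m t x =
     (m (x, t) powr (1 + \<alpha> * (1 - \<beta>)) * norm (Dx u x t) powr (\<beta> - 2)) *\<^sub>R Dx u x t"

text \<open>
  Classical solutions. For \<open>\<beta> < 2\<close> the map \<open>p \<mapsto> p |p|\<^bsup>\<beta>-2\<^esup>\<close> is not differentiable at \<open>0\<close>, so that
  differentiability of the flux in \<open>x\<close>, which gives its divergence a meaning, is part of what it
  means to solve the second equation.
\<close>

definition solves_congestion_MFG :: "real \<Rightarrow> real \<Rightarrow> real \<Rightarrow> (real \<Rightarrow> real) \<Rightarrow>
    ((real ^ 'n) \<times> real \<Rightarrow> real) \<Rightarrow> ((real ^ 'n) \<times> real \<Rightarrow> real) \<Rightarrow> bool" where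
  "solves_congestion_MFG T \<alpha> \<beta> g u m \<longleftrightarrow>
     (\<forall>x. \<forall>t\<in>{0<..<T}.
        - Dt u x t + m (x, t) powr (\<alpha> * (1 - \<beta>)) * (norm (Dx u x t) powr \<beta> / \<beta>) = g (m (x, t)) \<and>
        flux \<alpha> \<beta> u m t differentiable at x \<and>
        Dt m x t - divergence (flux \<alpha> \<beta> u m t) x = 0)"

end

theory Submission
  imports Defs
begin

text \<open>
  Let \<open>a = \<alpha> (\<beta> - 1)\<close>, \<open>M = ln m\<close> and \<open>q = Du |Du|\<^sup>\<beta>\<^sup>-\<^sup>2\<close>. The moment \<open>J(t) = \<integral> m\<^sup>r\<close> is a convex function of
  time for all large \<open>r\<close>, so \<open>J(t) \<le> max (J 0) (J T)\<close>, and the bound follows as \<open>r \<rightarrow> \<infinity>\<close>. Formally,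
  with \<open>\<rho> = r - 2a\<close>, \<open>D = div q\<close> and \<open>S = q \<cdot> DM\<close>, two integrations by parts bound \<open>J''\<close> from below by a
  positive multiple of
  \<open>\<integral> m\<^sup>\<rho> ((1 - 1/\<rho>) D\<^sup>2 - a S D + (a (\<beta> - 1) / \<beta>) S\<^sup>2 + tr ((Dq)\<^sup>2) / \<rho>)\<close>,
  where the coupling contributes a nonnegative term because \<open>g' \<ge> 0\<close>, and \<open>tr ((Dq)\<^sup>2) \<ge> 0\<close> because \<open>Dq\<close>
  is the product of a positive definite and a symmetric matrix. The quadratic form in \<open>(D, S)\<close> is nonnegative
  for large \<open>\<rho>\<close> as soon as \<open>\<alpha> < 4 / \<beta>\<close>, which both cases of the hypothesis imply.

  The difficulty is that \<open>q\<close> is singular at \<open>Du = 0\<close>. Replace one factor \<open>q\<close> by \<open>X = \<zeta> q\<close>, where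
  \<open>\<zeta> = max(0, 1 + \<iota> ln |Du|\<^sup>2)\<^sup>3\<close> vanishes near \<open>Du = 0\<close> and varies slowly on the logarithmic scale. The terms with
  \<open>D\<zeta>\<close> contain \<open>y = |Du|\<^sup>\<beta>\<^sup>-\<^sup>4 (Du \<cdot> D\<^sup>2u Du)\<close> with a weight \<open>\<omega> = O(\<iota>)\<close>, and \<open>tr (Dq DX)\<close> gains
  \<open>\<omega> (\<beta> - 1) y\<^sup>2\<close>, which absorbs them up to \<open>O(\<iota>)\<close>. As \<open>\<iota> \<rightarrow> 0\<close> the critical set of \<open>u\<close> does not contribute to
  \<open>J'\<close>: where \<open>Du = 0\<close> and \<open>m\<^sub>t \<noteq> 0\<close>, differentiability of the flux makes zeros of \<open>Du\<close> isolated along some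
  coordinate direction, and a set of such points is null because infinitely many of its translates are disjoint.
\<close>

section \<open>Iterated directional derivatives\<close>

text \<open>The total derivative applied to a direction, hence linear in \<open>v\<close> wherever
  \<open>f\<close> is differentiable. On \<open>(real ^ 'n) \<times> real\<close> the directions
  \<open>(axis i 1, 0)\<close> and \<open>(0, 1)\<close> give space and time derivatives in one
  notation.\<close>

definition dird :: "('a::real_normed_vector \<Rightarrow> real) \<Rightarrow> 'a \<Rightarrow> 'a \<Rightarrow> real" where
  "dird f v x = frechet_derivative f (at x) v"

lemma dird_eq: "(f has_derivative f') (at x) \<Longrightarrow> dird f v x = f' v"
  unfolding dird_def by (metis frechet_derivative_at)

lemma has_derivative_dird: "f differentiable at x \<Longrightarrow> (f has_derivative (\<lambda>v. dird f v x)) (at x)"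
  unfolding dird_def using frechet_derivative_works by metis

text \<open>\<open>frechet_derivative\<close> chooses from the set of possible derivatives.
  Functions that agree near \<open>x\<close> have the same set, hence the same choice, whether or
  not they are differentiable there.\<close>

lemma dird_cong_open:
  assumes "open S" "x \<in> S" "\<And>y. y \<in> S \<Longrightarrow> f y = g y"
  shows "dird f v x = dird g v x"
proof -
  have "(f has_derivative D) (at x) \<longleftrightarrow> (g has_derivative D) (at x)" for D
    using assms by (metis has_derivative_transform_within_open)
  then show ?thesis unfolding dird_def frechet_derivative_def by simp
qed

lemma dird_const [simp]: "dird (\<lambda>x. c) v x = 0"
  by (rule dird_eq) (rule has_derivative_const)

lemma dird_add:
  assumes "f differentiable at x" "g differentiable at x"
  shows "dird (\<lambda>x. f x + g x) v x = dird f v x + dird g v x"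
  by (rule dird_eq) (intro has_derivative_add has_derivative_dird assms)

lemma dird_diff:
  assumes "f differentiable at x" "g differentiable at x"
  shows "dird (\<lambda>x. f x - g x) v x = dird f v x - dird g v x"
  by (rule dird_eq) (intro has_derivative_diff has_derivative_dird assms)

lemma dird_mult:
  assumes "f differentiable at x" "g differentiable at x"
  shows "dird (\<lambda>x. f x * g x) v x = f x * dird g v x + dird f v x * g x"
  by (rule dird_eq) (intro has_derivative_mult has_derivative_dird assms)

lemma dird_cmult:
  assumes "f differentiable at x"
  shows "dird (\<lambda>x. c * f x) v x = c * dird f v x"
  by (rule dird_eq) (intro has_derivative_mult_right has_derivative_dird assms)

lemma dird_sum:
  assumes "\<And>i. i \<in> I \<Longrightarrow> f i differentiable at x"
  shows "dird (\<lambda>x. \<Sum>i\<in>I. f i x) v x = (\<Sum>i\<in>I. dird (f i) v x)"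
  by (rule dird_eq) (intro has_derivative_sum has_derivative_dird assms)

lemma dird_compose:
  assumes "f differentiable at x" "(\<phi> has_field_derivative d) (at (f x))"
  shows "dird (\<lambda>x. \<phi> (f x)) v x = d * dird f v x"
  by (rule dird_eq)
     (use has_derivative_compose[OF has_derivative_dird[OF assms(1)] assms(2)[unfolded has_field_derivative_def]] in simp)

lemma dird_linear:
  assumes "f differentiable at x"
  shows "linear (\<lambda>v. dird f v x)"
  using has_derivative_dird[OF assms] has_derivative_linear by blast

lemma dird_real:
  fixes \<phi> :: "real \<Rightarrow> real"
  assumes "(\<phi> has_field_derivative d) (at x)"
  shows "dird \<phi> v x = d * v"
  using assms unfolding has_field_derivative_def by (rule dird_eq)

lemma dird_shift:
  assumes "f differentiable at (x + c)"
  shows "dird (\<lambda>y. f (y + c)) v x = dird f v (x + c)"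
proof (rule dird_eq)
  have "((\<lambda>y. y + c) has_derivative (\<lambda>v. v)) (at x)"
    by (auto intro!: derivative_eq_intros)
  from has_derivative_compose[OF this has_derivative_dird[OF assms]]
  show "((\<lambda>y. f (y + c)) has_derivative (\<lambda>v. dird f v (x + c))) (at x)" .
qed

text \<open>C^k regularity in a form closed under \<open>dird\<close>. Total differentiability is
  demanded at every order, so that the sum, product and chain rules apply, and all directions are
  quantified, so that inductions on the order go through.\<close>

primrec Cdiff :: "nat \<Rightarrow> ('a::euclidean_space \<Rightarrow> real) \<Rightarrow> 'a set \<Rightarrow> bool" where
  "Cdiff 0 f S \<longleftrightarrow> continuous_on S f"
| "Cdiff (Suc k) f S \<longleftrightarrow> (\<forall>x\<in>S. f differentiable at x) \<and> (\<forall>v. Cdiff k (dird f v) S)"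

lemma Cdiff_dird: "Cdiff (Suc k) f S \<Longrightarrow> Cdiff k (dird f v) S"
  by simp

lemma Cdiff_cong:
  assumes "open S" "\<And>y. y \<in> S \<Longrightarrow> f y = g y"
  shows "Cdiff k f S \<longleftrightarrow> Cdiff k g S"
  using assms
proof (induction k arbitrary: f g)
  case 0
  then show ?case by (simp cong: continuous_on_cong)
next
  case (Suc k)
  have "f differentiable at x \<longleftrightarrow> g differentiable at x" if "x \<in> S" for x
    using Suc.prems that unfolding differentiable_def by (metis has_derivative_transform_within_open)
  moreover have "Cdiff k (dird f v) S \<longleftrightarrow> Cdiff k (dird g v) S" for v
    by (rule Suc.IH) (use Suc.prems dird_cong_open in blast)+
  ultimately show ?case by simp
qed

lemma Cdiff_congI:
  assumes "open S" "Cdiff k g S" "\<And>y. y \<in> S \<Longrightarrow> f y = g y"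
  shows "Cdiff k f S"
  using Cdiff_cong[of S f g k] assms by simp

lemma Cdiff_SucD: "Cdiff (Suc k) f S \<Longrightarrow> Cdiff k f S"
proof (induction k arbitrary: f)
  case 0
  then show ?case
    by (simp add: continuous_at_imp_continuous_on differentiable_imp_continuous_within)
next
  case (Suc k)
  from Suc.prems have "\<forall>v. Cdiff (Suc k) (dird f v) S" "\<forall>x\<in>S. f differentiable at x" by auto
  then show ?case using Suc.IH by auto
qed

lemma Cdiff_mono: "Cdiff l f S \<Longrightarrow> k \<le> l \<Longrightarrow> Cdiff k f S"
  by (induction l) (auto simp del: Cdiff.simps(2) dest: Cdiff_SucD simp: le_Suc_eq)

lemma Cdiff_continuous: "Cdiff k f S \<Longrightarrow> continuous_on S f"
  using Cdiff_mono[of k f S 0] by simp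

lemma Cdiff_subset: "Cdiff k f S \<Longrightarrow> S' \<subseteq> S \<Longrightarrow> Cdiff k f S'"
  by (induction k arbitrary: f) (auto intro: continuous_on_subset)

text \<open>Regularity on open sets is local. This is what later glues a function smooth away from
  the critical points of \<open>u\<close> to the zero function near them.\<close>

lemma Cdiff_Un:
  "open S \<Longrightarrow> open S' \<Longrightarrow> Cdiff k f S \<Longrightarrow> Cdiff k f S' \<Longrightarrow> Cdiff k f (S \<union> S')"
  by (induction k arbitrary: f) (auto intro: continuous_on_open_Un)

lemma Cdiff_const: "Cdiff k (\<lambda>x. c) S"
proof (induction k arbitrary: c)
  case (Suc k)
  have "dird (\<lambda>x. c) v = (\<lambda>x. 0)" for v :: 'a by (simp add: fun_eq_iff)
  then show ?case using Suc by auto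
qed simp

lemma Cdiff_add:
  assumes "open S"
  shows "Cdiff k f S \<Longrightarrow> Cdiff k g S \<Longrightarrow> Cdiff k (\<lambda>x. f x + g x) S"
proof (induction k arbitrary: f g)
  case (Suc k)
  have "Cdiff k (dird (\<lambda>x. f x + g x) v) S" for v
  proof -
    have "Cdiff k (\<lambda>x. dird f v x + dird g v x) S" using Suc by auto
    then show ?thesis
      by (rule Cdiff_congI[OF assms], intro dird_add) (use Suc.prems in auto)
  qed
  then show ?case using Suc.prems by auto
qed (simp add: continuous_on_add)

lemma Cdiff_mult:
  assumes "open S"
  shows "Cdiff k f S \<Longrightarrow> Cdiff k g S \<Longrightarrow> Cdiff k (\<lambda>x. f x * g x) S"
proof (induction k arbitrary: f g)
  case (Suc k)
  have "Cdiff k (dird (\<lambda>x. f x * g x) v) S" for v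
  proof -
    have "Cdiff k (\<lambda>x. f x * dird g v x + dird f v x * g x) S"
      using Suc.prems Cdiff_SucD[OF Suc.prems(1)] Cdiff_SucD[OF Suc.prems(2)]
      by (intro Cdiff_add assms Suc.IH) auto
    then show ?thesis
      by (rule Cdiff_congI[OF assms], intro dird_mult) (use Suc.prems in auto)
  qed
  then show ?case using Suc.prems by auto
qed (simp add: continuous_on_mult)

lemma Cdiff_minus:
  assumes "open S" "Cdiff k f S" shows "Cdiff k (\<lambda>x. - f x) S"
  using Cdiff_mult[OF assms(1) Cdiff_const[of k "-1"] assms(2)] by simp

lemma Cdiff_diff:
  assumes "open S" "Cdiff k f S" "Cdiff k g S" shows "Cdiff k (\<lambda>x. f x - g x) S"
  using Cdiff_add[OF assms(1,2) Cdiff_minus[OF assms(1,3)]] by simp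

lemma Cdiff_sum:
  assumes "open S" "\<And>i. i \<in> I \<Longrightarrow> Cdiff k (f i) S"
  shows "Cdiff k (\<lambda>x. \<Sum>i\<in>I. f i x) S"
  using assms(2) by (induction I rule: infinite_finite_induct) (auto intro!: Cdiff_const Cdiff_add assms(1))

lemma Cdiff_compose:
  fixes \<phi> :: "real \<Rightarrow> real"
  assumes "open S" "\<And>x. x \<in> S \<Longrightarrow> f x \<in> U"
  shows "Cdiff k \<phi> U \<Longrightarrow> Cdiff k f S \<Longrightarrow> Cdiff k (\<lambda>x. \<phi> (f x)) S"
proof (induction k arbitrary: \<phi>)
  case 0
  then have c: "continuous_on U \<phi>" "continuous_on S f" by simp_all
  have i: "f ` S \<subseteq> U" using assms(2) by blast
  have "continuous_on S (\<phi> \<circ> f)"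
    using continuous_on_compose[OF c(2) continuous_on_subset[OF c(1) i]] .
  then show ?case unfolding Cdiff.simps(1) o_def .
next
  case (Suc k)
  have \<phi>: "(\<phi> has_field_derivative dird \<phi> 1 y) (at y)" if "y \<in> U" for y
  proof -
    have "\<phi> differentiable at y" using Suc.prems(1) that by simp
    then obtain d where "(\<phi> has_field_derivative d) (at y)"
      by (auto simp: real_differentiable_def)
    moreover from this have "dird \<phi> 1 y = d" using dird_real[of \<phi> d y 1] by simp
    ultimately show ?thesis by simp
  qed
  have d: "dird (\<lambda>x. \<phi> (f x)) v x = dird \<phi> 1 (f x) * dird f v x" if "x \<in> S" for x v
  proof (rule dird_compose)
    show "f differentiable at x" using Suc.prems(2) that by simp
    show "(\<phi> has_field_derivative dird \<phi> 1 (f x)) (at (f x))" using \<phi> assms(2) that by simp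
  qed
  have "(\<lambda>x. \<phi> (f x)) differentiable at x" if "x \<in> S" for x
  proof -
    have "f differentiable at x" "\<phi> differentiable at (f x)"
      using Suc.prems that assms(2) by simp_all
    then show ?thesis using differentiable_chain_at[of f x \<phi>] by (simp add: o_def)
  qed
  moreover have "Cdiff k (dird (\<lambda>x. \<phi> (f x)) v) S" for v
  proof -
    have "Cdiff k (\<lambda>x. dird \<phi> 1 (f x) * dird f v x) S"
    proof (rule Cdiff_mult[OF assms(1)])
      show "Cdiff k (\<lambda>x. dird \<phi> 1 (f x)) S"
        using Suc.prems(1) Cdiff_SucD[OF Suc.prems(2)] by (intro Suc.IH[of "dird \<phi> 1"]) simp_all
      show "Cdiff k (dird f v) S" using Suc.prems(2) by simp
    qed
    then show ?thesis by (rule Cdiff_congI[OF assms(1)]) (rule d)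
  qed
  ultimately show ?case by simp
qed

lemma Cdiff_realI:
  fixes \<phi> :: "real \<Rightarrow> real"
  assumes "open U" "\<And>x. x \<in> U \<Longrightarrow> (\<phi> has_field_derivative \<phi>' x) (at x)" "Cdiff k \<phi>' U"
  shows "Cdiff (Suc k) \<phi> U"
proof -
  have "Cdiff k (dird \<phi> v) U" for v
  proof -
    have "Cdiff k (\<lambda>x. \<phi>' x * v) U" by (intro Cdiff_mult Cdiff_const assms)
    then show ?thesis by (rule Cdiff_congI[OF assms(1)]) (rule dird_real[OF assms(2)])
  qed
  moreover have "\<phi> differentiable at x" if "x \<in> U" for x
    using assms(2)[OF that] by (auto simp: real_differentiable_def)
  ultimately show ?thesis by simp
qed

section \<open>Regularity of the elementary scalar functions\<close>

lemma Cdiff_exp: "Cdiff k (exp :: real \<Rightarrow> real) UNIV"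
proof (induction k)
  case 0
  then show ?case by (simp add: continuous_on_exp)
next
  case (Suc k)
  then show ?case by (intro Cdiff_realI) (auto intro: DERIV_exp)
qed

lemma Cdiff_powr: "Cdiff k (\<lambda>s::real. s powr c) {0<..}"
proof (induction k arbitrary: c)
  case 0
  then show ?case by (simp add: continuous_on_powr)
next
  case (Suc k)
  show ?case
    by (rule Cdiff_realI[where \<phi>' = "\<lambda>s. c * s powr (c - 1)"])
       (simp_all add: Cdiff_mult Cdiff_const Suc has_real_derivative_powr)
qed

lemma Cdiff_ln: "Cdiff k (ln :: real \<Rightarrow> real) {0<..}"
proof (cases k)
  case 0
  then show ?thesis by (simp add: continuous_on_ln)
next
  case (Suc l)
  have "Cdiff (Suc l) (ln :: real \<Rightarrow> real) {0<..}"
    by (rule Cdiff_realI[where \<phi>' = "\<lambda>s. s powr (-1)"])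
       (use Cdiff_powr[of l "-1"] in \<open>auto intro!: derivative_eq_intros simp: powr_minus divide_inverse simp del: powr_neg_one\<close>)
  then show ?thesis using Suc by simp
qed

text \<open>Only \<open>x = 0\<close> is delicate: there the difference quotient is at most
  \<open>\<bar>h\<bar> ^ Suc n\<close>, which tends to 0.\<close>

lemma has_derivative_pos_power:
  "((\<lambda>s::real. (max 0 s) ^ Suc (Suc n)) has_field_derivative real (n + 2) * (max 0 x) ^ Suc n) (at x)"
proof -
  consider "x < 0" | "x = 0" | "x > 0" by linarith
  then show ?thesis
  proof cases
    case 1
    have "((\<lambda>_. 0) has_field_derivative real (n + 2) * (max 0 x) ^ Suc n) (at x)"
      using 1 by (simp add: max_def)
    then show ?thesis
      by (rule has_field_derivative_transform_within_open[where S="{..<0}"]) (use 1 in \<open>auto simp: max_def\<close>)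
  next
    case 2
    have bound: "norm ((max 0 h) ^ Suc (Suc n) / h) \<le> \<bar>h\<bar> ^ Suc n" for h :: real
    proof (cases "h > 0")
      case True
      then have "max 0 h = h" by simp
      moreover have "h ^ Suc (Suc n) / h = h ^ Suc n" using True by simp
      ultimately have "(max 0 h) ^ Suc (Suc n) / h = h ^ Suc n" by (simp only:)
      then show ?thesis using abs_ge_self[of h] by (simp only: real_norm_def power_abs order_refl)
    next
      case False
      then have "max 0 h = 0" by simp
      then have "(max 0 h) ^ Suc (Suc n) / h = 0" by (simp only: power_0_Suc div_0)
      then show ?thesis by (simp only: norm_zero zero_le_power abs_ge_zero)
    qed
    have "((\<lambda>h::real. \<bar>h\<bar> ^ Suc n) \<longlongrightarrow> \<bar>0\<bar> ^ Suc n) (at 0)"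
      by (intro tendsto_intros)
    then have lim: "((\<lambda>h::real. \<bar>h\<bar> ^ Suc n) \<longlongrightarrow> 0) (at 0)" by simp
    have "((\<lambda>h::real. (max 0 h) ^ Suc (Suc n) / h) \<longlongrightarrow> 0) (at 0)"
      by (rule Lim_null_comparison[OF always_eventually lim]) (use bound in blast)
    then show ?thesis using 2 by (simp add: DERIV_def)
  next
    case 3
    have "((\<lambda>s. s ^ Suc (Suc n)) has_field_derivative real (n + 2) * (max 0 x) ^ Suc n) (at x)"
      using 3 DERIV_pow[of "Suc (Suc n)" x] by (simp add: max_def algebra_simps)
    then show ?thesis
      by (rule has_field_derivative_transform_within_open[where S="{0<..}"]) (use 3 in \<open>auto simp: max_def\<close>)
  qed
qed

text \<open>The cube of the positive part is twice continuously differentiable at 0. This order is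
  what the cutoff must have, because second derivatives of \<open>X\<close> are commuted
  later.\<close>

lemma Cdiff_cube_pos: "Cdiff (Suc (Suc 0)) (\<lambda>s::real. (max 0 s) ^ 3) UNIV"
proof (rule Cdiff_realI[OF open_UNIV])
  show "((\<lambda>s::real. (max 0 s) ^ 3) has_field_derivative 3 * (max 0 x) ^ 2) (at x)" for x
    using has_derivative_pos_power[of 1 x] by (simp add: numeral_3_eq_3 numeral_2_eq_2)
  show "Cdiff (Suc 0) (\<lambda>s::real. 3 * (max 0 s) ^ 2) UNIV"
  proof (rule Cdiff_realI[OF open_UNIV])
    show "((\<lambda>s::real. 3 * (max 0 s) ^ 2) has_field_derivative 3 * (2 * max 0 x)) (at x)" for x
      using DERIV_cmult[OF has_derivative_pos_power[of 0 x], of 3] by (simp add: numeral_2_eq_2)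
    have "continuous_on UNIV (\<lambda>x::real. 3 * (2 * max 0 x))"
      by (intro continuous_intros)
    then show "Cdiff 0 (\<lambda>x::real. 3 * (2 * max 0 x)) UNIV" by simp
  qed
qed

text \<open>At a point of an open subset the derivative within \<open>A\<close> is the full
  derivative, and the basis directions yield all directions by linearity.\<close>

lemma Ck_on_imp_Cdiff:
  assumes "open S" "S \<subseteq> A"
  shows "Ck_on k f A \<Longrightarrow> Cdiff k f S"
proof (induction k arbitrary: f)
  case 0
  then show ?case using assms by (auto intro: continuous_on_subset)
next
  case (Suc k)
  then obtain f' where f': "\<And>x. x \<in> A \<Longrightarrow> (f has_derivative f' x) (at x within A)"
    and C: "\<And>b. b \<in> Basis \<Longrightarrow> Ck_on k (\<lambda>x. f' x b) A" by auto
  have d: "(f has_derivative f' x) (at x)" if "x \<in> S" for x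
    using f'[of x] that assms has_derivative_subset[of f "f' x" x A S] at_within_open[of x S] by auto
  have "Cdiff k (dird f v) S" for v
  proof -
    have "Cdiff k (\<lambda>x. \<Sum>b\<in>Basis. (v \<bullet> b) * f' x b) S"
      by (intro Cdiff_sum Cdiff_mult Cdiff_const assms(1)) (use C Suc.IH in auto)
    moreover have "dird f v x = (\<Sum>b\<in>Basis. (v \<bullet> b) * f' x b)" if "x \<in> S" for x
    proof -
      interpret linear "f' x" using d[OF that] has_derivative_linear by blast
      have "f' x v = f' x (\<Sum>b\<in>Basis. (v \<bullet> b) *\<^sub>R b)" by (simp add: euclidean_representation)
      then show ?thesis using dird_eq[OF d[OF that]] by (simp add: sum scale)
    qed
    ultimately show ?thesis using Cdiff_cong[OF assms(1)] by (metis (no_types, lifting))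
  qed
  then show ?case using d by (auto simp: differentiable_def)
qed

section \<open>Symmetry of second derivatives\<close>

lemma dird_along_line:
  assumes "f differentiable at (x + s *\<^sub>R v)"
  shows "((\<lambda>s. f (x + s *\<^sub>R v)) has_field_derivative dird f v (x + s *\<^sub>R v)) (at s)"
proof -
  have l: "((\<lambda>s. x + s *\<^sub>R v) has_derivative (\<lambda>r. r *\<^sub>R v)) (at s)"
    by (auto intro!: derivative_eq_intros)
  have "((\<lambda>s. f (x + s *\<^sub>R v)) has_derivative (\<lambda>r. dird f (r *\<^sub>R v) (x + s *\<^sub>R v))) (at s)"
    using has_derivative_compose[OF l has_derivative_dird[OF assms]] .
  moreover have "(\<lambda>r. dird f (r *\<^sub>R v) (x + s *\<^sub>R v)) = (*) (dird f v (x + s *\<^sub>R v))"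
    using linear_scale[OF dird_linear[OF assms]] by (auto simp: fun_eq_iff)
  ultimately show ?thesis by (simp add: has_field_derivative_def)
qed

text \<open>The mean value theorem is used twice: in direction \<open>v\<close> for the increment of
  \<open>f\<close> by \<open>h *\<^sub>R w\<close>, then in direction \<open>w\<close> for
  \<open>dird f v\<close>.\<close>

lemma second_difference:
  assumes "h > 0" and C: "Cdiff (Suc (Suc 0)) f S"
    and S: "\<And>s t. 0 \<le> s \<Longrightarrow> s \<le> h \<Longrightarrow> 0 \<le> t \<Longrightarrow> t \<le> h \<Longrightarrow> x + s *\<^sub>R v + t *\<^sub>R w \<in> S"
  obtains s t where "0 \<le> s" "s \<le> h" "0 \<le> t" "t \<le> h"
    "f (x + h *\<^sub>R v + h *\<^sub>R w) - f (x + h *\<^sub>R v) - f (x + h *\<^sub>R w) + f x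
       = h * (h * dird (dird f v) w (x + s *\<^sub>R v + t *\<^sub>R w))"
proof -
  have diff: "f differentiable at y" "dird f v differentiable at y" if "y \<in> S" for y
    using C that by auto
  have S0: "x + s *\<^sub>R v \<in> S" if "0 \<le> s" "s \<le> h" for s
    using S[of s 0] that \<open>h > 0\<close> by simp
  have S1: "x + h *\<^sub>R w + s *\<^sub>R v \<in> S" if "0 \<le> s" "s \<le> h" for s
    using S[of s h] that \<open>h > 0\<close> by (simp add: algebra_simps)
  have "\<exists>s>0. s < h \<and> (f (x + h *\<^sub>R w + h *\<^sub>R v) - f (x + h *\<^sub>R v))
      - (f (x + h *\<^sub>R w + 0 *\<^sub>R v) - f (x + 0 *\<^sub>R v))
      = (h - 0) * (dird f v (x + h *\<^sub>R w + s *\<^sub>R v) - dird f v (x + s *\<^sub>R v))"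
    by (rule MVT2[where f="\<lambda>s. f (x + h *\<^sub>R w + s *\<^sub>R v) - f (x + s *\<^sub>R v)"])
       (use \<open>h > 0\<close> in \<open>auto intro!: derivative_intros dird_along_line diff S0 S1\<close>)
  then obtain s where s: "0 < s" "s < h"
    and 1: "f (x + h *\<^sub>R w + h *\<^sub>R v) - f (x + h *\<^sub>R v) - f (x + h *\<^sub>R w) + f x
      = h * (dird f v (x + h *\<^sub>R w + s *\<^sub>R v) - dird f v (x + s *\<^sub>R v))"
    by (auto simp: algebra_simps)
  have "\<exists>t>0. t < h \<and> dird f v (x + s *\<^sub>R v + h *\<^sub>R w) - dird f v (x + s *\<^sub>R v + 0 *\<^sub>R w)
      = (h - 0) * dird (dird f v) w (x + s *\<^sub>R v + t *\<^sub>R w)"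
    by (rule MVT2) (use \<open>h > 0\<close> s in \<open>auto intro!: dird_along_line diff S\<close>)
  then obtain t where t: "0 < t" "t < h"
    and 2: "dird f v (x + s *\<^sub>R v + h *\<^sub>R w) - dird f v (x + s *\<^sub>R v)
      = h * dird (dird f v) w (x + s *\<^sub>R v + t *\<^sub>R w)"
    by auto
  show ?thesis
    by (rule that[of s t]) (use s t 1 2 in \<open>auto simp: add_ac\<close>)
qed

text \<open>The second difference is symmetric in \<open>v\<close> and \<open>w\<close>, so both
  mixed derivatives take a common value at points arbitrarily close to \<open>x\<close>; continuity
  excludes different values at \<open>x\<close>.\<close>

lemma dird_commute:
  assumes "open S" "x \<in> S" and C: "Cdiff (Suc (Suc 0)) f S"
  shows "dird (dird f v) w x = dird (dird f w) v x"
proof (rule ccontr)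
  let ?A = "dird (dird f v) w" and ?B = "dird (dird f w) v"
  assume neq: "?A x \<noteq> ?B x"
  define e where "e = \<bar>?A x - ?B x\<bar> / 2"
  have "e > 0" using neq by (simp add: e_def)
  have "continuous_on S ?A" "continuous_on S ?B" using C by auto
  then have "isCont ?A x" "isCont ?B x" using assms by (auto simp: continuous_on_eq_continuous_at)
  then obtain d1 d2 where d: "d1 > 0" "d2 > 0"
    and A: "\<And>y. dist y x < d1 \<Longrightarrow> dist (?A y) (?A x) < e"
    and B: "\<And>y. dist y x < d2 \<Longrightarrow> dist (?B y) (?B x) < e"
    unfolding continuous_at_eps_delta using \<open>e > 0\<close> by (metis dist_real_def)
  obtain d3 where d3: "d3 > 0" "ball x d3 \<subseteq> S" using assms open_contains_ball by blast
  define r where "r = min d1 (min d2 d3)"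
  have "r > 0" using d d3 by (simp add: r_def)
  \<comment> \<open>A parallelogram with these side lengths stays in the ball of radius
    \<open>r\<close>; the summand 1 keeps the denominator positive when both directions are
    0.\<close>
  define h where "h = r / (2 * (norm v + norm w + 1))"
  have pos: "norm v + norm w + 1 > 0" by (smt (verit) norm_ge_zero)
  have "h > 0" using \<open>r > 0\<close> pos by (simp add: h_def)
  have near: "dist (x + s *\<^sub>R v + t *\<^sub>R w) x < r" if "0 \<le> s" "s \<le> h" "0 \<le> t" "t \<le> h" for s t
  proof -
    have "dist (x + s *\<^sub>R v + t *\<^sub>R w) x \<le> s * norm v + t * norm w"
      using norm_triangle_ineq[of "s *\<^sub>R v" "t *\<^sub>R w"] that by (simp add: dist_norm)
    also have "\<dots> \<le> h * norm v + h * norm w"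
      by (intro add_mono mult_right_mono that) auto
    also have "\<dots> < 2 * (h * (norm v + norm w + 1))"
    proof -
      have "h * norm v \<ge> 0" "h * norm w \<ge> 0" using \<open>h > 0\<close> by auto
      then show ?thesis unfolding distrib_left using \<open>h > 0\<close> by linarith
    qed
    also have "\<dots> = r" using pos by (simp add: h_def divide_simps) 
    finally show ?thesis .
  qed
  have inS: "x + s *\<^sub>R v + t *\<^sub>R w \<in> S" if "0 \<le> s" "s \<le> h" "0 \<le> t" "t \<le> h" for s t
    using near[OF that] d3 by (auto simp: r_def dist_commute)
  obtain s t where st: "0 \<le> s" "s \<le> h" "0 \<le> t" "t \<le> h"
    and 1: "f (x + h *\<^sub>R v + h *\<^sub>R w) - f (x + h *\<^sub>R v) - f (x + h *\<^sub>R w) + f x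
       = h * (h * ?A (x + s *\<^sub>R v + t *\<^sub>R w))"
    using second_difference[OF \<open>h > 0\<close> C inS] by blast
  have inS': "x + s *\<^sub>R w + t *\<^sub>R v \<in> S" if "0 \<le> s" "s \<le> h" "0 \<le> t" "t \<le> h" for s t
    using inS[of t s] that by (simp add: add_ac)
  obtain s' t' where st': "0 \<le> s'" "s' \<le> h" "0 \<le> t'" "t' \<le> h"
    and 2: "f (x + h *\<^sub>R w + h *\<^sub>R v) - f (x + h *\<^sub>R w) - f (x + h *\<^sub>R v) + f x
       = h * (h * ?B (x + s' *\<^sub>R w + t' *\<^sub>R v))"
    using second_difference[OF \<open>h > 0\<close> C inS'] by blast
  have "h * (h * ?A (x + s *\<^sub>R v + t *\<^sub>R w)) = h * (h * ?B (x + s' *\<^sub>R w + t' *\<^sub>R v))"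
  proof -
    have "x + h *\<^sub>R w + h *\<^sub>R v = x + h *\<^sub>R v + h *\<^sub>R w" by (simp add: add_ac)
    then show ?thesis using 1 2 by (simp only:)
  qed
  then have "?A (x + s *\<^sub>R v + t *\<^sub>R w) = ?B (x + s' *\<^sub>R w + t' *\<^sub>R v)" using \<open>h > 0\<close> by simp
  moreover have "dist (?A (x + s *\<^sub>R v + t *\<^sub>R w)) (?A x) < e"
    using near[OF st] by (intro A) (simp add: r_def)
  moreover have "dist (?B (x + s' *\<^sub>R w + t' *\<^sub>R v)) (?B x) < e"
    using near[of t' s'] st' by (intro B) (simp add: r_def add_ac)
  ultimately show False unfolding e_def dist_real_def by argo
qed

section \<open>Integration by parts on the torus\<close>

text \<open>The part of the shifted cell that leaves the cube through the face where coordinate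
  \<open>i\<close> equals 1 is moved back by one period and fills the gap at the opposite
  face.\<close>

lemma integral_periodic_shift:
  fixes f :: "real ^ 'n \<Rightarrow> real"
  assumes cont: "continuous_on UNIV f" and per: "\<And>x. f (x + axis i 1) = f x"
    and h: "0 \<le> h" "h \<le> 1"
  shows "integral (cbox 0 1) (\<lambda>x. f (x + h *\<^sub>R axis i 1)) = integral (cbox 0 1) f"
proof -
  let ?e = "axis i 1 :: real ^ 'n"
  have int: "f integrable_on cbox a b" for a b
    using cont by (intro integrable_continuous) (rule continuous_on_subset, auto)
  have e: "?e \<in> Basis" by (simp add: axis_in_Basis_iff)
  have inner: "x \<bullet> ?e = x $ i" for x by (simp add: inner_axis)
  \<comment> \<open>The unit cube with its side in direction \<open>i\<close> replaced by the
    interval from \<open>p\<close> to \<open>1 + q\<close>. Thus \<open>slab 0 0\<close> is the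
    cube, and a translation by \<open>c\<close> along the axis adds \<open>c\<close> to both
    parameters.\<close>
  define slab where "slab p q = cbox (p *\<^sub>R ?e) (1 + q *\<^sub>R ?e)" for p q :: real
  have slab: "x \<in> slab p q \<longleftrightarrow> p \<le> x $ i \<and> x $ i \<le> 1 + q \<and> (\<forall>j. j \<noteq> i \<longrightarrow> 0 \<le> x $ j \<and> x $ j \<le> 1)"
    for x p q
  proof -
    have "x \<in> slab p q \<longleftrightarrow> (\<forall>j. p * ?e $ j \<le> x $ j \<and> x $ j \<le> 1 + q * ?e $ j)"
      by (simp add: slab_def mem_box_cart)
    also have "\<dots> \<longleftrightarrow> (p * ?e $ i \<le> x $ i \<and> x $ i \<le> 1 + q * ?e $ i) \<and>
        (\<forall>j. j \<noteq> i \<longrightarrow> p * ?e $ j \<le> x $ j \<and> x $ j \<le> 1 + q * ?e $ j)"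
      by metis
    finally show ?thesis by (simp add: axis_def)
  qed
  have shift: "integral (slab p q) (\<lambda>x. f (x + c *\<^sub>R ?e)) = integral (slab (p + c) (q + c)) f" for p q c
    using integral_shift_cbox[of "(p + c) *\<^sub>R ?e" "c *\<^sub>R ?e" "1 + (q + c) *\<^sub>R ?e" f]
    by (simp add: slab_def algebra_simps)
  have split: "integral (slab p q) f = integral (slab p (c - 1)) f + integral (slab c q) f"
    if "p \<le> c" "c \<le> 1 + q" for p q c
  proof -
    have "slab p q \<inter> {x. x \<bullet> ?e \<le> c} = slab p (c - 1)" "slab p q \<inter> {x. x \<bullet> ?e \<ge> c} = slab c q"
      using that by (auto simp: slab inner)
    then show ?thesis using integral_split[OF int e, of "p *\<^sub>R ?e" "1 + q *\<^sub>R ?e" c] by (simp add: slab_def)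
  qed
  have "integral (slab 0 0) (\<lambda>x. f (x + h *\<^sub>R ?e)) = integral (slab h h) f"
    using shift[of 0 0 h] by simp
  also have "\<dots> = integral (slab h 0) f + integral (slab 1 h) f"
    using split[of h 1 h] h by simp
  also have "integral (slab 1 h) f = integral (slab 0 (h - 1)) f"
    using shift[of 0 "h - 1" 1] per by simp
  also have "integral (slab h 0) f + integral (slab 0 (h - 1)) f = integral (slab 0 0) f"
    using split[of 0 h 0] h by simp
  finally show ?thesis by (simp add: slab_def)
qed

text \<open>The integral over a translated cell is constant in the translation \<open>h\<close>;
  differentiating under the integral at \<open>h = 0\<close> gives the claim. Since constancy is
  known for \<open>h\<close> in \<open>{0..1}\<close>, the derivative is one-sided.\<close>

lemma integral_periodic_dird:
  fixes f :: "real ^ 'n \<Rightarrow> real"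
  assumes diff: "\<And>x. f differentiable at x" and cont: "continuous_on UNIV (dird f (axis i 1))"
    and per: "\<And>x. f (x + axis i 1) = f x"
  shows "integral (cbox 0 1) (dird f (axis i 1)) = 0"
proof -
  let ?e = "axis i 1 :: real ^ 'n"
  let ?J = "\<lambda>h. integral (cbox 0 1) (\<lambda>x. f (x + h *\<^sub>R ?e))"
  have cf: "continuous_on UNIV f"
    using diff by (simp add: continuous_at_imp_continuous_on differentiable_imp_continuous_within)
  have cc: "continuous_on A (\<lambda>z. F (k z))" if "continuous_on UNIV F" "continuous_on A k"
    for A :: "'b::topological_space set" and F :: "real ^ 'n \<Rightarrow> real" and k
    using continuous_on_compose[OF that(2) continuous_on_subset[OF that(1)]] by (simp add: o_def)
  have "(?J has_field_derivative integral (cbox 0 1) (\<lambda>x. dird f ?e (x + 0 *\<^sub>R ?e))) (at 0 within {0..1})"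
  proof (rule leibniz_rule_field_derivative)
    show "((\<lambda>h. f (x + h *\<^sub>R ?e)) has_field_derivative dird f ?e (x + h *\<^sub>R ?e)) (at h within {0..1})"
      for x h by (rule has_field_derivative_at_within) (rule dird_along_line[OF diff])
    show "(\<lambda>x. f (x + h *\<^sub>R ?e)) integrable_on cbox 0 1" for h
      by (intro integrable_continuous cc[OF cf] continuous_intros)
    have "continuous_on ({0..1} \<times> cbox 0 1) (\<lambda>z. dird f ?e (snd z + fst z *\<^sub>R ?e))"
      by (intro cc[OF cont] continuous_intros)
    then show "continuous_on ({0..1} \<times> cbox 0 1) (\<lambda>(h, x). dird f ?e (x + h *\<^sub>R ?e))"
      by (simp add: case_prod_beta)
  qed auto
  moreover have "(?J has_field_derivative 0) (at 0 within {0..1})"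
  proof (rule has_field_derivative_transform_within[where d = 1])
    show "((\<lambda>h. integral (cbox 0 1) f) has_field_derivative 0) (at 0 within {0..1})" by simp
    show "integral (cbox 0 1) f = ?J h" if "h \<in> {0..1}" for h
      using integral_periodic_shift[OF cf per, of h] that by simp
  qed auto
  ultimately have "integral (cbox 0 1) (\<lambda>x. dird f ?e (x + 0 *\<^sub>R ?e)) = 0"
    unfolding has_real_derivative_iff_has_vector_derivative
    by (rule vector_derivative_unique_within[rotated]) (simp add: at_within_Icc_at_right)
  then show ?thesis by simp
qed

section \<open>Null sets and limits of moments\<close>

text \<open>A bounded piece of the set has infinitely many pairwise disjoint translates along
  \<open>e\<close> that remain in a bounded region, so its measure is 0.\<close>

lemma negligible_isolated_zeros:
  fixes f :: "'a::euclidean_space \<Rightarrow> 'b::real_normed_vector"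
  assumes cont: "continuous_on UNIV f" and "\<delta> > 0"
  shows "negligible {x. f x = 0 \<and> (\<forall>s. 0 < \<bar>s\<bar> \<and> \<bar>s\<bar> < \<delta> \<longrightarrow> f (x + s *\<^sub>R e) \<noteq> 0)}" (is "negligible ?E")
proof -
  define Z where "Z = {x. f x = 0}"
  have "closed Z" unfolding Z_def using cont by (intro closed_Collect_eq) auto
  \<comment> \<open>These compact sets exhaust the range of forbidden shifts. Adding a compact set
    to the closed zero set gives a closed set, so the exceptional set is Borel as a closed set minus
    countably many closed sets.\<close>
  define K where "K k = {s::real. 1 / real (Suc k) \<le> \<bar>s\<bar> \<and> \<bar>s\<bar> \<le> \<delta> - 1 / real (Suc k)}" for k
  define C where "C k = (\<Union>x\<in>Z. \<Union>y\<in>(\<lambda>s. - s *\<^sub>R e) ` K k. {x + y})" for k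
  have K: "K k = {-\<delta>..\<delta>} \<inter> (abs -` {1 / real (Suc k)..\<delta> - 1 / real (Suc k)})" for k
  proof -
    have "{s. c \<le> \<bar>s\<bar> \<and> \<bar>s\<bar> \<le> \<delta> - c} = {-\<delta>..\<delta>} \<inter> (abs -` {c..\<delta> - c})" if "0 < c" for c
      using that by auto
    then show ?thesis unfolding K_def by simp
  qed
  have "compact (K k)" for k
    unfolding K by (intro compact_Int_closed closed_vimage continuous_intros) auto
  then have "closed (C k)" for k
    unfolding C_def by (intro closed_compact_sums \<open>closed Z\<close> compact_continuous_image continuous_intros)
  moreover have "?E = Z - (\<Union>k. C k)"
  proof (intro set_eqI iffI)
    fix x assume x: "x \<in> ?E"
    have "x \<notin> C k" for k
    proof
      assume "x \<in> C k"
      then obtain y s where s: "s \<in> K k" and y: "f y = 0" "x = y - s *\<^sub>R e"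
        by (auto simp: C_def Z_def)
      have "0 < 1 / real (Suc k)" by simp
      moreover have "1 / real (Suc k) \<le> \<bar>s\<bar>" "\<bar>s\<bar> \<le> \<delta> - 1 / real (Suc k)"
        using s by (simp_all add: K_def)
      ultimately have "0 < \<bar>s\<bar>" "\<bar>s\<bar> < \<delta>" by linarith+
      moreover have "x + s *\<^sub>R e = y" using y by simp
      ultimately show False using x y by auto
    qed
    then show "x \<in> Z - (\<Union>k. C k)" using x by (auto simp: Z_def)
  next
    fix x assume x: "x \<in> Z - (\<Union>k. C k)"
    have "f (x + s *\<^sub>R e) \<noteq> 0" if s: "0 < \<bar>s\<bar>" "\<bar>s\<bar> < \<delta>" for s
    proof
      assume f: "f (x + s *\<^sub>R e) = 0"
      have "0 < min \<bar>s\<bar> (\<delta> - \<bar>s\<bar>)" using s by simp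
      then obtain k where k: "inverse (real (Suc k)) < min \<bar>s\<bar> (\<delta> - \<bar>s\<bar>)"
        using reals_Archimedean by blast
      have "s \<in> K k" using k by (simp add: K_def inverse_eq_divide del: of_nat_Suc)
      moreover have "x = (x + s *\<^sub>R e) + (- s *\<^sub>R e)" by simp
      ultimately have "x \<in> C k" unfolding C_def Z_def using f by blast
      then show False using x by blast
    qed
    then show "x \<in> ?E" using x by (auto simp: Z_def)
  qed
  ultimately have E_borel: "?E \<in> sets borel"
    using \<open>closed Z\<close> by (auto intro!: sets.Diff sets.countable_UN borel_closed)
  have null: "negligible (?E \<inter> cball 0 R)" for R
  proof -
    define B where "B = ?E \<inter> cball 0 R"
    have "B \<in> sets borel" using E_borel by (auto simp: B_def)
    then have B: "B \<in> lmeasurable"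
      by (intro bounded_set_imp_lmeasurable) (auto simp: B_def)
    \<comment> \<open>Distinct shifts in the open interval from 0 to \<delta>. Two of them differ by
      less than \<delta>, so a common point of two translates would produce two zeros at a forbidden
      distance.\<close>
    define s where "s k = \<delta> / real (k + 2)" for k :: nat
    define T where "T k = (+) (s k *\<^sub>R e) ` B" for k
    have T: "T k \<in> lmeasurable" "measure lebesgue (T k) = measure lebesgue B" for k
      using B by (auto simp: T_def measure_translation measurable_translation)
    have s: "0 < s k" "s k < \<delta>" "s k = s j \<longleftrightarrow> k = j" for k j
      using \<open>\<delta> > 0\<close> by (auto simp: s_def divide_simps)
    have disj: "T j \<inter> T k = {}" if "j \<noteq> k" for j k
    proof (rule equals0I)
      fix x assume "x \<in> T j \<inter> T k"
      then obtain y z where y: "y \<in> B" "x = s j *\<^sub>R e + y" and z: "z \<in> B" "x = s k *\<^sub>R e + z"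
        by (auto simp: T_def)
      then have eq: "z = y + (s j - s k) *\<^sub>R e" by (simp add: algebra_simps)
      have "0 < \<bar>s j - s k\<bar>" "\<bar>s j - s k\<bar> < \<delta>"
        using s(1)[of j] s(1)[of k] s(2)[of j] s(2)[of k] s(3)[of j k] \<open>j \<noteq> k\<close> by auto
      then have "f (y + (s j - s k) *\<^sub>R e) \<noteq> 0" using y(1) unfolding B_def by blast
      then show False using z(1) unfolding eq[symmetric] B_def by blast
    qed
    have "norm (s k *\<^sub>R e + y) \<le> R + \<delta> * norm e" if "y \<in> B" for k y
    proof -
      have "norm (s k *\<^sub>R e + y) \<le> s k * norm e + norm y"
        using norm_triangle_ineq[of "s k *\<^sub>R e" y] s(1)[of k] by simp
      also have "\<dots> \<le> \<delta> * norm e + R"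
        using that s(2)[of k] by (intro add_mono mult_right_mono) (auto simp: B_def)
      finally show ?thesis by simp
    qed
    then have sub: "(\<Union>k<n. T k) \<subseteq> cball 0 (R + \<delta> * norm e)" for n
      by (auto simp: T_def)
    have bound: "real n * measure lebesgue B \<le> measure lebesgue (cball (0::'a) (R + \<delta> * norm e))" for n
    proof -
      have "measure lebesgue (\<Union>k<n. T k) = (\<Sum>k<n. measure lebesgue (T k))"
        using disj fmeasurableD[OF T(1)] fmeasurableD2[OF T(1)]
        by (intro measure_finite_Union) (auto simp: disjoint_family_on_def simp del: emeasure_completion)
      moreover have "measure lebesgue (\<Union>k<n. T k) \<le> measure lebesgue (cball (0::'a) (R + \<delta> * norm e))"
        using T sub by (intro measure_mono_fmeasurable) (auto intro!: sets.finite_UN simp: fmeasurableD)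
      ultimately show ?thesis using T by simp
    qed
    have "measure lebesgue B = 0"
    proof (rule ccontr)
      assume "measure lebesgue B \<noteq> 0"
      then have "measure lebesgue B > 0" using measure_nonneg[of lebesgue B] by linarith
      then obtain n where "measure lebesgue (cball (0::'a) (R + \<delta> * norm e)) < real n * measure lebesgue B"
        using reals_Archimedean3 by blast
      then show False using bound[of n] by linarith
    qed
    then show ?thesis using B negligible_iff_measure B_def by blast
  qed
  have "?E = (\<Union>N::nat. ?E \<inter> cball 0 (real N))"
    using real_arch_simple by (auto simp: dist_norm)
  moreover have "negligible (\<Union>(range (\<lambda>N::nat. ?E \<inter> cball 0 (real N))))"
    by (rule negligible_countable_Union) (use null in auto)
  ultimately show ?thesis by simp
qed

section \<open>From moments to the essential supremum\<close>

lemma content_unit_cube: "measure lebesgue (cbox 0 1 :: (real ^ 'n) set) = 1"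
proof -
  have "measure lborel (cbox 0 1 :: (real ^ 'n) set) = 1"
    by (subst content_cbox_cart) (auto simp: interval_ne_empty_cart)
  then show ?thesis by simp
qed

text \<open>If the norm of \<open>f\<close> exceeded the right-hand side, a level \<open>d\<close>
  in between would be exceeded by \<open>f\<close> on a set of positive measure. The moment
  inequality would then bound this measure by a power \<open>r\<close> of a ratio below 1, for every
  large \<open>r\<close>.\<close>

lemma torus_Linfty_norm_le_moments:
  fixes f f0 f1 :: "real ^ 'n \<Rightarrow> real"
  assumes cont: "continuous_on (cbox 0 1) f" "continuous_on (cbox 0 1) f0" "continuous_on (cbox 0 1) f1"
    and pos: "\<And>x. x \<in> cbox 0 1 \<Longrightarrow> f x > 0" "\<And>x. x \<in> cbox 0 1 \<Longrightarrow> f0 x > 0" "\<And>x. x \<in> cbox 0 1 \<Longrightarrow> f1 x > 0"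
    and le: "\<And>r. r \<ge> r0 \<Longrightarrow> integral (cbox 0 1) (\<lambda>x. f x powr r)
      \<le> max (integral (cbox 0 1) (\<lambda>x. f0 x powr r)) (integral (cbox 0 1) (\<lambda>x. f1 x powr r))"
  shows "torus_Linfty_norm f \<le> max (torus_Linfty_norm f0) (torus_Linfty_norm f1)"
proof (rule ccontr)
  let ?Q = "cbox 0 1 :: (real ^ 'n) set"
  let ?c = "max (torus_Linfty_norm f0) (torus_Linfty_norm f1)"
  assume "\<not> ?thesis"
  then have lt: "?c < torus_Linfty_norm f" by (simp only: not_le)
  have content: "measure lebesgue ?Q = 1" by (rule content_unit_cube)
  have meas: "(\<lambda>x. ereal \<bar>h x\<bar>) \<in> borel_measurable (lebesgue_on ?Q)" if "continuous_on ?Q h" for h :: "real ^ 'n \<Rightarrow> real"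
    using continuous_imp_measurable_on_sets_lebesgue[OF that] by simp
  have ae: "\<exists>N. negligible N \<and> (\<forall>x\<in>?Q - N. ereal (h x) \<le> torus_Linfty_norm h)"
    if "continuous_on ?Q h" "\<And>x. x \<in> ?Q \<Longrightarrow> h x > 0" for h :: "real ^ 'n \<Rightarrow> real"
  proof -
    have "AE x in lebesgue_on ?Q. ereal \<bar>h x\<bar> \<le> torus_Linfty_norm h"
      unfolding torus_Linfty_norm_def by (rule esssup_AE)
    then have "AE x in lebesgue. x \<in> ?Q \<longrightarrow> ereal \<bar>h x\<bar> \<le> torus_Linfty_norm h"
      by (simp add: AE_restrict_space_iff)
    then obtain N where N: "N \<in> null_sets lebesgue"
      "{x \<in> space lebesgue. \<not> (x \<in> ?Q \<longrightarrow> ereal \<bar>h x\<bar> \<le> torus_Linfty_norm h)} \<subseteq> N"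
      by (auto simp: eventually_ae_filter)
    have "ereal (h x) \<le> torus_Linfty_norm h" if "x \<in> ?Q - N" for x
      using N(2) that \<open>\<And>x. x \<in> ?Q \<Longrightarrow> h x > 0\<close>[of x] by auto
    then show ?thesis using N(1) negligible_iff_null_sets by blast
  qed
  obtain N0 where N0: "negligible N0" "\<And>x. x \<in> ?Q - N0 \<Longrightarrow> ereal (f0 x) \<le> ?c"
    using ae[OF cont(2) pos(2)] by (metis max.coboundedI1)
  obtain N1 where N1: "negligible N1" "\<And>x. x \<in> ?Q - N1 \<Longrightarrow> ereal (f1 x) \<le> ?c"
    using ae[OF cont(3) pos(3)] by (metis max.coboundedI2)
  \<comment> \<open>A point of the cube outside the null set shows that the bound is positive. It is
    finite because it lies strictly below another extended real, so it is a positive real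
    \<open>c\<close>.\<close>
  have "\<not> negligible ?Q" using content negligible_iff_measure by force
  then have "\<not> ?Q \<subseteq> N0" using N0(1) negligible_subset by blast
  then obtain x0 where x0: "x0 \<in> ?Q" "x0 \<notin> N0" by blast
  then have "0 < ereal (f0 x0)" using pos(2) by simp
  also have "\<dots> \<le> ?c" using N0(2) x0 by blast
  finally have "0 < ?c" .
  moreover have "?c < \<infinity>" using lt by (cases ?c) auto
  ultimately obtain c where c: "?c = ereal c" "0 < c" by (cases ?c) auto
  obtain d where d: "?c < ereal d" "ereal d < torus_Linfty_norm f"
    using ereal_dense2[OF lt] by blast
  have cd: "c < d" using d(1) unfolding c(1) by simp
  define S where "S = {x \<in> ?Q. d < f x}"
  have S: "S \<in> lmeasurable"
  proof -
    have "f \<in> borel_measurable (lebesgue_on ?Q)" using continuous_imp_measurable_on_sets_lebesgue[OF cont(1)] by simp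
    then have "{x \<in> space (lebesgue_on ?Q). d < f x} \<in> sets (lebesgue_on ?Q)" by measurable
    then have "S \<in> sets lebesgue"
      by (auto simp: S_def sets_restrict_space_iff)
    moreover have "bounded S" using bounded_cbox by (rule bounded_subset) (auto simp: S_def)
    ultimately show ?thesis by (rule bounded_set_imp_lmeasurable[rotated])
  qed
  have mS: "measure lebesgue S > 0"
  proof (rule ccontr)
    assume "\<not> ?thesis"
    then have "measure lebesgue S = 0" using measure_nonneg[of lebesgue S] by linarith
    then have null: "S \<in> null_sets lebesgue" using S negligible_iff_measure negligible_iff_null_sets by blast
    have "AE x in lebesgue. x \<in> ?Q \<longrightarrow> ereal \<bar>f x\<bar> \<le> ereal d"
      by (rule AE_I'[OF null]) (auto simp: S_def not_le dest: pos(1))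
    then have "AE x in lebesgue_on ?Q. ereal \<bar>f x\<bar> \<le> ereal d"
      by (simp add: AE_restrict_space_iff)
    then have "torus_Linfty_norm f \<le> ereal d"
      unfolding torus_Linfty_norm_def by (rule esssup_I[OF meas[OF cont(1)]])
    then show False using d(2) by simp
  qed
  have int: "(\<lambda>x. h x powr r) integrable_on ?Q"
    if "continuous_on ?Q h" "\<And>x. x \<in> ?Q \<Longrightarrow> h x > 0" for h :: "real ^ 'n \<Rightarrow> real" and r
    using that(2) by (intro integrable_continuous continuous_on_powr that(1) continuous_on_const) force
  have upper: "integral ?Q (\<lambda>x. h x powr r) \<le> c powr r"
    if "continuous_on ?Q h" and p: "\<And>x. x \<in> ?Q \<Longrightarrow> h x > 0" and "negligible N"
      and b: "\<And>x. x \<in> ?Q - N \<Longrightarrow> ereal (h x) \<le> ?c" and "r \<ge> 0" for h :: "real ^ 'n \<Rightarrow> real" and r N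
  proof -
    \<comment> \<open>The bound by \<open>c\<close> is available only off the null set
      \<open>N\<close>, so the integrand is changed to 0 on \<open>N\<close> before
      comparing.\<close>
    let ?k = "\<lambda>x. if x \<in> N then 0 else h x powr r"
    have "integral ?Q (\<lambda>x. h x powr r) = integral ?Q ?k"
      by (rule integral_spike[OF \<open>negligible N\<close>]) simp
    also have "\<dots> \<le> integral ?Q (\<lambda>x. c powr r)"
    proof (rule integral_le)
      show "?k integrable_on ?Q"
        by (rule integrable_spike[OF int[OF that(1) p] \<open>negligible N\<close>]) simp_all
      show "?k x \<le> c powr r" if "x \<in> ?Q" for x
        using b[of x] p[of x] that \<open>r \<ge> 0\<close> unfolding c(1) by (auto intro: powr_mono2)
    qed (rule integrable_continuous[OF continuous_on_const])
    also have "\<dots> = c powr r" using content by simp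
    finally show ?thesis .
  qed
  have lower: "d powr r * measure lebesgue S \<le> integral ?Q (\<lambda>x. f x powr r)" if "r \<ge> 0" for r
  proof -
    have iS: "(\<lambda>x. f x powr r) integrable_on S"
    proof -
      have "(\<lambda>x. f x powr r) absolutely_integrable_on ?Q"
        using int[OF cont(1) pos(1)] by (intro nonnegative_absolutely_integrable_1) auto
      then have "(\<lambda>x. f x powr r) absolutely_integrable_on S"
        by (rule set_integrable_subset) (use S in \<open>auto simp: S_def fmeasurableD\<close>)
      then show ?thesis by (rule set_lebesgue_integral_eq_integral(1))
    qed
    have "d powr r * measure lebesgue S = integral S (\<lambda>x. d powr r)"
      using S lmeasure_integral[OF S] integral_mult_right[of S "d powr r" "\<lambda>x. 1"] by simp
    also have "\<dots> \<le> integral S (\<lambda>x. f x powr r)"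
    proof (rule integral_le[OF _ iS])
      show "(\<lambda>x. d powr r) integrable_on S" using S by (simp add: integrable_on_const)
      show "d powr r \<le> f x powr r" if "x \<in> S" for x
        using that \<open>r \<ge> 0\<close> cd c(2) by (auto simp: S_def intro!: powr_mono2)
    qed
    also have "\<dots> \<le> integral ?Q (\<lambda>x. f x powr r)"
      by (rule integral_subset_le[OF _ iS int[OF cont(1) pos(1)]]) (auto simp: S_def)
    finally show ?thesis .
  qed
  have key: "measure lebesgue S \<le> (c / d) powr r" if "r \<ge> max r0 0" for r
  proof -
    have "d powr r * measure lebesgue S \<le> c powr r"
      using lower[of r] le[of r] upper[OF cont(2) pos(2) N0, of r] upper[OF cont(3) pos(3) N1, of r] that
      by linarith
    moreover have "d powr r > 0" using cd c(2) by simp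
    ultimately show ?thesis using cd c(2) by (simp add: powr_divide field_simps)
  qed
  have "((\<lambda>r. (c / d) powr r) \<longlongrightarrow> 0) at_top"
  proof -
    have "ln (c / d) < 0" using cd c(2) by simp
    then have "filterlim (\<lambda>r. r * ln (c / d)) at_bot at_top"
      by (subst mult.commute) (intro filterlim_tendsto_neg_mult_at_bot[OF tendsto_const] filterlim_ident)
    then have "((\<lambda>r. exp (r * ln (c / d))) \<longlongrightarrow> 0) at_top"
      by (rule filterlim_compose[OF exp_at_bot])
    then show ?thesis using cd c(2) by (simp add: powr_def)
  qed
  then have "\<forall>\<^sub>F r in at_top. (c / d) powr r < measure lebesgue S"
    using mS by (rule order_tendstoD(2))
  then have "\<forall>\<^sub>F r in at_top. (c / d) powr r < measure lebesgue S \<and> r \<ge> max r0 0"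
    by (intro eventually_conj eventually_ge_at_top)
  then obtain r where "(c / d) powr r < measure lebesgue S" "r \<ge> max r0 0"
    using eventually_happens by force
  then show False using key[of r] by linarith
qed

text \<open>An interior value above both end values would give, by the mean value theorem on each
  side of \<open>t\<close>, a positive slope followed by a negative one. At the end points only
  continuity is available.\<close>

lemma le_max_of_mono_deriv:
  fixes J N :: "real \<Rightarrow> real"
  assumes cont: "continuous_on {0..T} J"
    and der: "\<And>t. 0 < t \<Longrightarrow> t < T \<Longrightarrow> (J has_field_derivative N t) (at t)"
    and mono: "\<And>t t'. 0 < t \<Longrightarrow> t \<le> t' \<Longrightarrow> t' < T \<Longrightarrow> N t \<le> N t'"
    and t: "t \<in> {0..T}"
  shows "J t \<le> max (J 0) (J T)"
proof (rule ccontr)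
  assume "\<not> ?thesis"
  then have gt: "J t > J 0" "J t > J T" by auto
  then have t': "0 < t" "t < T" using t by (auto simp: less_le)
  have diff: "J differentiable at r" if "0 < r" "r < T" for r
    using der[OF that] by (auto simp: real_differentiable_def)
  obtain l1 r1 where 1: "0 < r1" "r1 < t" "(J has_field_derivative l1) (at r1)" "J t - J 0 = (t - 0) * l1"
  proof -
    have "continuous_on {0..t} J" by (rule continuous_on_subset[OF cont]) (use t' in auto)
    moreover have "J differentiable at r" if "0 < r" "r < t" for r using diff that t' by simp
    ultimately obtain l r where "0 < r" "r < t" "(J has_field_derivative l) (at r)" "J t - J 0 = (t - 0) * l"
      using MVT[OF t'(1), of J] by blast
    then show ?thesis by (rule that)
  qed
  obtain l2 r2 where 2: "t < r2" "r2 < T" "(J has_field_derivative l2) (at r2)" "J T - J t = (T - t) * l2"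
  proof -
    have "continuous_on {t..T} J" by (rule continuous_on_subset[OF cont]) (use t' in auto)
    moreover have "J differentiable at r" if "t < r" "r < T" for r using diff that t' by simp
    ultimately obtain l r where "t < r" "r < T" "(J has_field_derivative l) (at r)" "J T - J t = (T - t) * l"
      using MVT[OF t'(2), of J] by blast
    then show ?thesis by (rule that)
  qed
  have "l1 = N r1" using DERIV_unique[OF 1(3) der] 1 t' by simp
  moreover have "l2 = N r2" using DERIV_unique[OF 2(3) der] 2 t' by simp
  moreover have "N r1 \<le> N r2" using mono[of r1 r2] 1 2 by simp
  moreover have "0 < t * l1" using 1(4) gt by simp
  then have "l1 > 0" using t' by (simp add: zero_less_mult_iff)
  moreover have "(T - t) * l2 < 0" using 2(4) gt by linarith
  then have "l2 < 0" using t' by (simp add: mult_less_0_iff)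
  ultimately show False by linarith
qed

section \<open>Algebraic inequalities\<close>

lemma quadratic_form_nonneg:
  fixes A B C x y :: real
  assumes "A > 0" "B\<^sup>2 \<le> 4 * A * C"
  shows "A * x\<^sup>2 + B * x * y + C * y\<^sup>2 \<ge> 0"
proof -
  have "4 * A * (A * x\<^sup>2 + B * x * y + C * y\<^sup>2) = (2 * A * x + B * y)\<^sup>2 + (4 * A * C - B\<^sup>2) * y\<^sup>2"
    by (simp add: power2_eq_square algebra_simps)
  also have "\<dots> \<ge> 0" using assms by simp
  finally show ?thesis using assms(1) by (simp add: zero_le_mult_iff)
qed

lemma sum_Cauchy_Schwarz:
  fixes f g :: "'i::finite \<Rightarrow> real"
  shows "(\<Sum>i\<in>UNIV. f i * g i)\<^sup>2 \<le> (\<Sum>i\<in>UNIV. f i * f i) * (\<Sum>i\<in>UNIV. g i * g i)"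
  using Cauchy_Schwarz_ineq_sum[of f g UNIV] by (simp add: power2_eq_square)

section \<open>Trace inequalities for a symmetric matrix with a rank-one correction\<close>

context
  fixes H :: "'i::finite \<Rightarrow> 'i \<Rightarrow> real" and p h :: "'i \<Rightarrow> real"
  assumes sym: "H i j = H j i" and h_def: "h i = (\<Sum>j\<in>UNIV. H i j * p j)"
begin

text \<open>Symmetry of \<open>H\<close> and \<open>h = H p\<close> reduce every double sum to the
  three scalars |H|^2, |h|^2 and h . p. With \<open>b = (\<beta> - 2) / s\<close> and the Hessian of
  \<open>u\<close> for \<open>H\<close>, the first factor is the Jacobian of \<open>q\<close> up to
  the scalar \<open>k\<close>.\<close>

lemma trace_expand:
  fixes b w \<zeta> :: real
  shows "(\<Sum>i\<in>UNIV. \<Sum>j\<in>UNIV. (H j i + b * (h i * p j)) * (\<zeta> * (H i j + b * (h j * p i)) + w * (h j * p i)))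
    = \<zeta> * ((\<Sum>i\<in>UNIV. \<Sum>j\<in>UNIV. H i j * H i j) + 2 * b * (\<Sum>i\<in>UNIV. h i * h i) + b\<^sup>2 * (\<Sum>i\<in>UNIV. h i * p i)\<^sup>2)
      + w * ((\<Sum>i\<in>UNIV. h i * h i) + b * (\<Sum>i\<in>UNIV. h i * p i)\<^sup>2)"
proof -
  let ?hh = "\<Sum>i\<in>UNIV. h i * h i" and ?hp = "\<Sum>i\<in>UNIV. h i * p i"
  have 1: "(\<Sum>i\<in>UNIV. \<Sum>j\<in>UNIV. H i j * p j * h i) = ?hh"
    by (simp add: h_def sum_distrib_right)
  have 2: "(\<Sum>i\<in>UNIV. \<Sum>j\<in>UNIV. H i j * p i * h j) = ?hh"
    by (subst sum.swap) (simp add: h_def sum_distrib_right sym[of _ "_ :: 'i"])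
  have 3: "(\<Sum>i\<in>UNIV. (h i * p i) * ?hp) = ?hp\<^sup>2"
    by (simp add: power2_eq_square sum_distrib_right)
  have "(H j i + b * (h i * p j)) * (\<zeta> * (H i j + b * (h j * p i)) + w * (h j * p i))
    = \<zeta> * (H i j * H i j) + (\<zeta> * b + w) * (H i j * p i * h j) + (b * \<zeta>) * (H i j * p j * h i)
      + (\<zeta> * b\<^sup>2 + w * b) * ((h i * p i) * (h j * p j))" for i j
    using sym[of j i] by (simp add: power2_eq_square algebra_simps)
  then have "(\<Sum>i\<in>UNIV. \<Sum>j\<in>UNIV. (H j i + b * (h i * p j)) * (\<zeta> * (H i j + b * (h j * p i)) + w * (h j * p i)))
    = \<zeta> * (\<Sum>i\<in>UNIV. \<Sum>j\<in>UNIV. H i j * H i j) + (\<zeta> * b + w) * ?hh + (b * \<zeta>) * ?hh + (\<zeta> * b\<^sup>2 + w * b) * ?hp\<^sup>2"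
    by (simp only: sum.distrib sum_distrib_left[symmetric] 1 2 3)
  then show ?thesis by (simp add: algebra_simps)
qed

text \<open>With \<open>\<gamma> = sqrt (1 + c) - 1\<close> and \<open>B = I + \<gamma> \<Pi>\<close>, where \<open>\<Pi>\<close> is the orthogonal projection onto
  the line of \<open>p\<close>, the left-hand side is the squared Frobenius norm of \<open>B H B\<close>.\<close>

lemma trace_square_nonneg:
  assumes s: "s = (\<Sum>i\<in>UNIV. p i * p i)" "s > 0" and "c > -1"
  shows "(\<Sum>i\<in>UNIV. \<Sum>j\<in>UNIV. H i j * H i j) + 2 * (c / s) * (\<Sum>i\<in>UNIV. h i * h i)
    + (c / s)\<^sup>2 * (\<Sum>i\<in>UNIV. h i * p i)\<^sup>2 \<ge> 0"
proof -
  define \<gamma> where "\<gamma> = sqrt (1 + c) - 1"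
  have c: "c = 2 * \<gamma> + \<gamma>\<^sup>2"
    using \<open>c > -1\<close> by (simp add: \<gamma>_def power2_diff)
  define \<kappa> where "\<kappa> = 1 / s"
  have \<kappa>: "\<kappa> * s = 1" using s(2) by (simp add: \<kappa>_def)
  let ?hh = "\<Sum>i\<in>UNIV. h i * h i" and ?hp = "\<Sum>i\<in>UNIV. h i * p i"
  have 1: "(\<Sum>i\<in>UNIV. \<Sum>j\<in>UNIV. H i j * p j * h i) = ?hh"
    by (simp add: h_def sum_distrib_right)
  have 2: "(\<Sum>i\<in>UNIV. \<Sum>j\<in>UNIV. H i j * p i * h j) = ?hh"
    by (subst sum.swap) (simp add: h_def sum_distrib_right sym[of _ "_ :: 'i"])
  have 3: "(\<Sum>i\<in>UNIV. (h i * p i) * ?hp) = ?hp\<^sup>2"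
    by (simp add: power2_eq_square sum_distrib_right)
  have 4: "(\<Sum>i\<in>UNIV. \<Sum>j\<in>UNIV. H i j * p j * p i) = ?hp"
    by (simp add: h_def sum_distrib_right)
  have 5: "(\<Sum>i\<in>UNIV. (p i * p i) * ?hh) = s * ?hh"
    "(\<Sum>i\<in>UNIV. (h i * h i) * (\<Sum>j\<in>UNIV. p j * p j)) = s * ?hh"
    by (simp_all add: s(1) sum_distrib_right[symmetric])
  have 6: "(\<Sum>i\<in>UNIV. (p i * p i) * ?hp) = s * ?hp"
    "(\<Sum>i\<in>UNIV. (h i * p i) * (\<Sum>j\<in>UNIV. p j * p j)) = s * ?hp"
    by (simp_all add: s(1) sum_distrib_right[symmetric])
  have 7: "(\<Sum>i\<in>UNIV. (p i * p i) * (\<Sum>j\<in>UNIV. p j * p j)) = s * s"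
    by (simp add: s(1) sum_distrib_right[symmetric])
  \<comment> \<open>The entries of the matrix \<open>B H B\<close>, where
    \<open>\<kappa> * (p i * p j)\<close> are the entries of the projection. Its square sum
    reproduces the trace because B^2 is the identity plus \<open>c\<close> times the
    projection.\<close>
  let ?B = "\<lambda>i j. H i j + \<gamma> * \<kappa> * (p i * h j + h i * p j) + \<gamma>\<^sup>2 * \<kappa>\<^sup>2 * ?hp * (p i * p j)"
  have "?B i j * ?B i j = H i j * H i j
      + (2 * \<gamma> * \<kappa>) * (H i j * p i * h j) + (2 * \<gamma> * \<kappa>) * (H i j * p j * h i)
      + (2 * \<gamma>\<^sup>2 * \<kappa>\<^sup>2 * ?hp) * (H i j * p j * p i)
      + (\<gamma>\<^sup>2 * \<kappa>\<^sup>2) * ((p i * p i) * (h j * h j)) + (\<gamma>\<^sup>2 * \<kappa>\<^sup>2) * ((h i * h i) * (p j * p j))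
      + (2 * \<gamma>\<^sup>2 * \<kappa>\<^sup>2) * ((h i * p i) * (h j * p j))
      + (2 * \<gamma> ^ 3 * \<kappa> ^ 3 * ?hp) * ((p i * p i) * (h j * p j))
      + (2 * \<gamma> ^ 3 * \<kappa> ^ 3 * ?hp) * ((h i * p i) * (p j * p j))
      + (\<gamma> ^ 4 * \<kappa> ^ 4 * ?hp\<^sup>2) * ((p i * p i) * (p j * p j))" for i j
    by (simp add: power2_eq_square power3_eq_cube power4_eq_xxxx algebra_simps)
  then have "(\<Sum>i\<in>UNIV. \<Sum>j\<in>UNIV. ?B i j * ?B i j) = (\<Sum>i\<in>UNIV. \<Sum>j\<in>UNIV. H i j * H i j)
      + (2 * \<gamma> * \<kappa>) * ?hh + (2 * \<gamma> * \<kappa>) * ?hh + (2 * \<gamma>\<^sup>2 * \<kappa>\<^sup>2 * ?hp) * ?hp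
      + (\<gamma>\<^sup>2 * \<kappa>\<^sup>2) * (s * ?hh) + (\<gamma>\<^sup>2 * \<kappa>\<^sup>2) * (s * ?hh) + (2 * \<gamma>\<^sup>2 * \<kappa>\<^sup>2) * ?hp\<^sup>2
      + (2 * \<gamma> ^ 3 * \<kappa> ^ 3 * ?hp) * (s * ?hp) + (2 * \<gamma> ^ 3 * \<kappa> ^ 3 * ?hp) * (s * ?hp)
      + (\<gamma> ^ 4 * \<kappa> ^ 4 * ?hp\<^sup>2) * (s * s)"
    by (simp only: sum.distrib sum_distrib_left[symmetric] 1 2 3 4 5 6 7)
  also have "\<dots> = (\<Sum>i\<in>UNIV. \<Sum>j\<in>UNIV. H i j * H i j) + 2 * (c * \<kappa>) * ?hh + (c * \<kappa>)\<^sup>2 * ?hp\<^sup>2"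
  proof -
    have "\<kappa>\<^sup>2 * s = \<kappa>" "\<kappa> ^ 3 * s = \<kappa>\<^sup>2"
      using \<kappa> by (simp_all add: power2_eq_square power3_eq_cube mult.assoc)
    moreover have "\<kappa> ^ 4 * (s * s) = (\<kappa> * s) * (\<kappa> * s) * \<kappa>\<^sup>2"
      by (simp add: power2_eq_square power4_eq_xxxx)
    then have "\<kappa> ^ 4 * (s * s) = \<kappa>\<^sup>2" using \<kappa> by simp
    moreover have "(\<gamma>\<^sup>2 * \<kappa>\<^sup>2) * (s * ?hh) = \<gamma>\<^sup>2 * (\<kappa>\<^sup>2 * s) * ?hh"
      "(2 * \<gamma> ^ 3 * \<kappa> ^ 3 * ?hp) * (s * ?hp) = 2 * \<gamma> ^ 3 * (\<kappa> ^ 3 * s) * ?hp\<^sup>2"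
      "(\<gamma> ^ 4 * \<kappa> ^ 4 * ?hp\<^sup>2) * (s * s) = \<gamma> ^ 4 * (\<kappa> ^ 4 * (s * s)) * ?hp\<^sup>2"
      by (simp_all only: mult_ac power2_eq_square)
    ultimately have e: "(\<gamma>\<^sup>2 * \<kappa>\<^sup>2) * (s * ?hh) = \<gamma>\<^sup>2 * \<kappa> * ?hh"
      "(2 * \<gamma> ^ 3 * \<kappa> ^ 3 * ?hp) * (s * ?hp) = 2 * \<gamma> ^ 3 * \<kappa>\<^sup>2 * ?hp\<^sup>2"
      "(\<gamma> ^ 4 * \<kappa> ^ 4 * ?hp\<^sup>2) * (s * s) = \<gamma> ^ 4 * \<kappa>\<^sup>2 * ?hp\<^sup>2"
      by (simp_all only:)
    show ?thesis unfolding e c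
      by (simp add: power2_eq_square power3_eq_cube power4_eq_xxxx algebra_simps)
  qed
  finally have "(\<Sum>i\<in>UNIV. \<Sum>j\<in>UNIV. H i j * H i j) + 2 * (c * \<kappa>) * ?hh + (c * \<kappa>)\<^sup>2 * ?hp\<^sup>2
    = (\<Sum>i\<in>UNIV. \<Sum>j\<in>UNIV. ?B i j * ?B i j)" by simp
  also have "\<dots> \<ge> 0" by (intro sum_nonneg) simp
  finally show ?thesis by (simp add: \<kappa>_def)
qed

text \<open>The part with \<open>\<zeta>\<close> is nonnegative by
  \<open>trace_square_nonneg\<close>. In the part with \<open>w\<close>, Cauchy-Schwarz bounds |h|^2
  below by (h . p)^2 / s, which leaves the factor \<open>c + 1\<close>.\<close>

lemma trace_lower_bound:
  assumes s: "s = (\<Sum>i\<in>UNIV. p i * p i)" "s > 0" and "c > -1" and "\<zeta> \<ge> 0" "w \<ge> 0"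
  shows "(\<Sum>i\<in>UNIV. \<Sum>j\<in>UNIV. (H j i + c / s * (h i * p j)) * (\<zeta> * (H i j + c / s * (h j * p i)) + w / s * (h j * p i)))
    \<ge> w * (c + 1) * ((\<Sum>i\<in>UNIV. h i * p i) / s)\<^sup>2"
proof -
  let ?hh = "\<Sum>i\<in>UNIV. h i * h i" and ?hp = "\<Sum>i\<in>UNIV. h i * p i"
  have "?hp\<^sup>2 \<le> ?hh * s" using sum_Cauchy_Schwarz[of h p] s(1) by simp
  then have "?hp\<^sup>2 / s \<le> ?hh" using s(2) by (simp add: divide_simps)
  then have "w / s * (?hp\<^sup>2 / s + c / s * ?hp\<^sup>2) \<le> w / s * (?hh + c / s * ?hp\<^sup>2)"
    using \<open>w \<ge> 0\<close> s(2) by (intro mult_left_mono add_right_mono) auto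
  moreover have "w / s * (?hp\<^sup>2 / s + c / s * ?hp\<^sup>2) = w * (c + 1) * (?hp / s)\<^sup>2"
    using s(2) by (simp add: field_simps power2_eq_square)
  ultimately show ?thesis
    unfolding trace_expand using mult_nonneg_nonneg[OF \<open>\<zeta> \<ge> 0\<close> trace_square_nonneg[OF assms(1-3)]] by linarith
qed

end

text \<open>The left side splits by weights. The weight \<open>\<zeta>\<close> carries a quadratic
  form in \<open>D\<close> and \<open>S\<close>, nonnegative by the discriminant condition. The
  weight \<open>\<omega>\<close> carries \<open>E * y\<close>, where
  \<open>E = (1 - 1 / \<rho>) * D - a * S\<close>; the square of \<open>y\<close> gained from
  \<open>Tr / \<rho>\<close> absorbs it up to a multiple of the square of \<open>E\<close>.\<close>

lemma pointwise_convexity_bound: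
  fixes D S y :: real
  assumes "\<zeta> \<ge> 0" "\<omega> \<ge> 0" "\<rho> > 1" "b > 0" and disc: "a\<^sup>2 \<le> 4 * (1 - 1 / \<rho>) * K" and Tr: "Tr \<ge> \<omega> * b * y\<^sup>2"
  shows "(D + (1 - a) * S) * (\<zeta> * D + \<omega> * y) + K * \<zeta> * S\<^sup>2 + Tr / \<rho> - (S + D / \<rho>) * (\<zeta> * D + \<omega> * y)
    \<ge> - (\<omega> * (\<rho> * ((1 - 1 / \<rho>) * D - a * S)\<^sup>2 / (4 * b)))"
proof -
  define \<kappa> where "\<kappa> = 1 / \<rho>"
  have \<kappa>: "0 < \<kappa>" "\<kappa> < 1" "\<kappa> * \<rho> = 1" using \<open>\<rho> > 1\<close> by (auto simp: \<kappa>_def)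
  define E where "E = (1 - \<kappa>) * D - a * S"
  have Q: "(1 - \<kappa>) * D\<^sup>2 + (- a) * D * S + K * S\<^sup>2 \<ge> 0"
    by (rule quadratic_form_nonneg) (use disc \<kappa> in \<open>auto simp: \<kappa>_def\<close>)
  have "(\<kappa> * b) * y\<^sup>2 + E * y * 1 + (E\<^sup>2 * \<rho> / (4 * b)) * 1\<^sup>2 \<ge> 0"
  proof (rule quadratic_form_nonneg)
    have "4 * (\<kappa> * b) * (E\<^sup>2 * \<rho> / (4 * b)) = (\<kappa> * \<rho>) * E\<^sup>2" using \<open>b > 0\<close> by simp
    then show "E\<^sup>2 \<le> 4 * (\<kappa> * b) * (E\<^sup>2 * \<rho> / (4 * b))" using \<kappa>(3) by simp
  qed (use \<kappa>(1) \<open>b > 0\<close> in simp)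
  then have R: "\<omega> * ((\<kappa> * b) * y\<^sup>2 + E * y + \<rho> * E\<^sup>2 / (4 * b)) \<ge> 0" using \<open>\<omega> \<ge> 0\<close> by (simp add: mult.commute)
  have "\<kappa> * (\<omega> * b * y\<^sup>2) \<le> \<kappa> * Tr" using Tr \<kappa> by (intro mult_left_mono) auto
  moreover have "\<zeta> * ((1 - \<kappa>) * D\<^sup>2 + (- a) * D * S + K * S\<^sup>2) \<ge> 0" using Q \<open>\<zeta> \<ge> 0\<close> by simp
  moreover have "(D + (1 - a) * S) * (\<zeta> * D + \<omega> * y) + K * \<zeta> * S\<^sup>2 + \<kappa> * Tr - (S + \<kappa> * D) * (\<zeta> * D + \<omega> * y)
      = \<zeta> * ((1 - \<kappa>) * D\<^sup>2 + (- a) * D * S + K * S\<^sup>2) + \<omega> * ((\<kappa> * b) * y\<^sup>2 + E * y + \<rho> * E\<^sup>2 / (4 * b))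
        - \<omega> * (\<rho> * E\<^sup>2 / (4 * b)) + (\<kappa> * Tr - \<kappa> * (\<omega> * b * y\<^sup>2))"
    unfolding E_def by (simp add: algebra_simps power2_eq_square)
  ultimately have "(D + (1 - a) * S) * (\<zeta> * D + \<omega> * y) + K * \<zeta> * S\<^sup>2 + \<kappa> * Tr - (S + \<kappa> * D) * (\<zeta> * D + \<omega> * y)
    \<ge> - (\<omega> * (\<rho> * E\<^sup>2 / (4 * b)))" using R by linarith
  then show ?thesis by (simp add: \<kappa>_def E_def)
qed

section \<open>The logarithmic cutoff\<close>

lemma dird_slice:
  assumes "f differentiable at (x, t)"
  shows "dird (\<lambda>y. f (y, t)) v x = dird f (v, 0) (x, t)"
    "(\<lambda>y. f (y, t)) differentiable at x"
proof -
  have l: "((\<lambda>y. (y, t)) has_derivative (\<lambda>v. (v, 0))) (at x)"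
    by (auto intro!: derivative_eq_intros)
  have d: "((\<lambda>y. f (y, t)) has_derivative (\<lambda>v. dird f (v, 0) (x, t))) (at x)"
    using has_derivative_compose[OF l has_derivative_dird[OF assms]] .
  show "dird (\<lambda>y. f (y, t)) v x = dird f (v, 0) (x, t)" by (rule dird_eq[OF d])
  show "(\<lambda>y. f (y, t)) differentiable at x" using d by (auto simp: differentiable_def)
qed

lemma deriv_time_slice:
  assumes "f differentiable at (x, t :: real)"
  shows "((\<lambda>s. f (x, s)) has_field_derivative dird f (0, 1) (x, t)) (at t)"
proof -
  have "f differentiable at ((x, 0) + t *\<^sub>R (0, 1))" using assms by simp
  from dird_along_line[OF this] show ?thesis by simp
qed

lemma divergence_eq_sum_dird:
  assumes "F differentiable at x"
  shows "divergence F x = (\<Sum>i\<in>UNIV. dird (\<lambda>y. F y $ i) (axis i 1) x)"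
proof -
  have F: "(F has_derivative frechet_derivative F (at x)) (at x)"
    using assms frechet_derivative_works by blast
  have "dird (\<lambda>y. F y $ i) v x = frechet_derivative F (at x) v $ i" for i v
    by (rule dird_eq) (rule bounded_linear.has_derivative[OF bounded_linear_vec_nth F])
  then show ?thesis by (simp add: divergence_def trace_def jacobian_def matrix_def)
qed

text \<open>The value at arguments \<le> 0 is fixed by a separate case, so that it does not depend
  on the convention for \<open>ln\<close> there. For fixed \<open>r > 0\<close> the value tends to 1
  as \<open>\<iota>\<close> tends to 0.\<close>

definition cutoff :: "real \<Rightarrow> real \<Rightarrow> real" where
  "cutoff \<iota> r = (if r \<le> 0 then 0 else (max 0 (1 + \<iota> * ln r)) ^ 3)"

lemma cutoff_nonneg: "cutoff \<iota> r \<ge> 0"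
  by (simp add: cutoff_def)

lemma cutoff_eq_0:
  assumes "\<iota> > 0" "r < exp (- 1 / \<iota>)"
  shows "cutoff \<iota> r = 0"
proof (cases "r \<le> 0")
  case False
  then have "ln r < - 1 / \<iota>" using assms by (metis exp_gt_zero ln_exp ln_less_cancel_iff not_le)
  then have "1 + \<iota> * ln r < 0" using assms(1) by (simp add: field_simps)
  then show ?thesis by (simp add: cutoff_def)
qed (simp add: cutoff_def)

lemma Cdiff_affine_ln: "Cdiff k (\<lambda>r. 1 + \<iota> * ln r) {0<..}"
  by (intro Cdiff_add Cdiff_mult Cdiff_const Cdiff_ln open_greaterThan)

lemma Cdiff_cutoff: "Cdiff (Suc (Suc 0)) (cutoff \<iota>) {0<..}"
proof (rule Cdiff_congI[OF open_greaterThan])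
  show "Cdiff (Suc (Suc 0)) (\<lambda>r. (max 0 (1 + \<iota> * ln r)) ^ 3) {0<..}"
    by (rule Cdiff_compose[OF open_greaterThan _ Cdiff_cube_pos Cdiff_affine_ln]) simp
qed (simp add: cutoff_def)

text \<open>The derivative times \<open>r\<close> carries a factor \<open>\<iota>\<close>: this is
  the slow variation on the logarithmic scale. At \<open>r = s z\<close>, twice this product is
  \<open>\<omega> \<iota> z\<close>.\<close>

lemma DERIV_cutoff:
  assumes "r > 0"
  shows "(cutoff \<iota> has_field_derivative 3 * \<iota> * (max 0 (1 + \<iota> * ln r))\<^sup>2 / r) (at r)"
proof -
  have 1: "((\<lambda>r. 1 + \<iota> * ln r) has_field_derivative \<iota> / r) (at r)"
    using assms by (auto intro!: derivative_eq_intros)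
  have 2: "((\<lambda>s::real. (max 0 s) ^ 3) has_field_derivative 3 * (max 0 (1 + \<iota> * ln r))\<^sup>2) (at (1 + \<iota> * ln r))"
    using has_derivative_pos_power[of 1 "1 + \<iota> * ln r"] by (simp add: numeral_3_eq_3 numeral_2_eq_2)
  have "((\<lambda>r. (max 0 (1 + \<iota> * ln r)) ^ 3) has_field_derivative 3 * (max 0 (1 + \<iota> * ln r))\<^sup>2 * (\<iota> / r)) (at r)"
    by (rule DERIV_chain2[OF 2 1])
  then have "(cutoff \<iota> has_field_derivative 3 * (max 0 (1 + \<iota> * ln r))\<^sup>2 * (\<iota> / r)) (at r)"
    by (rule has_field_derivative_transform_within_open[where S = "{0<..}"]) (use assms in \<open>auto simp: cutoff_def\<close>)
  then show ?thesis by (simp add: mult_ac)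
qed

section \<open>The regularized flux\<close>

locale congestion_MFG =
  fixes T \<alpha> \<beta> :: real and g :: "real \<Rightarrow> real" and u m :: "(real ^ 'n) \<times> real \<Rightarrow> real"
  assumes T_pos: "T > 0" and \<alpha>_pos: "\<alpha> > 0" and \<beta>_gt: "\<beta> > 1"
    and g_smooth: "Cinfinity_on g {0<..}" and g_mono: "mono_on {0<..} g"
    and u_smooth: "Cinfinity_on u (UNIV \<times> {0..T})" and m_smooth: "Cinfinity_on m (UNIV \<times> {0..T})"
    and u_periodic: "\<forall>t\<in>{0..T}. torus_periodic (\<lambda>x. u (x, t))"
    and m_periodic: "\<forall>t\<in>{0..T}. torus_periodic (\<lambda>x. m (x, t))"
    and m_pos: "\<forall>x. \<forall>t\<in>{0..T}. m (x, t) > 0"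
    and solution: "solves_congestion_MFG T \<alpha> \<beta> g u m"
begin

definition a where "a = \<alpha> * (\<beta> - 1)"

definition Om :: "((real ^ 'n) \<times> real) set" where "Om = UNIV \<times> {0<..<T}"

abbreviation ex :: "'n \<Rightarrow> (real ^ 'n) \<times> real" where "ex i \<equiv> (axis i 1, 0)"
abbreviation et :: "(real ^ 'n) \<times> real" where "et \<equiv> (0, 1)"

definition M where "M z = ln (m z)"
definition p where "p i = dird u (ex i)"
definition s where "s z = (\<Sum>i\<in>UNIV. p i z * p i z)"
definition P where "P = {z \<in> Om. s z > 0}"
definition k where "k z = s z powr ((\<beta> - 2) / 2)"
definition q where "q i z = k z * p i z"
text \<open>A \<open>C\<^sup>2\<close> substitute for \<open>q\<close> that vanishes near \<open>Du = 0\<close>, where \<open>q\<close> need not be smooth.\<close>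

definition X where "X \<iota> i z = cutoff \<iota> (s z) * q i z"
definition dX where "dX \<iota> i j = dird (X \<iota> i) (ex j)"
definition divX where "divX \<iota> z = (\<Sum>i\<in>UNIV. dX \<iota> i i z)"
definition D where "D z = (\<Sum>i\<in>UNIV. dird (q i) (ex i) z)"
definition S where "S z = (\<Sum>i\<in>UNIV. q i z * dird M (ex i) z)"
definition \<omega> where "\<omega> \<iota> z = 6 * \<iota> * (max 0 (1 + \<iota> * ln (s z)))\<^sup>2"
definition h where "h i z = (\<Sum>j\<in>UNIV. dird (p i) (ex j) z * p j z)"
definition y where "y z = k z * (\<Sum>i\<in>UNIV. h i z * p i z) / s z"

section \<open>Regularity on the open cylinder and gluing across the critical set\<close>

lemma open_Om: "open Om" unfolding Om_def by (intro open_Times) auto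

lemma Om_sub: "Om \<subseteq> UNIV \<times> {0..T}" by (auto simp: Om_def)

lemma Cdiff_u: "Cdiff n u Om" and Cdiff_m: "Cdiff n m Om"
  using u_smooth m_smooth Ck_on_imp_Cdiff[OF open_Om Om_sub] unfolding Cinfinity_on_def by auto

lemma Cdiff_g: "Cdiff n g {0<..}"
  using g_smooth Ck_on_imp_Cdiff[OF open_greaterThan order_refl] unfolding Cinfinity_on_def by blast

lemma m_Om: "z \<in> Om \<Longrightarrow> m z > 0"
  using m_pos by (auto simp: Om_def)

lemma Cdiff_M: "Cdiff n M Om"
  unfolding M_def[abs_def] by (rule Cdiff_compose[OF open_Om _ Cdiff_ln Cdiff_m]) (simp add: m_Om)

lemma exp_M: "z \<in> Om \<Longrightarrow> exp (M z) = m z"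
  by (simp add: M_def m_Om)

lemma Cdiff_p: "Cdiff n (p i) Om"
  unfolding p_def using Cdiff_u[of "Suc n"] by simp

lemma Cdiff_s: "Cdiff n s Om"
  unfolding s_def[abs_def] by (intro Cdiff_sum Cdiff_mult open_Om Cdiff_p)

lemma s_nonneg: "s z \<ge> 0" unfolding s_def by (intro sum_nonneg) simp

lemma s_eq_0: "s z = 0 \<longleftrightarrow> (\<forall>i. p i z = 0)"
  unfolding s_def by (subst sum_nonneg_eq_0_iff) auto

lemma P_Om: "z \<in> P \<Longrightarrow> z \<in> Om" and s_pos: "z \<in> P \<Longrightarrow> s z > 0"
  by (auto simp: P_def)

lemma open_P: "open P"
proof -
  have "open (Om \<inter> s -` {0<..})"
    by (rule continuous_open_preimage[OF Cdiff_continuous[OF Cdiff_s[of 0]] open_Om]) simp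
  moreover have "P = Om \<inter> s -` {0<..}" by (auto simp: P_def)
  ultimately show ?thesis by simp
qed

lemma Cdiff_P: "Cdiff n f Om \<Longrightarrow> Cdiff n f P"
  by (rule Cdiff_subset) (auto dest: P_Om)

lemma Cdiff_exp_M: "Cdiff n (\<lambda>z. exp (c * M z)) Om"
  by (rule Cdiff_compose[OF open_Om _ Cdiff_exp]) (auto intro!: Cdiff_mult open_Om Cdiff_const Cdiff_M)

lemma Cdiff_k: "Cdiff n k P"
  unfolding k_def[abs_def]
  by (rule Cdiff_compose[OF open_P _ Cdiff_powr Cdiff_P[OF Cdiff_s]]) (simp add: s_pos)

lemma Cdiff_q: "Cdiff n (q i) P"
  unfolding q_def[abs_def] by (intro Cdiff_mult open_P Cdiff_k Cdiff_P Cdiff_p)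

lemma Cdiff_cutoff_s: "Cdiff (Suc (Suc 0)) (\<lambda>z. cutoff \<iota> (s z)) P"
  by (rule Cdiff_compose[OF open_P _ Cdiff_cutoff Cdiff_P[OF Cdiff_s]]) (simp add: s_pos)

lemma Cdiff_X_P: "Cdiff (Suc (Suc 0)) (X \<iota> i) P"
  unfolding X_def[abs_def] by (intro Cdiff_mult open_P Cdiff_cutoff_s Cdiff_q)

text \<open>An open set that contains all critical points of \<open>u\<close> and on which the
  cutoff vanishes identically. It overlaps \<open>P\<close>, and together they cover the
  cylinder.\<close>

definition P0 where "P0 \<iota> = {z \<in> Om. s z < exp (- 1 / \<iota>)}"

lemma open_P0: "open (P0 \<iota>)"
proof -
  have "open (Om \<inter> s -` {..<exp (- 1 / \<iota>)})"
    by (rule continuous_open_preimage[OF Cdiff_continuous[OF Cdiff_s[of 0]] open_Om]) simp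
  moreover have "P0 \<iota> = Om \<inter> s -` {..<exp (- 1 / \<iota>)}" by (auto simp: P0_def)
  ultimately show ?thesis by simp
qed

lemma Om_eq: "Om = P \<union> P0 \<iota>"
  using s_nonneg by (auto simp: P_def P0_def not_less intro: le_less_trans less_le_trans[OF exp_gt_zero])

lemma X_P0: "\<iota> > 0 \<Longrightarrow> z \<in> P0 \<iota> \<Longrightarrow> X \<iota> i z = 0"
  by (simp add: X_def P0_def cutoff_eq_0)

lemma dX_P0: "\<iota> > 0 \<Longrightarrow> z \<in> P0 \<iota> \<Longrightarrow> dird (X \<iota> i) v z = 0"
  using dird_cong_open[OF open_P0, of z \<iota> "X \<iota> i" "\<lambda>_. 0"] X_P0 by simp

text \<open>A function that is regular where Du \<noteq> 0 and vanishes on the neighbourhood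
  \<open>P0 \<iota>\<close> of the critical set is regular on the whole cylinder.\<close>

lemma Cdiff_zero_P0:
  assumes "Cdiff n f P" "\<And>z. z \<in> P0 \<iota> \<Longrightarrow> f z = 0"
  shows "Cdiff n f Om"
  unfolding Om_eq[of \<iota>]
  by (intro Cdiff_Un open_P open_P0 assms(1) Cdiff_congI[OF open_P0 Cdiff_const assms(2)])

lemma Cdiff_X: "\<iota> > 0 \<Longrightarrow> Cdiff (Suc (Suc 0)) (X \<iota> i) Om"
  by (rule Cdiff_zero_P0[OF Cdiff_X_P X_P0])

lemma diff_Om: "z \<in> Om \<Longrightarrow> Cdiff (Suc 0) f Om \<Longrightarrow> f differentiable at z"
  by simp

lemma diff_P: "z \<in> P \<Longrightarrow> Cdiff (Suc 0) f P \<Longrightarrow> f differentiable at z"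
  by simp

section \<open>First derivatives of \<open>q\<close> and of its regularization\<close>

lemma p_sym: "z \<in> Om \<Longrightarrow> dird (p i) (ex j) z = dird (p j) (ex i) z"
  unfolding p_def by (rule dird_commute[OF open_Om _ Cdiff_u])

lemma dird_s: "z \<in> Om \<Longrightarrow> dird s v z = 2 * (\<Sum>i\<in>UNIV. p i z * dird (p i) v z)"
proof -
  assume z: "z \<in> Om"
  have "dird s v z = (\<Sum>i\<in>UNIV. dird (\<lambda>z. p i z * p i z) v z)"
    unfolding s_def[abs_def]
    by (rule dird_sum) (rule diff_Om[OF z Cdiff_mult[OF open_Om Cdiff_p Cdiff_p]])
  also have "\<dots> = (\<Sum>i\<in>UNIV. 2 * (p i z * dird (p i) v z))"
    by (intro sum.cong refl) (simp add: dird_mult[OF diff_Om[OF z Cdiff_p] diff_Om[OF z Cdiff_p]])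
  finally show ?thesis by (simp add: sum_distrib_left)
qed

lemma h_eq: "z \<in> Om \<Longrightarrow> (\<Sum>i\<in>UNIV. p i z * dird (p i) (ex j) z) = h j z"
  unfolding h_def by (intro sum.cong refl) (simp add: p_sym[of z _ j])

lemma dird_q:
  assumes z: "z \<in> P"
  shows "dird (q i) v z = k z * (dird (p i) v z + (\<beta> - 2) / s z * ((\<Sum>l\<in>UNIV. p l z * dird (p l) v z) * p i z))"
proof -
  have s: "s z > 0" using z by (rule s_pos)
  have dk: "dird k v z = ((\<beta> - 2) / 2 * s z powr ((\<beta> - 2) / 2 - 1)) * dird s v z"
    unfolding k_def[abs_def]
    by (rule dird_compose[OF diff_Om[OF P_Om[OF z] Cdiff_s] has_real_derivative_powr[OF s]])
  have e: "s z powr ((\<beta> - 2) / 2 - 1) = k z / s z"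
    using s by (simp add: k_def powr_diff)
  have "dird (q i) v z = k z * dird (p i) v z + dird k v z * p i z"
    unfolding q_def[abs_def] by (rule dird_mult[OF diff_P[OF z Cdiff_k] diff_Om[OF P_Om[OF z] Cdiff_p]])
  moreover have "k z * A + (\<beta> - 2) / 2 * (k z / s z) * (2 * B) * C = k z * (A + (\<beta> - 2) / s z * (B * C))" for A B C
    using s by (simp add: field_simps)
  ultimately show ?thesis unfolding dk e dird_s[OF P_Om[OF z]] by (simp only:)
qed

lemma dird_X:
  assumes z: "z \<in> P"
  shows "dird (X \<iota> i) v z = cutoff \<iota> (s z) * dird (q i) v z
    + k z * (\<omega> \<iota> z / s z * ((\<Sum>l\<in>UNIV. p l z * dird (p l) v z) * p i z))"
proof -
  have dc: "dird (\<lambda>z. cutoff \<iota> (s z)) v z = 3 * \<iota> * (max 0 (1 + \<iota> * ln (s z)))\<^sup>2 / s z * dird s v z"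
    by (rule dird_compose[OF diff_Om[OF P_Om[OF z] Cdiff_s] DERIV_cutoff[OF s_pos[OF z]]])
  have "dird (X \<iota> i) v z = cutoff \<iota> (s z) * dird (q i) v z + dird (\<lambda>z. cutoff \<iota> (s z)) v z * q i z"
    unfolding X_def[abs_def]
    by (rule dird_mult[OF diff_P[OF z Cdiff_mono[OF Cdiff_cutoff_s]] diff_P[OF z Cdiff_q]]) simp
  then show ?thesis unfolding dc dird_s[OF P_Om[OF z]] by (simp add: q_def \<omega>_def)
qed

lemma dX_eq:
  assumes z: "z \<in> P"
  shows "dX \<iota> i j z = k z * (cutoff \<iota> (s z) * (dird (p i) (ex j) z + (\<beta> - 2) / s z * (h j z * p i z))
     + \<omega> \<iota> z / s z * (h j z * p i z))"
  unfolding dX_def dird_X[OF z] dird_q[OF z] h_eq[OF P_Om[OF z]] by (simp add: algebra_simps)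

lemma dq_eq:
  assumes z: "z \<in> P"
  shows "dird (q i) (ex j) z = k z * (dird (p i) (ex j) z + (\<beta> - 2) / s z * (h j z * p i z))"
  unfolding dird_q[OF z] h_eq[OF P_Om[OF z]] by simp

text \<open>The extra term is \<open>q\<close> applied to the gradient of the cutoff: that gradient
  is twice the derivative of the cutoff times \<open>h\<close>, and twice \<open>s\<close> times
  that derivative is \<open>\<omega>\<close>.\<close>

lemma divX_eq:
  assumes z: "z \<in> P"
  shows "divX \<iota> z = cutoff \<iota> (s z) * D z + \<omega> \<iota> z * y z"
proof -
  have "divX \<iota> z = (\<Sum>i\<in>UNIV. cutoff \<iota> (s z) * dird (q i) (ex i) z + k z * \<omega> \<iota> z / s z * (h i z * p i z))"
    unfolding divX_def dX_def dird_X[OF z] h_eq[OF P_Om[OF z]] by (simp add: mult.assoc)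
  also have "\<dots> = cutoff \<iota> (s z) * D z + k z * \<omega> \<iota> z / s z * (\<Sum>i\<in>UNIV. h i z * p i z)"
    by (simp only: sum.distrib sum_distrib_left[symmetric] D_def)
  finally show ?thesis by (simp add: y_def)
qed

lemma \<omega>_nonneg: "\<iota> \<ge> 0 \<Longrightarrow> \<omega> \<iota> z \<ge> 0"
  by (simp add: \<omega>_def)

text \<open>After the factor \<open>k\<close> is taken out of both Jacobians, this is
  \<open>trace_lower_bound\<close> with \<open>c = \<beta> - 2\<close>, which exceeds -1 because
  \<beta> > 1.\<close>

lemma trace_bound:
  assumes z: "z \<in> P" and \<iota>: "\<iota> \<ge> 0"
  shows "(\<Sum>i\<in>UNIV. \<Sum>j\<in>UNIV. dird (q j) (ex i) z * dX \<iota> i j z) \<ge> \<omega> \<iota> z * (\<beta> - 1) * (y z)\<^sup>2"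
proof -
  let ?H = "\<lambda>i j. dird (p i) (ex j) z" and ?p = "\<lambda>i. p i z" and ?h = "\<lambda>i. h i z"
  let ?T = "\<Sum>i\<in>UNIV. \<Sum>j\<in>UNIV. (?H j i + (\<beta> - 2) / s z * (?h i * ?p j)) *
      (cutoff \<iota> (s z) * (?H i j + (\<beta> - 2) / s z * (?h j * ?p i)) + \<omega> \<iota> z / s z * (?h j * ?p i))"
  have "(\<Sum>i\<in>UNIV. \<Sum>j\<in>UNIV. dird (q j) (ex i) z * dX \<iota> i j z) = (k z)\<^sup>2 * ?T"
    unfolding dX_eq[OF z] dq_eq[OF z] sum_distrib_left by (simp add: power2_eq_square mult_ac)
  moreover have "?T \<ge> \<omega> \<iota> z * ((\<beta> - 2) + 1) * ((\<Sum>i\<in>UNIV. ?h i * ?p i) / s z)\<^sup>2"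
    using p_sym[OF P_Om[OF z]] s_pos[OF z] \<beta>_gt cutoff_nonneg \<omega>_nonneg[OF \<iota>]
    by (intro trace_lower_bound) (auto simp: s_def h_def)
  then have "(k z)\<^sup>2 * ?T \<ge> (k z)\<^sup>2 * (\<omega> \<iota> z * ((\<beta> - 2) + 1) * ((\<Sum>i\<in>UNIV. ?h i * ?p i) / s z)\<^sup>2)"
    by (intro mult_left_mono) auto
  moreover have "(k z)\<^sup>2 * (\<omega> \<iota> z * ((\<beta> - 2) + 1) * ((\<Sum>i\<in>UNIV. ?h i * ?p i) / s z)\<^sup>2)
      = \<omega> \<iota> z * (\<beta> - 1) * (y z)\<^sup>2"
    by (simp add: y_def power_mult_distrib power_divide)
  ultimately show ?thesis by linarith
qed

text \<open>The divergence of this field contains no second derivatives of \<open>X\<close>: they cancel.\<close>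

definition NL where
  "NL Y \<iota> i z = Y z * (\<Sum>j\<in>UNIV. q j z * dX \<iota> i j z) - Y z * q i z * divX \<iota> z"

lemma Cdiff_dX_P: "Cdiff (Suc 0) (dX \<iota> i j) P"
  unfolding dX_def by (rule Cdiff_dird[OF Cdiff_X_P])

lemma Cdiff_divX_P: "Cdiff (Suc 0) (divX \<iota>) P"
  unfolding divX_def[abs_def] by (rule Cdiff_sum[OF open_P Cdiff_dX_P])

text \<open>The field contains one derivative of the C^2 field \<open>X\<close>, hence is C^1, as
  integrating its divergence requires; near critical points it vanishes.\<close>

lemma Cdiff_NL:
  assumes "\<iota> > 0" "Cdiff (Suc 0) Y Om"
  shows "Cdiff (Suc 0) (NL Y \<iota> i) Om"
proof (rule Cdiff_zero_P0)
  show "Cdiff (Suc 0) (NL Y \<iota> i) P"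
    unfolding NL_def[abs_def]
    by (intro Cdiff_diff Cdiff_mult Cdiff_sum open_P Cdiff_P[OF assms(2)] Cdiff_q Cdiff_dX_P Cdiff_divX_P)
  show "NL Y \<iota> i z = 0" if "z \<in> P0 \<iota>" for z
    using that assms(1) by (simp add: NL_def divX_def dX_def dX_P0)
qed

lemma NL_div:
  assumes z: "z \<in> P" and Y: "Cdiff (Suc 0) Y Om"
  shows "(\<Sum>i\<in>UNIV. dird (NL Y \<iota> i) (ex i) z) =
    (\<Sum>i\<in>UNIV. dird Y (ex i) z * (\<Sum>j\<in>UNIV. q j z * dX \<iota> i j z))
    + Y z * (\<Sum>i\<in>UNIV. \<Sum>j\<in>UNIV. dird (q j) (ex i) z * dX \<iota> i j z)
    - ((\<Sum>i\<in>UNIV. dird Y (ex i) z * q i z) + Y z * D z) * divX \<iota> z"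
proof -
  have dY: "Y differentiable at z" by (rule diff_Om[OF P_Om[OF z] Y])
  have dq: "q i differentiable at z" for i by (rule diff_P[OF z Cdiff_q])
  have ddX: "dX \<iota> i j differentiable at z" for i j by (rule diff_P[OF z Cdiff_dX_P])
  have ddivX: "divX \<iota> differentiable at z" by (rule diff_P[OF z Cdiff_divX_P])
  have dqX: "(\<lambda>z. q j z * dX \<iota> i j z) differentiable at z" for i j
    by (rule diff_P[OF z Cdiff_mult[OF open_P Cdiff_q Cdiff_dX_P]])
  have dsum: "(\<lambda>z. \<Sum>j\<in>UNIV. q j z * dX \<iota> i j z) differentiable at z" for i
    by (rule diff_P[OF z Cdiff_sum[OF open_P Cdiff_mult[OF open_P Cdiff_q Cdiff_dX_P]]])
  have dYq: "(\<lambda>z. Y z * q i z) differentiable at z" for i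
    by (rule diff_P[OF z Cdiff_mult[OF open_P Cdiff_P[OF Y] Cdiff_q]])
  have d1: "(\<lambda>z. Y z * (\<Sum>j\<in>UNIV. q j z * dX \<iota> i j z)) differentiable at z" for i
    by (rule diff_P[OF z Cdiff_mult[OF open_P Cdiff_P[OF Y] Cdiff_sum[OF open_P Cdiff_mult[OF open_P Cdiff_q Cdiff_dX_P]]]])
  have d2: "(\<lambda>z. Y z * q i z * divX \<iota> z) differentiable at z" for i
    by (rule diff_P[OF z Cdiff_mult[OF open_P Cdiff_mult[OF open_P Cdiff_P[OF Y] Cdiff_q] Cdiff_divX_P]])
  have e1: "dird (\<lambda>z. \<Sum>j\<in>UNIV. q j z * dX \<iota> i j z) v z
      = (\<Sum>j\<in>UNIV. q j z * dird (dX \<iota> i j) v z + dird (q j) v z * dX \<iota> i j z)" for i v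
    by (subst dird_sum[OF dqX]) (intro sum.cong refl dird_mult[OF dq ddX])
  have e2: "dird (divX \<iota>) v z = (\<Sum>j\<in>UNIV. dird (dX \<iota> j j) v z)" for v
    unfolding divX_def[abs_def] by (rule dird_sum[OF ddX])
  \<comment> \<open>Second derivatives commute, so after exchanging the two summation indices the
    terms \<open>q j\<close> times a second derivative of \<open>X\<close> cancel against the
    gradient of \<open>divX\<close>.\<close>
  have comm: "dird (dX \<iota> i j) (ex i) z = dird (dX \<iota> i i) (ex j) z" for i j
    unfolding dX_def by (rule dird_commute[OF open_P z Cdiff_X_P])
  have e3: "dird (NL Y \<iota> i) (ex i) z =
      Y z * (\<Sum>j\<in>UNIV. q j z * dird (dX \<iota> i j) (ex i) z) + Y z * (\<Sum>j\<in>UNIV. dird (q j) (ex i) z * dX \<iota> i j z)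
      + dird Y (ex i) z * (\<Sum>j\<in>UNIV. q j z * dX \<iota> i j z)
      - (Y z * (\<Sum>j\<in>UNIV. q i z * dird (dX \<iota> j j) (ex i) z)
         + (Y z * dird (q i) (ex i) z + dird Y (ex i) z * q i z) * divX \<iota> z)" for i
  proof -
    have "dird (NL Y \<iota> i) (ex i) z =
      (Y z * dird (\<lambda>z. \<Sum>j\<in>UNIV. q j z * dX \<iota> i j z) (ex i) z + dird Y (ex i) z * (\<Sum>j\<in>UNIV. q j z * dX \<iota> i j z))
      - (Y z * q i z * dird (divX \<iota>) (ex i) z + (Y z * dird (q i) (ex i) z + dird Y (ex i) z * q i z) * divX \<iota> z)"
      unfolding NL_def[abs_def] dird_diff[OF d1 d2] dird_mult[OF dY dsum] dird_mult[OF dYq ddivX] dird_mult[OF dY dq] ..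
    then show ?thesis unfolding e1 e2 by (simp add: sum.distrib sum_distrib_left algebra_simps)
  qed
  have "(\<Sum>i\<in>UNIV. \<Sum>j\<in>UNIV. q j z * dird (dX \<iota> i j) (ex i) z) = (\<Sum>i\<in>UNIV. \<Sum>j\<in>UNIV. q i z * dird (dX \<iota> j j) (ex i) z)"
    by (subst sum.swap) (simp add: comm)
  then have swap: "(\<Sum>i\<in>UNIV. Y z * (\<Sum>j\<in>UNIV. q j z * dird (dX \<iota> i j) (ex i) z))
      = (\<Sum>i\<in>UNIV. Y z * (\<Sum>j\<in>UNIV. q i z * dird (dX \<iota> j j) (ex i) z))"
    by (simp only: sum_distrib_left[symmetric])
  have s1: "(\<Sum>i\<in>UNIV. (Y z * dird (q i) (ex i) z + dird Y (ex i) z * q i z) * divX \<iota> z)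
      = ((\<Sum>i\<in>UNIV. dird Y (ex i) z * q i z) + Y z * D z) * divX \<iota> z"
    by (simp only: sum_distrib_right[symmetric] sum.distrib D_def sum_distrib_left[symmetric] add.commute)
  show ?thesis unfolding e3 sum_subtractf sum.distrib swap s1 by (simp only: sum_distrib_left)
qed

section \<open>Pointwise consequences of the equations\<close>

lemma differentiable_u: "z \<in> Om \<Longrightarrow> u differentiable at z"
  by (rule diff_Om[OF _ Cdiff_u])

lemma differentiable_M: "z \<in> Om \<Longrightarrow> M differentiable at z"
  by (rule diff_Om[OF _ Cdiff_M])

lemma Dx_component: "t \<in> {0<..<T} \<Longrightarrow> Dx u x t $ i = p i (x, t)"
  using dird_slice[OF differentiable_u, of x t] by (simp add: Dx_def gradient_def dird_def p_def Om_def)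

lemma norm_Dx: "t \<in> {0<..<T} \<Longrightarrow> norm (Dx u x t) = sqrt (s (x, t))"
  by (simp add: norm_vec_def L2_set_def Dx_component s_def power2_eq_square)

lemma Dt_eq: "f differentiable at (x, t) \<Longrightarrow> Dt f x t = dird f et (x, t)"
  unfolding Dt_def using deriv_time_slice by (rule DERIV_imp_deriv)

lemma norm_Dx_powr: "t \<in> {0<..<T} \<Longrightarrow> norm (Dx u x t) powr c = s (x, t) powr (c / 2)"
  using s_nonneg by (simp add: norm_Dx powr_half_sqrt[symmetric] powr_powr)

lemma m_powr: "z \<in> Om \<Longrightarrow> m z powr c = exp (c * M z)"
  using m_Om[of z] by (simp add: powr_def M_def)

lemma Hamilton_Jacobi:
  assumes z: "z \<in> Om"
  shows "dird u et z = exp (- a * M z) * (s z powr (\<beta> / 2) / \<beta>) - g (m z)"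
proof -
  obtain x t where xt: "z = (x, t)" "t \<in> {0<..<T}" using z by (auto simp: Om_def)
  have "- Dt u x t + m (x, t) powr (\<alpha> * (1 - \<beta>)) * (norm (Dx u x t) powr \<beta> / \<beta>) = g (m (x, t))"
    using solution xt(2) unfolding solves_congestion_MFG_def by blast
  moreover have "Dt u x t = dird u et z" using Dt_eq[of u x t] differentiable_u[OF z] xt by simp
  moreover have "\<alpha> * (1 - \<beta>) = - a" by (simp add: a_def algebra_simps)
  ultimately show ?thesis using norm_Dx_powr[OF xt(2)] m_powr[OF z] xt(1) by simp
qed

lemma flux_component:
  assumes "t \<in> {0<..<T}"
  shows "flux \<alpha> \<beta> u m t x $ i = exp ((1 - a) * M (x, t)) * q i (x, t)"
proof -
  have "1 + \<alpha> * (1 - \<beta>) = 1 - a" by (simp add: a_def algebra_simps)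
  then show ?thesis
    using assms m_powr[of "(x, t)"] by (simp add: flux_def norm_Dx_powr Dx_component q_def k_def Om_def)
qed

lemma m_t_eq_divergence:
  assumes "(x, t) \<in> Om"
  shows "dird m et (x, t) = (\<Sum>i\<in>UNIV. dird (\<lambda>y. flux \<alpha> \<beta> u m t y $ i) (axis i 1) x)"
    and "(\<lambda>y. flux \<alpha> \<beta> u m t y $ i) differentiable at x"
proof -
  have t: "t \<in> {0<..<T}" using assms by (auto simp: Om_def)
  have d: "flux \<alpha> \<beta> u m t differentiable at x"
    and eq: "Dt m x t = divergence (flux \<alpha> \<beta> u m t) x"
    using solution t unfolding solves_congestion_MFG_def by auto
  show "dird m et (x, t) = (\<Sum>i\<in>UNIV. dird (\<lambda>y. flux \<alpha> \<beta> u m t y $ i) (axis i 1) x)"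
    using Dt_eq[OF diff_Om[OF assms Cdiff_m]] eq divergence_eq_sum_dird[OF d] by simp
  obtain F' where "(flux \<alpha> \<beta> u m t has_derivative F') (at x)" using d by (auto simp: differentiable_def)
  from bounded_linear.has_derivative[OF bounded_linear_vec_nth this]
  show "(\<lambda>y. flux \<alpha> \<beta> u m t y $ i) differentiable at x" unfolding differentiable_def by blast
qed

lemma dird_exp_M:
  assumes "z \<in> Om"
  shows "dird (\<lambda>z. exp (c * M z)) v z = c * exp (c * M z) * dird M v z"
proof -
  have "((\<lambda>r. exp (c * r)) has_field_derivative c * exp (c * M z)) (at (M z))"
    by (auto intro!: derivative_eq_intros)
  from dird_compose[OF differentiable_M[OF assms] this] show ?thesis .
qed

lemma dird_m:
  assumes "z \<in> Om"
  shows "dird m v z = m z * dird M v z"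
proof -
  have "dird m v z = dird (\<lambda>z. exp (1 * M z)) v z"
    by (rule dird_cong_open[OF open_Om assms]) (simp add: exp_M)
  then show ?thesis using dird_exp_M[OF assms, of 1] exp_M[OF assms] by simp
qed

text \<open>Restricted to noncritical points, where \<open>q\<close> is smooth and the product rule
  applies to the flux; dividing by \<open>m\<close> turns the equation for \<open>m\<close> into one
  for \<open>M\<close>.\<close>

lemma continuity_eq:
  assumes z: "z \<in> P"
  shows "dird M et z = exp (- a * M z) * (D z + (1 - a) * S z)"
proof -
  obtain x t where xt: "z = (x, t)" "t \<in> {0<..<T}" using P_Om[OF z] by (auto simp: Om_def)
  note zO = P_Om[OF z]
  have dq: "q i differentiable at z" for i by (rule diff_P[OF z Cdiff_q])
  have de: "(\<lambda>z. exp ((1 - a) * M z)) differentiable at z" by (rule diff_Om[OF zO Cdiff_exp_M])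
  have "dird (\<lambda>y. flux \<alpha> \<beta> u m t y $ i) (axis i 1) x
      = exp ((1 - a) * M z) * (dird (q i) (ex i) z + (1 - a) * (q i z * dird M (ex i) z))" for i
  proof -
    have "dird (\<lambda>y. flux \<alpha> \<beta> u m t y $ i) (axis i 1) x = dird (\<lambda>y. exp ((1 - a) * M (y, t)) * q i (y, t)) (axis i 1) x"
      using flux_component[OF xt(2)] by simp
    also have "\<dots> = dird (\<lambda>z. exp ((1 - a) * M z) * q i z) (ex i) (x, t)"
      by (rule dird_slice) (use xt dq de in \<open>auto intro: differentiable_mult\<close>)
    also have "\<dots> = exp ((1 - a) * M z) * dird (q i) (ex i) z + (1 - a) * exp ((1 - a) * M z) * dird M (ex i) z * q i z"
      unfolding xt(1)[symmetric] dird_mult[OF de dq] dird_exp_M[OF zO] ..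
    finally show ?thesis by (simp add: algebra_simps)
  qed
  then have "dird m et z = exp ((1 - a) * M z) * (D z + (1 - a) * S z)"
    using m_t_eq_divergence(1)[of x t] zO unfolding xt(1)[symmetric]
    by (simp only: sum_distrib_left[symmetric] sum.distrib D_def S_def)
  then have "exp (M z) * dird M et z = exp (M z) * (exp (- a * M z) * (D z + (1 - a) * S z))"
  proof -
    have "exp ((1 - a) * M z) = exp (M z) * exp (- a * M z)" by (simp add: mult_exp_exp algebra_simps)
    then show ?thesis using \<open>dird m et z = _\<close> dird_m[OF zO, of et] exp_M[OF zO] by (simp only: mult.assoc)
  qed
  then show ?thesis by (simp only: mult_cancel_left exp_not_eq_zero simp_thms)
qed

lemma g_deriv:
  assumes "r > 0"
  shows "(g has_field_derivative dird g 1 r) (at r)" "dird g 1 r \<ge> 0"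
proof -
  have "g differentiable at r" using Cdiff_g[of "Suc 0"] assms by simp
  then obtain d where d: "(g has_field_derivative d) (at r)" by (auto simp: real_differentiable_def)
  have e: "dird g 1 r = d" using dird_real[OF d, of 1] by simp
  show "(g has_field_derivative dird g 1 r) (at r)" unfolding e by (rule d)
  then show "dird g 1 r \<ge> 0"
    by (rule mono_on_imp_deriv_nonneg[OF g_mono]) (simp add: interior_open assms)
qed

lemma s_powr_half: "z \<in> P \<Longrightarrow> s z powr (\<beta> / 2) = s z * k z"
proof -
  assume "z \<in> P"
  then have "s z powr (1 + (\<beta> - 2) / 2) = s z * k z"
    using s_pos[of z] by (simp add: powr_add k_def)
  moreover have "1 + (\<beta> - 2) / 2 = \<beta> / 2" by (simp add: field_simps)
  ultimately show ?thesis by (simp only:)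
qed

text \<open>The Hamilton-Jacobi equation is differentiated in space after exchanging time and space
  derivatives of \<open>u\<close>. The first term is advection along \<open>q\<close>; the factor of
  the gradient of \<open>M\<close> is nonnegative because \<open>g\<close> is
  non-decreasing.\<close>

lemma p_time:
  assumes z: "z \<in> P"
  shows "dird (p i) et z = exp (- a * M z) * k z * h i z
    - (a * exp (- a * M z) * (s z * k z / \<beta>) + dird g 1 (m z) * m z) * dird M (ex i) z"
proof -
  note zO = P_Om[OF z]
  let ?F = "\<lambda>z. exp (- a * M z) * (s z powr (\<beta> / 2) / \<beta>)"
  have m0: "m z > 0" by (rule m_Om[OF zO])
  have ds: "dird (\<lambda>z. s z powr (\<beta> / 2) / \<beta>) (ex i) z = k z * h i z"
  proof -
    have "((\<lambda>r. r powr (\<beta> / 2) / \<beta>) has_field_derivative (\<beta> / 2 * s z powr (\<beta> / 2 - 1)) / \<beta>) (at (s z))"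
      by (intro DERIV_cdivide has_real_derivative_powr s_pos[OF z])
    then have "dird (\<lambda>z. s z powr (\<beta> / 2) / \<beta>) (ex i) z = (\<beta> / 2 * s z powr (\<beta> / 2 - 1)) / \<beta> * dird s (ex i) z"
      by (rule dird_compose[OF diff_Om[OF zO Cdiff_s]])
    moreover have "s z powr (\<beta> / 2 - 1) = k z" by (simp add: k_def diff_divide_distrib)
    ultimately show ?thesis using \<beta>_gt by (simp add: dird_s[OF zO] h_eq[OF zO])
  qed
  have dd: "(\<lambda>z. s z powr (\<beta> / 2) / \<beta>) differentiable at z"
  proof (rule diff_P[OF z])
    have "Cdiff (Suc 0) (\<lambda>z. s z powr (\<beta> / 2)) P"
      by (rule Cdiff_compose[OF open_P _ Cdiff_powr Cdiff_P[OF Cdiff_s]]) (simp add: s_pos)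
    from Cdiff_mult[OF open_P this Cdiff_const[of _ "1 / \<beta>"]]
    show "Cdiff (Suc 0) (\<lambda>z. s z powr (\<beta> / 2) / \<beta>) P" by simp
  qed
  have de: "(\<lambda>z. exp (- a * M z)) differentiable at z" by (rule diff_Om[OF zO Cdiff_exp_M])
  have dg: "(\<lambda>z. g (m z)) differentiable at z"
    by (rule diff_Om[OF zO Cdiff_compose[OF open_Om _ Cdiff_g Cdiff_m]]) (simp add: m_Om)
  have "dird (p i) et z = dird (dird u et) (ex i) z"
    unfolding p_def by (rule dird_commute[OF open_Om zO Cdiff_u])
  also have "\<dots> = dird (\<lambda>z. ?F z - g (m z)) (ex i) z"
    by (rule dird_cong_open[OF open_Om zO]) (rule Hamilton_Jacobi)
  also have "\<dots> = dird ?F (ex i) z - dird (\<lambda>z. g (m z)) (ex i) z"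
    by (rule dird_diff[OF differentiable_mult[OF de dd] dg])
  also have "dird (\<lambda>z. g (m z)) (ex i) z = dird g 1 (m z) * dird m (ex i) z"
    by (rule dird_compose[OF diff_Om[OF zO Cdiff_m] g_deriv(1)[OF m0]])
  finally show ?thesis
    unfolding dird_mult[OF de dd] ds dird_exp_M[OF zO] dird_m[OF zO] s_powr_half[OF z]
    by (simp add: algebra_simps)
qed

section \<open>Powers of the density and the fields to be integrated\<close>

definition W where "W c z = exp (c * M z) / c"

lemma Cdiff_W: "Cdiff n (W c) Om"
  using Cdiff_mult[OF open_Om Cdiff_exp_M Cdiff_const[of _ "1 / c"]] by (simp add: W_def[abs_def])

lemma dird_W:
  assumes "z \<in> Om" "c \<noteq> 0"
  shows "dird (W c) v z = exp (c * M z) * dird M v z"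
proof -
  have "dird (W c) v z = dird (\<lambda>z. (1 / c) * exp (c * M z)) v z" by (simp add: W_def[abs_def])
  also have "\<dots> = (1 / c) * dird (\<lambda>z. exp (c * M z)) v z"
    by (rule dird_cmult[OF diff_Om[OF assms(1) Cdiff_exp_M]])
  finally show ?thesis using assms by (simp add: dird_exp_M)
qed

text \<open>This is m^c DM . X. With \<open>c = r - a\<close>, \<open>- (r - 1)\<close> times its
  integral approximates the integral of m^r M_t, so the moment is convex when the integral of
  \<open>G\<close> decreases up to a vanishing error.\<close>

definition G where "G c \<iota> z = (\<Sum>i\<in>UNIV. dird (W c) (ex i) z * X \<iota> i z)"
text \<open>The first summand removes the time derivative that falls on DW when \<open>G\<close> is
  differentiated; the second cancels the advection part of the time derivative of \<open>X\<close>.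
  It is used with \<open>c = b + a\<close>, because the time derivatives of \<open>M\<close> and
  \<open>q\<close> carry a factor m^(-a).\<close>

definition R where "R c b \<iota> i z = dird (W c) et z * X \<iota> i z + NL (W b) \<iota> i z"

lemma Cdiff_dW: "Cdiff n (dird (W c) v) Om"
  by (rule Cdiff_dird[OF Cdiff_W])

lemma Cdiff_X1: "\<iota> > 0 \<Longrightarrow> Cdiff (Suc 0) (X \<iota> i) Om"
  by (rule Cdiff_SucD[OF Cdiff_X])

lemma Cdiff_G: "\<iota> > 0 \<Longrightarrow> Cdiff (Suc 0) (G c \<iota>) Om"
  unfolding G_def[abs_def] by (intro Cdiff_sum Cdiff_mult open_Om Cdiff_dW Cdiff_X1)

lemma Cdiff_R: "\<iota> > 0 \<Longrightarrow> Cdiff (Suc 0) (R c b \<iota> i) Om"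
  unfolding R_def[abs_def] by (intro Cdiff_add Cdiff_mult Cdiff_NL open_Om Cdiff_dW Cdiff_W Cdiff_X1)

lemma zero_P0:
  assumes "\<iota> > 0" "z \<in> P0 \<iota>"
  shows "dird (G c \<iota>) v z = 0" "dird (R c b \<iota> i) v z = 0" "dird (NL Y \<iota> i) v z = 0"
    "dird (\<lambda>z. Y z * X \<iota> i z) v z = 0"
proof -
  have "NL Y \<iota> i z = 0" if "z \<in> P0 \<iota>" for z Y i
    using that assms(1) by (simp add: NL_def divX_def dX_def dX_P0)
  then show "dird (G c \<iota>) v z = 0" "dird (R c b \<iota> i) v z = 0" "dird (NL Y \<iota> i) v z = 0"
    "dird (\<lambda>z. Y z * X \<iota> i z) v z = 0"
    using dird_cong_open[OF open_P0 assms(2), of _ "\<lambda>_. 0"] X_P0[OF assms(1)]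
    by (simp_all add: G_def R_def)
qed

lemma advection_term:
  assumes z: "z \<in> P"
  shows "(\<Sum>j\<in>UNIV. q j z * dX \<iota> i j z) = (k z)\<^sup>2 * (cutoff \<iota> (s z) * (h i z + (\<beta> - 2) / s z * ((\<Sum>j\<in>UNIV. h j z * p j z) * p i z))
    + \<omega> \<iota> z / s z * ((\<Sum>j\<in>UNIV. h j z * p j z) * p i z))"
proof -
  have "q j z * dX \<iota> i j z = ((k z)\<^sup>2 * cutoff \<iota> (s z)) * (dird (p i) (ex j) z * p j z)
     + ((k z)\<^sup>2 * (cutoff \<iota> (s z) * ((\<beta> - 2) / s z) + \<omega> \<iota> z / s z) * p i z) * (h j z * p j z)" for j
    unfolding dX_eq[OF z] q_def by (simp add: power2_eq_square algebra_simps)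
  then have "(\<Sum>j\<in>UNIV. q j z * dX \<iota> i j z) = ((k z)\<^sup>2 * cutoff \<iota> (s z)) * h i z
     + ((k z)\<^sup>2 * (cutoff \<iota> (s z) * ((\<beta> - 2) / s z) + \<omega> \<iota> z / s z) * p i z) * (\<Sum>j\<in>UNIV. h j z * p j z)"
    by (simp only: sum.distrib sum_distrib_left[symmetric] h_def)
  then show ?thesis by (simp add: algebra_simps)
qed

text \<open>The coupling enters only through \<open>g' \<ge> 0\<close>, and the term containing it has a sign.\<close>

lemma time_derivative_bound:
  assumes z: "z \<in> P" and \<iota>: "\<iota> \<ge> 0"
  shows "(\<Sum>i\<in>UNIV. dird M (ex i) z * dird (X \<iota> i) et z) \<le>
    exp (- a * M z) * (\<Sum>i\<in>UNIV. dird M (ex i) z * (\<Sum>j\<in>UNIV. q j z * dX \<iota> i j z))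
    - exp (- a * M z) * (a * (\<beta> - 1) / \<beta>) * cutoff \<iota> (s z) * (S z)\<^sup>2"
proof -
  note zO = P_Om[OF z]
  define e where "e = exp (- a * M z)"
  define c where "c = a * e * (s z * k z / \<beta>) + dird g 1 (m z) * m z"
  define \<zeta> where "\<zeta> = cutoff \<iota> (s z)"
  define w where "w = \<omega> \<iota> z / s z"
  define b where "b = (\<beta> - 2) / s z"
  let ?M = "\<lambda>i. dird M (ex i) z" and ?p = "\<lambda>i. p i z" and ?h = "\<lambda>i. h i z"
  define \<eta> where "\<eta> = (\<Sum>i\<in>UNIV. ?h i * ?p i)"
  define pM where "pM = (\<Sum>i\<in>UNIV. ?p i * ?M i)"
  define hM where "hM = (\<Sum>i\<in>UNIV. ?h i * ?M i)"
  define MM where "MM = (\<Sum>i\<in>UNIV. ?M i * ?M i)"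
  have s0: "s z > 0" by (rule s_pos[OF z])
  have k0: "k z \<ge> 0" by (simp add: k_def)
  have w0: "w \<ge> 0" using \<omega>_nonneg[OF \<iota>] s0 by (simp add: w_def)
  have \<zeta>0: "\<zeta> \<ge> 0" by (simp add: \<zeta>_def cutoff_nonneg)
  have a0: "a \<ge> 0" using \<alpha>_pos \<beta>_gt by (simp add: a_def)
  have tau: "dird (p i) et z = (e * k z) * ?h i - c * ?M i" for i
    unfolding p_time[OF z] c_def e_def ..
  have ptau: "(\<Sum>l\<in>UNIV. p l z * dird (p l) et z) = e * k z * \<eta> - c * pM"
  proof -
    have "p l z * dird (p l) et z = (e * k z) * (?h l * ?p l) - c * (?p l * ?M l)" for l
      unfolding tau by (simp add: algebra_simps)
    then show ?thesis by (simp only: sum_subtractf sum_distrib_left[symmetric] \<eta>_def pM_def)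
  qed
  have "?M i * dird (X \<iota> i) et z = (\<zeta> * k z * (e * k z)) * (?h i * ?M i) - (\<zeta> * k z * c) * (?M i * ?M i)
      + ((\<zeta> * k z * b + k z * w) * (e * k z * \<eta> - c * pM)) * (?p i * ?M i)" for i
    unfolding dird_X[OF z] dird_q[OF z] ptau unfolding tau \<zeta>_def[symmetric] w_def[symmetric] b_def[symmetric]
    by (simp add: algebra_simps)
  then have lhs: "(\<Sum>i\<in>UNIV. ?M i * dird (X \<iota> i) et z) = (\<zeta> * k z * (e * k z)) * hM - (\<zeta> * k z * c) * MM
      + ((\<zeta> * k z * b + k z * w) * (e * k z * \<eta> - c * pM)) * pM"
    by (simp only: sum.distrib sum_subtractf sum_distrib_left[symmetric] hM_def MM_def pM_def)
  have "?M i * (\<Sum>j\<in>UNIV. q j z * dX \<iota> i j z) = ((k z)\<^sup>2 * \<zeta>) * (?h i * ?M i)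
      + ((k z)\<^sup>2 * (\<zeta> * b + w) * \<eta>) * (?p i * ?M i)" for i
    unfolding advection_term[OF z] \<zeta>_def[symmetric] w_def[symmetric] b_def[symmetric] \<eta>_def[symmetric]
    by (simp add: algebra_simps)
  then have adv: "(\<Sum>i\<in>UNIV. ?M i * (\<Sum>j\<in>UNIV. q j z * dX \<iota> i j z))
      = ((k z)\<^sup>2 * \<zeta>) * hM + ((k z)\<^sup>2 * (\<zeta> * b + w) * \<eta>) * pM"
    by (simp only: sum.distrib sum_distrib_left[symmetric] hM_def pM_def)
  have S: "S z = k z * pM"
    by (simp add: S_def q_def pM_def sum_distrib_left mult.assoc)
  \<comment> \<open>Cauchy-Schwarz makes |DM|^2 at least (p . DM)^2 / s. Adding the contribution of
    the derivative of \<open>k\<close>, which has the factor \<open>\<beta> - 2\<close>, leaves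
    \<open>\<beta> - 1\<close>.\<close>
  have "pM\<^sup>2 \<le> s z * MM"
    using sum_Cauchy_Schwarz[of ?p ?M] by (simp add: pM_def s_def MM_def)
  then have "pM\<^sup>2 / s z \<le> MM" using s0 by (simp add: divide_simps mult.commute)
  then have "\<zeta> * ((\<beta> - 1) * (pM\<^sup>2 / s z)) \<le> \<zeta> * (MM + b * pM\<^sup>2)"
    by (intro mult_left_mono \<zeta>0) (use s0 in \<open>simp add: b_def field_simps\<close>)
  also have "\<dots> \<le> \<zeta> * (MM + b * pM\<^sup>2) + w * pM\<^sup>2" using w0 by simp
  finally have 1: "\<zeta> * ((\<beta> - 1) * (pM\<^sup>2 / s z)) \<le> \<zeta> * (MM + b * pM\<^sup>2) + w * pM\<^sup>2" .
  \<comment> \<open>The term of \<open>c\<close> with g' is nonnegative and is dropped; the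
    remaining one turns the square of \<open>k z * pM\<close> into the stated multiple of
    \<open>(S z)\<^sup>2\<close>.\<close>
  have "a * e * (s z * k z / \<beta>) \<le> c"
    using g_deriv(2)[OF m_Om[OF zO]] m_Om[OF zO] by (simp add: c_def)
  moreover have "0 \<le> a * e * (s z * k z / \<beta>)"
    using a0 s0 k0 \<beta>_gt by (simp add: e_def)
  moreover have "0 \<le> \<zeta> * ((\<beta> - 1) * (pM\<^sup>2 / s z))" using \<zeta>0 s0 \<beta>_gt by simp
  ultimately have "(a * e * (s z * k z / \<beta>) * k z) * (\<zeta> * ((\<beta> - 1) * (pM\<^sup>2 / s z)))
      \<le> (c * k z) * (\<zeta> * (MM + b * pM\<^sup>2) + w * pM\<^sup>2)"
    using 1 k0 by (intro mult_mono) auto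
  moreover have "(a * e * (s z * k z / \<beta>) * k z) * (\<zeta> * ((\<beta> - 1) * (pM\<^sup>2 / s z)))
      = e * (a * (\<beta> - 1) / \<beta>) * \<zeta> * (S z)\<^sup>2"
    unfolding S using s0 by (simp add: power_mult_distrib power2_eq_square)
  moreover have "(\<Sum>i\<in>UNIV. ?M i * dird (X \<iota> i) et z) = e * (\<Sum>i\<in>UNIV. ?M i * (\<Sum>j\<in>UNIV. q j z * dX \<iota> i j z))
      - (c * k z) * (\<zeta> * (MM + b * pM\<^sup>2) + w * pM\<^sup>2)"
    unfolding lhs adv by (simp add: power2_eq_square algebra_simps)
  ultimately show ?thesis unfolding e_def[symmetric] \<zeta>_def[symmetric] by linarith
qed

text \<open>The divergence of \<open>R\<close> is chosen so that, once \<open>G\<close> is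
  differentiated in time, only first derivatives of \<open>q\<close>, \<open>X\<close> and
  \<open>M\<close> survive; what remains is the expression of
  \<open>pointwise_convexity_bound\<close> times m^\<rho>.\<close>

lemma convexity_pointwise_P:
  assumes z: "z \<in> P" and \<iota>: "\<iota> > 0" and \<rho>: "\<rho> > 1" and disc: "a\<^sup>2 \<le> 4 * (1 - 1 / \<rho>) * (a * (\<beta> - 1) / \<beta>)"
  shows "- dird (G (\<rho> + a) \<iota>) et z + (\<Sum>i\<in>UNIV. dird (R (\<rho> + a) \<rho> \<iota> i) (ex i) z)
    \<ge> - (exp (\<rho> * M z) * (\<omega> \<iota> z * (\<rho> * ((1 - 1 / \<rho>) * D z - a * S z)\<^sup>2 / (4 * (\<beta> - 1)))))"
proof -
  note zO = P_Om[OF z]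
  let ?c = "\<rho> + a"
  have a0: "a \<ge> 0" using \<alpha>_pos \<beta>_gt by (simp add: a_def)
  then have c0: "?c \<noteq> 0" "\<rho> \<noteq> 0" using \<rho> by auto
  have dW: "dird (W ?c) v differentiable at z" for v by (rule diff_Om[OF zO Cdiff_dW])
  have dX: "X \<iota> i differentiable at z" for i by (rule diff_Om[OF zO Cdiff_X1[OF \<iota>]])
  have dNL: "NL (W \<rho>) \<iota> i differentiable at z" for i by (rule diff_Om[OF zO Cdiff_NL[OF \<iota> Cdiff_W]])
  have dWX: "(\<lambda>z. dird (W ?c) v z * X \<iota> i z) differentiable at z" for v i
    by (rule differentiable_mult[OF dW dX])
  let ?Mi = "\<lambda>i. dird M (ex i) z"
  let ?adv = "\<Sum>i\<in>UNIV. ?Mi i * (\<Sum>j\<in>UNIV. q j z * dX \<iota> i j z)"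
  let ?Tr = "\<Sum>i\<in>UNIV. \<Sum>j\<in>UNIV. dird (q j) (ex i) z * dX \<iota> i j z"
  let ?MX = "\<Sum>i\<in>UNIV. ?Mi i * dird (X \<iota> i) et z"
  define e E E' where "e = exp (- a * M z)" and "E = exp (\<rho> * M z)" and "E' = exp (?c * M z)"
  have Ee: "E' * e = E" by (simp add: e_def E_def E'_def mult_exp_exp algebra_simps)
  have "dird (G ?c \<iota>) et z = (\<Sum>i\<in>UNIV. dird (\<lambda>z. dird (W ?c) (ex i) z * X \<iota> i z) et z)"
    unfolding G_def[abs_def] by (rule dird_sum[OF dWX])
  also have "\<dots> = (\<Sum>i\<in>UNIV. dird (W ?c) (ex i) z * dird (X \<iota> i) et z) + (\<Sum>i\<in>UNIV. dird (dird (W ?c) (ex i)) et z * X \<iota> i z)"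
    unfolding dird_mult[OF dW dX] sum.distrib ..
  also have "(\<Sum>i\<in>UNIV. dird (W ?c) (ex i) z * dird (X \<iota> i) et z) = E' * ?MX"
    unfolding dird_W[OF zO c0(1)] E'_def sum_distrib_left by (simp add: mult.assoc)
  finally have dG: "dird (G ?c \<iota>) et z = E' * ?MX + (\<Sum>i\<in>UNIV. dird (dird (W ?c) (ex i)) et z * X \<iota> i z)" .
  have "dird (R ?c \<rho> \<iota> i) (ex i) z = (dird (W ?c) et z * dird (X \<iota> i) (ex i) z + dird (dird (W ?c) et) (ex i) z * X \<iota> i z)
      + dird (NL (W \<rho>) \<iota> i) (ex i) z" for i
    unfolding R_def[abs_def] dird_add[OF dWX dNL] dird_mult[OF dW dX] ..
  then have "(\<Sum>i\<in>UNIV. dird (R ?c \<rho> \<iota> i) (ex i) z) = dird (W ?c) et z * divX \<iota> z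
      + (\<Sum>i\<in>UNIV. dird (dird (W ?c) et) (ex i) z * X \<iota> i z) + (\<Sum>i\<in>UNIV. dird (NL (W \<rho>) \<iota> i) (ex i) z)"
    by (simp only: sum.distrib sum_distrib_left[symmetric] divX_def dX_def)
  \<comment> \<open>Mixed derivatives of \<open>W\<close> commute, so this sum cancels the same sum
    in \<open>dG\<close>.\<close>
  also have "(\<Sum>i\<in>UNIV. dird (dird (W ?c) et) (ex i) z * X \<iota> i z) = (\<Sum>i\<in>UNIV. dird (dird (W ?c) (ex i)) et z * X \<iota> i z)"
    by (intro sum.cong refl arg_cong2[where f = "(*)"] dird_commute[OF open_Om zO Cdiff_W])
  also have "(\<Sum>i\<in>UNIV. dird (NL (W \<rho>) \<iota> i) (ex i) z) = E * ?adv + E / \<rho> * ?Tr - (E * S z + E / \<rho> * D z) * divX \<iota> z"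
  proof -
    have "(\<Sum>i\<in>UNIV. dird (W \<rho>) (ex i) z * (\<Sum>j\<in>UNIV. q j z * dX \<iota> i j z)) = E * ?adv"
      unfolding dird_W[OF zO c0(2)] E_def sum_distrib_left[of "exp (\<rho> * M z)"] by (simp only: mult.assoc)
    moreover have "(\<Sum>i\<in>UNIV. dird (W \<rho>) (ex i) z * q i z) = E * S z"
      unfolding dird_W[OF zO c0(2)] E_def S_def sum_distrib_left by (simp only: mult_ac)
    moreover have "W \<rho> z = E / \<rho>" by (simp add: W_def E_def)
    ultimately show ?thesis unfolding NL_div[OF z Cdiff_W] by (simp only:)
  qed
  also have "dird (W ?c) et z = E * (D z + (1 - a) * S z)"
    unfolding dird_W[OF zO c0(1)] continuity_eq[OF z] E'_def[symmetric] e_def[symmetric] Ee[symmetric] by (simp only: mult.assoc)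
  finally have dR: "(\<Sum>i\<in>UNIV. dird (R ?c \<rho> \<iota> i) (ex i) z) = E * (D z + (1 - a) * S z) * divX \<iota> z
      + (\<Sum>i\<in>UNIV. dird (dird (W ?c) (ex i)) et z * X \<iota> i z)
      + (E * ?adv + E / \<rho> * ?Tr - (E * S z + E / \<rho> * D z) * divX \<iota> z)" .
  let ?K = "a * (\<beta> - 1) / \<beta>" and ?\<zeta> = "cutoff \<iota> (s z)"
  \<comment> \<open>Since \<open>E' * e = E\<close>, the advection term appearing here equals the
    one in \<open>dR\<close>, and the two cancel.\<close>
  have "E' * ?MX \<le> E' * (e * ?adv - e * ?K * ?\<zeta> * (S z)\<^sup>2)"
    by (rule mult_left_mono) (use time_derivative_bound[OF z, of \<iota>] \<iota> in \<open>auto simp: e_def E'_def\<close>)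
  also have "\<dots> = E * ?adv - E * (?K * ?\<zeta> * (S z)\<^sup>2)" unfolding Ee[symmetric] by (simp add: algebra_simps)
  finally have "- dird (G ?c \<iota>) et z + (\<Sum>i\<in>UNIV. dird (R ?c \<rho> \<iota> i) (ex i) z) \<ge>
      E * ((D z + (1 - a) * S z) * divX \<iota> z + ?K * ?\<zeta> * (S z)\<^sup>2 + ?Tr / \<rho> - (S z + D z / \<rho>) * divX \<iota> z)"
    unfolding dG dR by (simp add: algebra_simps)
  moreover have "(D z + (1 - a) * S z) * divX \<iota> z + ?K * ?\<zeta> * (S z)\<^sup>2 + ?Tr / \<rho> - (S z + D z / \<rho>) * divX \<iota> z
      \<ge> - (\<omega> \<iota> z * (\<rho> * ((1 - 1 / \<rho>) * D z - a * S z)\<^sup>2 / (4 * (\<beta> - 1))))"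
    unfolding divX_eq[OF z]
    by (rule pointwise_convexity_bound[OF cutoff_nonneg \<omega>_nonneg \<rho> _ disc trace_bound[OF z]]) (use \<iota> \<beta>_gt in auto)
  then have "E * ((D z + (1 - a) * S z) * divX \<iota> z + ?K * ?\<zeta> * (S z)\<^sup>2 + ?Tr / \<rho> - (S z + D z / \<rho>) * divX \<iota> z)
      \<ge> E * - (\<omega> \<iota> z * (\<rho> * ((1 - 1 / \<rho>) * D z - a * S z)\<^sup>2 / (4 * (\<beta> - 1))))"
    by (intro mult_left_mono) (auto simp: E_def)
  ultimately show ?thesis unfolding E_def by linarith
qed

section \<open>Continuous majorants and the pointwise bound on the whole cylinder\<close>

definition Sb where "Sb z = (\<Sum>i\<in>UNIV. s z powr ((\<beta> - 1) / 2) * \<bar>dird M (ex i) z\<bar>)"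
text \<open>\<open>D\<close> contains second derivatives of \<open>u\<close> with a possibly
  singular weight. The continuity equation expresses it by the time derivative of \<open>M\<close>
  and by \<open>S\<close>, which gives a majorant continuous up to the critical set.\<close>

definition Db where "Db z = \<bar>exp (a * M z) * dird M et z\<bar> + \<bar>1 - a\<bar> * Sb z"

lemma continuous_M: "continuous_on Om M" "continuous_on Om (dird M v)"
  by (rule Cdiff_continuous[OF Cdiff_M]) (rule Cdiff_continuous[OF Cdiff_dird[OF Cdiff_M]])

lemma continuous_s: "continuous_on Om s"
  by (rule Cdiff_continuous[OF Cdiff_s])

lemma continuous_Sb: "continuous_on Om Sb"
  unfolding Sb_def[abs_def] using \<beta>_gt s_nonneg
  by (intro continuous_on_sum continuous_on_mult continuous_on_powr' continuous_s continuous_on_const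
      continuous_on_rabs continuous_M) auto

lemma continuous_Db: "continuous_on Om Db"
  unfolding Db_def[abs_def]
  by (intro continuous_on_add continuous_on_mult continuous_on_rabs continuous_on_exp continuous_on_const
      continuous_M continuous_Sb)

lemma Sb_nonneg: "Sb z \<ge> 0" unfolding Sb_def by (intro sum_nonneg) simp
lemma Db_nonneg: "Db z \<ge> 0" unfolding Db_def using Sb_nonneg[of z] by simp

lemma abs_q_le: "z \<in> P \<Longrightarrow> \<bar>q i z\<bar> \<le> s z powr ((\<beta> - 1) / 2)"
proof -
  assume z: "z \<in> P"
  have "p i z * p i z \<le> s z" unfolding s_def by (rule member_le_sum) auto
  then have "\<bar>p i z\<bar> \<le> sqrt (s z)" by (metis power2_eq_square real_sqrt_abs real_sqrt_le_iff)
  also have "\<dots> = s z powr (1 / 2)" using s_pos[OF z] by (simp add: powr_half_sqrt)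
  finally have "k z * \<bar>p i z\<bar> \<le> k z * s z powr (1 / 2)" by (intro mult_left_mono) (auto simp: k_def)
  also have "\<dots> = s z powr ((\<beta> - 1) / 2)" by (simp add: k_def powr_add[symmetric] add_divide_distrib[symmetric])
  finally show ?thesis by (simp add: q_def abs_mult k_def)
qed

lemma abs_S_le: "z \<in> P \<Longrightarrow> \<bar>S z\<bar> \<le> Sb z"
  unfolding S_def Sb_def
  by (rule order_trans[OF sum_abs], rule sum_mono) (auto simp: abs_mult intro: mult_right_mono abs_q_le)

lemma abs_D_le: "z \<in> P \<Longrightarrow> \<bar>D z\<bar> \<le> Db z"
proof -
  assume z: "z \<in> P"
  have "exp (a * M z) * dird M et z = D z + (1 - a) * S z"
    unfolding continuity_eq[OF z] by (simp add: mult.assoc[symmetric] mult_exp_exp)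
  then have "D z = exp (a * M z) * dird M et z - (1 - a) * S z" by simp
  then have "\<bar>D z\<bar> \<le> \<bar>exp (a * M z) * dird M et z\<bar> + \<bar>(1 - a) * S z\<bar>" by linarith
  also have "\<bar>(1 - a) * S z\<bar> \<le> \<bar>1 - a\<bar> * Sb z"
    unfolding abs_mult by (intro mult_left_mono abs_S_le z) auto
  finally show ?thesis by (simp add: Db_def)
qed

text \<open>Estimating the logarithm by \<open>s z\<close> gives a bound that is uniform in
  \<open>\<iota> \<le> 1\<close> and continuous at critical points.\<close>

lemma cutoff_base_le:
  assumes "z \<in> P" "0 < \<iota>" "\<iota> \<le> 1"
  shows "max 0 (1 + \<iota> * ln (s z)) \<le> 1 + s z"
proof -
  have s: "s z > 0" using assms(1) by (rule s_pos)
  have "\<iota> * ln (s z) \<le> s z"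
  proof (cases "ln (s z) \<ge> 0")
    case True
    then have "\<iota> * ln (s z) \<le> 1 * ln (s z)" using assms by (intro mult_right_mono) auto
    also have "\<dots> \<le> s z" using ln_le_minus_one[OF s] by simp
    finally show ?thesis .
  next
    case False
    then have "\<iota> * ln (s z) \<le> 0" using assms by (simp add: mult_nonneg_nonpos)
    then show ?thesis using s by linarith
  qed
  then show ?thesis using s by simp
qed

lemma \<omega>_le:
  assumes "z \<in> P" "0 < \<iota>" "\<iota> \<le> 1"
  shows "\<omega> \<iota> z \<le> \<iota> * (6 * (1 + s z)\<^sup>2)"
  using mult_left_mono[OF power_mono[OF cutoff_base_le[OF assms], of 2], of "6 * \<iota>"] assms(2)
  by (simp add: \<omega>_def mult_ac)

lemma cutoff_le:
  assumes "0 < \<iota>" "\<iota> \<le> 1" "z \<in> Om"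
  shows "cutoff \<iota> (s z) \<le> (1 + s z) ^ 3"
proof (cases "z \<in> P")
  case True
  then show ?thesis
    using power_mono[OF cutoff_base_le[OF True assms(1,2)], of 3] s_pos[OF True] by (simp add: cutoff_def)
next
  case False
  then have "s z = 0" using s_nonneg[of z] assms(3) by (auto simp: P_def)
  then show ?thesis by (simp add: cutoff_def)
qed

text \<open>The loss term of \<open>convexity_pointwise_P\<close> with \<open>D\<close>,
  \<open>S\<close> and \<open>\<omega>\<close> replaced by their majorants and the factor
  \<open>\<iota>\<close> of the last one taken out.\<close>

definition CB where
  "CB \<rho> z = exp (\<rho> * M z) * ((6 * (1 + s z)\<^sup>2) * (\<rho> * (Db z + a * Sb z)\<^sup>2 / (4 * (\<beta> - 1))))"

lemma continuous_CB: "continuous_on Om (CB \<rho>)"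
  unfolding CB_def[abs_def] using \<beta>_gt
  by (intro continuous_on_add continuous_on_mult continuous_on_power continuous_on_divide continuous_on_exp
      continuous_on_const continuous_M continuous_Sb continuous_Db continuous_s) auto

lemma a_pos: "a > 0" using \<alpha>_pos \<beta>_gt by (simp add: a_def)

lemma convexity_pointwise:
  assumes z: "z \<in> Om" and \<iota>: "0 < \<iota>" "\<iota> \<le> 1" and \<rho>: "\<rho> > 1"
    and disc: "a\<^sup>2 \<le> 4 * (1 - 1 / \<rho>) * (a * (\<beta> - 1) / \<beta>)"
  shows "dird (G (\<rho> + a) \<iota>) et z \<le> (\<Sum>i\<in>UNIV. dird (R (\<rho> + a) \<rho> \<iota> i) (ex i) z) + \<iota> * CB \<rho> z"
proof (cases "z \<in> P")
  case True
  have "\<bar>(1 - 1 / \<rho>) * D z - a * S z\<bar> \<le> \<bar>(1 - 1 / \<rho>) * D z\<bar> + \<bar>a * S z\<bar>" by linarith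
  also have "\<dots> = (1 - 1 / \<rho>) * \<bar>D z\<bar> + a * \<bar>S z\<bar>" using \<rho> a_pos by (simp add: abs_mult)
  also have "\<dots> \<le> 1 * Db z + a * Sb z"
    by (intro add_mono mult_mono abs_D_le[OF True] abs_S_le[OF True]) (use \<rho> a_pos in auto)
  finally have "\<bar>(1 - 1 / \<rho>) * D z - a * S z\<bar> \<le> Db z + a * Sb z" by simp
  then have E: "((1 - 1 / \<rho>) * D z - a * S z)\<^sup>2 \<le> (Db z + a * Sb z)\<^sup>2"
    by (metis abs_le_square_iff abs_of_nonneg abs_ge_zero order_trans)
  have "exp (\<rho> * M z) * (\<omega> \<iota> z * (\<rho> * ((1 - 1 / \<rho>) * D z - a * S z)\<^sup>2 / (4 * (\<beta> - 1))))
      \<le> exp (\<rho> * M z) * ((\<iota> * (6 * (1 + s z)\<^sup>2)) * (\<rho> * (Db z + a * Sb z)\<^sup>2 / (4 * (\<beta> - 1))))"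
    by (intro mult_left_mono mult_mono divide_right_mono \<omega>_le[OF True \<iota>] E) (use \<rho> \<beta>_gt \<iota> in auto)
  also have "\<dots> = \<iota> * CB \<rho> z" by (simp add: CB_def)
  finally show ?thesis using convexity_pointwise_P[OF True \<iota>(1) \<rho> disc] by linarith
next
  case False
  \<comment> \<open>Critical points lie in \<open>P0 \<iota>\<close>, where both derivatives vanish,
    so the bound reduces to nonnegativity of \<open>CB\<close>.\<close>
  then have "z \<in> P0 \<iota>" using z Om_eq by blast
  moreover have "CB \<rho> z \<ge> 0" using \<rho> \<beta>_gt by (simp add: CB_def)
  ultimately show ?thesis using zero_P0[OF \<iota>(1)] \<iota>(1) by simp
qed

section \<open>The error caused by the gradient of the cutoff\<close>

definition V where "V \<iota> z = (\<Sum>i\<in>UNIV. dird (NL (\<lambda>_. 1) \<iota> i) (ex i) z)"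

text \<open>The first two summands dominate the negative terms of \<open>V\<close>, namely the
  square of \<open>D\<close> and the remainder after splitting D y by Young's inequality. The last
  one keeps a reserve that pays for the constant part when |y| is bounded by its square.\<close>

definition VB where
  "VB z = (1 + s z) ^ 3 * (Db z)\<^sup>2 + 6 * (1 + s z)\<^sup>2 * (Db z)\<^sup>2 / (2 * (\<beta> - 1)) + 3 * (\<beta> - 1) * (1 + s z)\<^sup>2"

lemma continuous_VB: "continuous_on Om VB"
  unfolding VB_def[abs_def] using \<beta>_gt
  by (intro continuous_on_add continuous_on_mult continuous_on_power continuous_on_divide
      continuous_on_const continuous_Db continuous_s) auto

definition Err where
  "Err r \<iota> z = (\<Sum>i\<in>UNIV. dird (\<lambda>z. exp ((r - a) * M z) * X \<iota> i z) (ex i) z) - (r - 1) * G (r - a) \<iota> z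
    - cutoff \<iota> (s z) * (exp (r * M z) * dird M et z)"

text \<open>Multiplying the continuity equation by the cutoff and moving the cutoff under the
  divergence leaves just the term where the gradient of the cutoff meets \<open>q\<close>.\<close>

lemma Err_P:
  assumes z: "z \<in> P" and \<iota>: "0 < \<iota>" and c: "r \<noteq> a"
  shows "Err r \<iota> z = exp ((r - a) * M z) * (\<omega> \<iota> z * y z)"
proof -
  note zO = P_Om[OF z]
  have dX: "X \<iota> i differentiable at z" for i by (rule diff_Om[OF zO Cdiff_X1[OF \<iota>]])
  have dE: "(\<lambda>z. exp ((r - a) * M z)) differentiable at z" by (rule diff_Om[OF zO Cdiff_exp_M])
  define E where "E = exp ((r - a) * M z)"
  define \<zeta> where "\<zeta> = cutoff \<iota> (s z)"
  have "dird (\<lambda>z. exp ((r - a) * M z) * X \<iota> i z) (ex i) z = E * dX \<iota> i i z + ((r - a) * E * \<zeta>) * (q i z * dird M (ex i) z)" for i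
    unfolding dird_mult[OF dE dX] dird_exp_M[OF zO] by (simp add: dX_def E_def X_def \<zeta>_def)
  then have 1: "(\<Sum>i\<in>UNIV. dird (\<lambda>z. exp ((r - a) * M z) * X \<iota> i z) (ex i) z) = E * divX \<iota> z + ((r - a) * E * \<zeta>) * S z"
    by (simp only: sum.distrib sum_distrib_left[symmetric] divX_def S_def)
  have "dird (W (r - a)) (ex i) z * X \<iota> i z = (E * \<zeta>) * (q i z * dird M (ex i) z)" for i
    using dird_W[OF zO, of "r - a"] c by (simp add: X_def E_def \<zeta>_def)
  then have 2: "G (r - a) \<iota> z = (E * \<zeta>) * S z"
    by (simp only: G_def sum_distrib_left[symmetric] S_def)
  have 3: "exp (r * M z) * dird M et z = E * (D z + (1 - a) * S z)"
    unfolding continuity_eq[OF z] E_def mult.assoc[symmetric] mult_exp_exp by (simp add: algebra_simps)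
  show ?thesis unfolding Err_def 1 2 3 divX_eq[OF z] \<zeta>_def[symmetric] E_def[symmetric] by (simp add: algebra_simps)
qed

text \<open>\<open>V\<close> is the trace of Dq DX minus \<open>D * divX\<close>; its trace part
  controls \<omega> y^2. As \<open>V\<close> is also a divergence, it has integral 0, so the right
  side will be small in the mean even though y is not bounded pointwise.\<close>

lemma Err_bound:
  assumes z: "z \<in> Om" and \<iota>: "0 < \<iota>" "\<iota> \<le> 1" and c: "r \<noteq> a"
  shows "0 \<le> V \<iota> z + VB z" "\<bar>Err r \<iota> z\<bar> \<le> exp ((r - a) * M z) * (sqrt \<iota> * (2 / (\<beta> - 1) * (V \<iota> z + VB z)))"
proof -
  have "0 \<le> V \<iota> z + VB z \<and> \<bar>Err r \<iota> z\<bar> \<le> exp ((r - a) * M z) * (sqrt \<iota> * (2 / (\<beta> - 1) * (V \<iota> z + VB z)))"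
  proof (cases "z \<in> P")
    case True
    define b where "b = \<beta> - 1"
    have b: "b > 0" using \<beta>_gt by (simp add: b_def)
    define w where "w = \<omega> \<iota> z"
    have w: "0 \<le> w" "w \<le> \<iota> * (6 * (1 + s z)\<^sup>2)"
      using \<omega>_nonneg[of \<iota> z] \<omega>_le[OF True \<iota>] \<iota> by (auto simp: w_def)
    have w1: "w \<le> 6 * (1 + s z)\<^sup>2"
    proof -
      have "\<iota> * (6 * (1 + s z)\<^sup>2) \<le> 1 * (6 * (1 + s z)\<^sup>2)" using \<iota> by (intro mult_right_mono) auto
      then show ?thesis using w(2) by linarith
    qed
    have d0: "dird (\<lambda>_. 1 :: real) v z = 0" for v by simp
    have "V \<iota> z = (\<Sum>i\<in>UNIV. \<Sum>j\<in>UNIV. dird (q j) (ex i) z * dX \<iota> i j z) - D z * divX \<iota> z"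
      unfolding V_def NL_div[OF True Cdiff_const] d0 by simp
    then have V: "V \<iota> z \<ge> w * b * (y z)\<^sup>2 - cutoff \<iota> (s z) * (D z)\<^sup>2 - w * (D z * y z)"
      using trace_bound[OF True, of \<iota>] \<iota> unfolding divX_eq[OF True] w_def[symmetric] b_def[symmetric]
      by (simp add: algebra_simps power2_eq_square)
    have D2: "(D z)\<^sup>2 \<le> (Db z)\<^sup>2"
      using abs_D_le[OF True] Db_nonneg[of z] by (metis abs_le_square_iff abs_of_nonneg)
    \<comment> \<open>Young's inequality with half of the coefficient \<open>b\<close>, so that the
      other half of the gain in y^2 is kept.\<close>
    have "D z * y z \<le> b / 2 * (y z)\<^sup>2 + (D z)\<^sup>2 / (2 * b)"
    proof -
      have "0 \<le> (b * y z - D z)\<^sup>2 / (2 * b)" using b by simp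
      also have "\<dots> = b / 2 * (y z)\<^sup>2 + (D z)\<^sup>2 / (2 * b) - D z * y z"
        using b by (simp add: power2_eq_square field_simps)
      finally show ?thesis by simp
    qed
    then have "w * (D z * y z) \<le> w * (b / 2 * (y z)\<^sup>2 + (D z)\<^sup>2 / (2 * b))"
      by (rule mult_left_mono[OF _ w(1)])
    also have "\<dots> = b / 2 * (w * (y z)\<^sup>2) + w * ((D z)\<^sup>2 / (2 * b))" by (simp add: algebra_simps)
    also have "w * ((D z)\<^sup>2 / (2 * b)) \<le> (6 * (1 + s z)\<^sup>2) * ((Db z)\<^sup>2 / (2 * b))"
      by (intro mult_mono divide_right_mono w1 D2) (use b in auto)
    finally have 1: "w * (D z * y z) \<le> b / 2 * (w * (y z)\<^sup>2) + 6 * (1 + s z)\<^sup>2 * (Db z)\<^sup>2 / (2 * b)" by simp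
    have 2: "cutoff \<iota> (s z) * (D z)\<^sup>2 \<le> (1 + s z) ^ 3 * (Db z)\<^sup>2"
      by (intro mult_mono cutoff_le[OF \<iota> z] D2) (use s_nonneg[of z] in auto)
    have 3: "V \<iota> z + VB z \<ge> b / 2 * (w * (y z)\<^sup>2 + 6 * (1 + s z)\<^sup>2)"
      using V 1 2 unfolding VB_def b_def[symmetric] by (simp add: algebra_simps)
    moreover have 4: "b / 2 * (w * (y z)\<^sup>2 + 6 * (1 + s z)\<^sup>2) \<ge> 0" using b w by simp
    ultimately have pos: "V \<iota> z + VB z \<ge> 0" by linarith
    have "\<bar>w * y z\<bar> \<le> sqrt \<iota> * (w * (y z)\<^sup>2 + 6 * (1 + s z)\<^sup>2)"
    proof -
      \<comment> \<open>The weight \<open>sqrt \<iota>\<close> balances the two terms: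
        \<open>w\<close> is of order \<open>\<iota>\<close>, so after multiplication by
        \<open>w\<close> both are of order \<open>sqrt \<iota>\<close>, up to the quantity that
        \<open>V\<close> controls.\<close>
      have "2 * \<bar>y z\<bar> \<le> sqrt \<iota> * (y z)\<^sup>2 + 1 / sqrt \<iota>"
      proof -
        have "0 \<le> (sqrt \<iota> * \<bar>y z\<bar> - 1)\<^sup>2 / sqrt \<iota>" using \<iota> by simp
        also have "\<dots> = sqrt \<iota> * (y z)\<^sup>2 + 1 / sqrt \<iota> - 2 * \<bar>y z\<bar>"
        proof -
          have "(sqrt \<iota> * \<bar>y z\<bar> - 1)\<^sup>2 = sqrt \<iota> * (sqrt \<iota> * (y z)\<^sup>2) + 1 - 2 * (sqrt \<iota> * \<bar>y z\<bar>)"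
            by (simp add: power2_eq_square algebra_simps)
          then show ?thesis using \<iota> by (simp add: diff_divide_distrib add_divide_distrib)
        qed
        finally show ?thesis by simp
      qed
      then have "\<bar>y z\<bar> \<le> sqrt \<iota> * (y z)\<^sup>2 + 1 / sqrt \<iota>" using abs_ge_zero[of "y z"] by linarith
      then have "w * \<bar>y z\<bar> \<le> w * (sqrt \<iota> * (y z)\<^sup>2 + 1 / sqrt \<iota>)" by (rule mult_left_mono[OF _ w(1)])
      also have "\<dots> = sqrt \<iota> * (w * (y z)\<^sup>2) + w / sqrt \<iota>" by (simp add: algebra_simps)
      also have "w / sqrt \<iota> \<le> \<iota> * (6 * (1 + s z)\<^sup>2) / sqrt \<iota>" using w(2) \<iota> by (intro divide_right_mono) auto
      also have "\<dots> = sqrt \<iota> * (6 * (1 + s z)\<^sup>2)" using \<iota> real_div_sqrt[of \<iota>] by (simp add: mult.commute mult.left_commute divide_inverse)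
      finally show ?thesis using w(1) by (simp add: abs_mult algebra_simps)
    qed
    also have "\<dots> \<le> sqrt \<iota> * (2 / b * (V \<iota> z + VB z))"
      using 3 b \<iota> by (intro mult_left_mono) (auto simp: field_simps)
    finally have "exp ((r - a) * M z) * \<bar>w * y z\<bar> \<le> exp ((r - a) * M z) * (sqrt \<iota> * (2 / b * (V \<iota> z + VB z)))"
      by (intro mult_left_mono) auto
    then show ?thesis using pos unfolding Err_P[OF True \<iota>(1) c] by (simp add: abs_mult w_def b_def)
  next
    case False
    then have z0: "z \<in> P0 \<iota>" using z Om_eq by blast
    have "V \<iota> z = 0" by (simp add: V_def zero_P0[OF \<iota>(1) z0])
    moreover have "VB z \<ge> 0" using \<beta>_gt s_nonneg[of z] by (simp add: VB_def)
    moreover have "cutoff \<iota> (s z) = 0" using z0 \<iota> by (simp add: P0_def cutoff_eq_0)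
    then have "Err r \<iota> z = 0"
      by (simp add: Err_def zero_P0[OF \<iota>(1) z0] G_def X_P0[OF \<iota>(1) z0])
    ultimately show ?thesis using \<beta>_gt \<iota> by simp
  qed
  then show "0 \<le> V \<iota> z + VB z" "\<bar>Err r \<iota> z\<bar> \<le> exp ((r - a) * M z) * (sqrt \<iota> * (2 / (\<beta> - 1) * (V \<iota> z + VB z)))"
    by auto
qed

section \<open>Convexity of the moments\<close>

text \<open>Invariance under the coordinate unit shifts is what
  \<open>integral_periodic_dird\<close> asks for.\<close>

definition per :: "((real ^ 'n) \<times> real \<Rightarrow> real) \<Rightarrow> bool" where
  "per f \<longleftrightarrow> (\<forall>z\<in>Om. \<forall>i. f (z + ex i) = f z)"

lemma shift_Om: "z \<in> Om \<Longrightarrow> z + ex i \<in> Om"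
  by (auto simp: Om_def)

lemma per_dird:
  assumes "per f" "\<And>z. z \<in> Om \<Longrightarrow> f differentiable at z"
  shows "per (dird f v)"
  unfolding per_def
proof (intro ballI allI)
  fix z i assume z: "z \<in> Om"
  have "dird f v (z + ex i) = dird (\<lambda>z. f (z + ex i)) v z"
    by (rule dird_shift[OF assms(2)[OF shift_Om[OF z]], symmetric])
  also have "\<dots> = dird f v z"
    by (rule dird_cong_open[OF open_Om z]) (use assms(1) in \<open>auto simp: per_def\<close>)
  finally show "dird f v (z + ex i) = dird f v z" .
qed

lemma torus_periodic_axis: "torus_periodic f \<Longrightarrow> f (x + axis i 1) = f x"
  unfolding torus_periodic_def by (simp add: axis_def)

lemma per_if_torus_periodic:
  assumes "\<forall>t\<in>{0..T}. torus_periodic (\<lambda>x. f (x, t))"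
  shows "per f"
  unfolding per_def
proof (intro ballI allI)
  fix z i assume "z \<in> Om"
  then obtain x t where z: "z = (x, t)" "t \<in> {0..T}" by (auto simp: Om_def)
  then have "torus_periodic (\<lambda>x. f (x, t))" using assms by blast
  from torus_periodic_axis[OF this, of x i] show "f (z + ex i) = f z" using z by simp
qed

lemma per_u: "per u" and per_m: "per m"
  by (rule per_if_torus_periodic[OF u_periodic]) (rule per_if_torus_periodic[OF m_periodic])

lemma per_M: "per M" using per_m by (simp add: per_def M_def)
lemma per_p: "per (p i)" unfolding p_def by (rule per_dird[OF per_u differentiable_u])
lemma per_s: "per s" using per_p by (simp add: per_def s_def)
lemma per_q: "per (q i)" using per_p per_s by (simp add: per_def q_def k_def)
lemma per_X: "per (X \<iota> i)" using per_q per_s by (simp add: per_def X_def)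

lemma per_dX: "\<iota> > 0 \<Longrightarrow> per (dX \<iota> i j)"
  unfolding dX_def by (rule per_dird[OF per_X diff_Om[OF _ Cdiff_X1]])

lemma per_W: "per (W c)" using per_M by (simp add: per_def W_def)

lemma per_dW: "per (dird (W c) v)"
  by (rule per_dird[OF per_W diff_Om[OF _ Cdiff_W]])

lemma per_NL: "\<iota> > 0 \<Longrightarrow> per Y \<Longrightarrow> per (NL Y \<iota> i)"
  using per_dX[of \<iota>] per_q by (simp add: per_def NL_def divX_def)

lemma per_R: "\<iota> > 0 \<Longrightarrow> per (R c b \<iota> i)"
  using per_dW per_X per_NL[OF _ per_W] by (simp add: per_def R_def)

section \<open>Integrals over the unit cell and their time derivatives\<close>

definition I where "I f t = integral (cbox 0 1) (\<lambda>x :: real ^ 'n. f (x, t) :: real)"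

lemma continuous_slice:
  assumes "continuous_on Om f" "t \<in> {0<..<T}"
  shows "continuous_on A (\<lambda>x. f (x, t))"
proof -
  have "continuous_on A (f \<circ> (\<lambda>x. (x, t)))"
  proof (rule continuous_on_compose)
    show "continuous_on A (\<lambda>x :: real ^ 'n. (x, t))" by (intro continuous_intros)
    show "continuous_on ((\<lambda>x. (x, t)) ` A) f"
      by (rule continuous_on_subset[OF assms(1)]) (use assms(2) in \<open>auto simp: Om_def\<close>)
  qed
  then show ?thesis by (simp add: o_def)
qed

lemma integrable_slice:
  fixes f :: "(real ^ 'n) \<times> real \<Rightarrow> real"
  assumes "continuous_on Om f" "t \<in> {0<..<T}"
  shows "(\<lambda>x. f (x, t)) integrable_on cbox 0 1"
  by (rule integrable_continuous[OF continuous_slice[OF assms]])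

lemma I_mono:
  assumes "t \<in> {0<..<T}" "continuous_on Om f" "continuous_on Om f'" "\<And>x. x \<in> cbox 0 1 \<Longrightarrow> f (x, t) \<le> f' (x, t)"
  shows "I f t \<le> I f' t"
  unfolding I_def
  by (rule integral_le[OF integrable_slice[OF assms(2,1)] integrable_slice[OF assms(3,1)]])
     (rule assms(4))

lemma I_add:
  assumes "t \<in> {0<..<T}" "continuous_on Om f" "continuous_on Om f'"
  shows "I (\<lambda>z. f z + f' z) t = I f t + I f' t"
  unfolding I_def by (rule integral_add[OF integrable_slice[OF assms(2,1)] integrable_slice[OF assms(3,1)]])

lemma I_diff:
  assumes "t \<in> {0<..<T}" "continuous_on Om f" "continuous_on Om f'"
  shows "I (\<lambda>z. f z - f' z) t = I f t - I f' t"
  unfolding I_def by (rule integral_diff[OF integrable_slice[OF assms(2,1)] integrable_slice[OF assms(3,1)]])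

lemma I_cmult: "I (\<lambda>z. c * f z) t = c * I f t"
  unfolding I_def by (rule integral_mult_right)

lemma I_div:
  assumes t: "t \<in> {0<..<T}" and F: "\<And>i. Cdiff (Suc 0) (F i) Om" and per: "\<And>i. per (F i)"
  shows "I (\<lambda>z. \<Sum>i\<in>UNIV. dird (F i) (ex i) z) t = 0"
proof -
  have z: "(x, t) \<in> Om" for x :: "real ^ 'n" using t by (simp add: Om_def)
  have 0: "integral (cbox 0 1) (\<lambda>x. dird (F i) (ex i) (x, t)) = 0" for i
  proof -
    have sl: "dird (\<lambda>y. F i (y, t)) (axis i 1) = (\<lambda>x. dird (F i) (ex i) (x, t))"
      using dird_slice(1)[OF diff_Om[OF z F]] by (simp add: fun_eq_iff)
    have "integral (cbox 0 1) (dird (\<lambda>y. F i (y, t)) (axis i 1)) = 0"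
    proof (rule integral_periodic_dird)
      show "(\<lambda>y. F i (y, t)) differentiable at x" for x by (rule dird_slice(2)[OF diff_Om[OF z F]])
      show "continuous_on UNIV (dird (\<lambda>y. F i (y, t)) (axis i 1))"
        unfolding sl by (rule continuous_slice[OF Cdiff_continuous[OF Cdiff_dird[OF F]] t])
      show "F i (x + axis i 1, t) = F i (x, t)" for x
      proof -
        have "F i ((x, t) + ex i) = F i (x, t)" using per[of i] z[of x] unfolding per_def by blast
        then show ?thesis by simp
      qed
    qed
    then show ?thesis unfolding sl .
  qed
  have "I (\<lambda>z. \<Sum>i\<in>UNIV. dird (F i) (ex i) z) t = (\<Sum>i\<in>UNIV. integral (cbox 0 1) (\<lambda>x. dird (F i) (ex i) (x, t)))"
    unfolding I_def by (rule integral_sum) (auto intro: integrable_slice[OF Cdiff_continuous[OF Cdiff_dird[OF F]] t])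
  then show ?thesis using 0 by simp
qed

lemma I_deriv:
  assumes t: "t \<in> {0<..<T}" and f: "Cdiff (Suc 0) f Om"
  shows "(I f has_field_derivative I (dird f et) t) (at t)"
proof -
  have "((\<lambda>t. integral (cbox 0 1) (\<lambda>x. f (x, t))) has_field_derivative integral (cbox 0 1) (\<lambda>x. dird f et (x, t))) (at t within {0<..<T})"
  proof (rule leibniz_rule_field_derivative)
    show "((\<lambda>t. f (x, t)) has_field_derivative dird f et (x, r)) (at r within {0<..<T})"
      if "r \<in> {0<..<T}" for x r
    proof -
      have "(x, r) \<in> Om" using that by (simp add: Om_def)
      from deriv_time_slice[OF diff_Om[OF this f]] show ?thesis by (rule has_field_derivative_at_within)
    qed
    show "(\<lambda>x. f (x, r)) integrable_on cbox 0 1" if "r \<in> {0<..<T}" for r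
      by (rule integrable_slice[OF Cdiff_continuous[OF f] that])
    have "continuous_on ({0<..<T} \<times> cbox 0 1) (dird f et \<circ> (\<lambda>z. (snd z, fst z)))"
    proof (rule continuous_on_compose)
      show "continuous_on ({0<..<T} \<times> cbox 0 1) (\<lambda>z :: real \<times> (real ^ 'n). (snd z, fst z))"
        by (intro continuous_intros)
      have "continuous_on Om (dird f et)" by (rule Cdiff_continuous[OF Cdiff_dird[OF f]])
      moreover have "(\<lambda>z. (snd z, fst z)) ` ({0<..<T} \<times> cbox 0 1) \<subseteq> Om"
        unfolding Om_def image_subset_iff by simp
      ultimately show "continuous_on ((\<lambda>z. (snd z, fst z)) ` ({0<..<T} \<times> cbox 0 1)) (dird f et)"
        by (rule continuous_on_subset)
    qed
    then show "continuous_on ({0<..<T} \<times> cbox 0 1) (\<lambda>(t, x). dird f et (x, t))"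
      unfolding o_def split_def .
  qed (use t in auto)
  moreover have "at t within {0<..<T} = at t" by (rule at_within_open[OF t open_greaterThanLessThan])
  ultimately show ?thesis unfolding I_def[abs_def] by (simp only:)
qed

lemma bounded_on_slab:
  assumes f: "continuous_on Om f" and t: "0 < t1" "t2 < T"
  obtains B :: real where "B \<ge> 0" "\<And>x t. x \<in> cbox 0 1 \<Longrightarrow> t \<in> {t1..t2} \<Longrightarrow> f (x, t) \<le> B"
proof -
  have "compact (cbox 0 1 \<times> {t1..t2} :: ((real ^ 'n) \<times> real) set)" by (intro compact_Times) auto
  moreover have "continuous_on (cbox 0 1 \<times> {t1..t2}) f"
    by (rule continuous_on_subset[OF f]) (use t in \<open>auto simp: Om_def\<close>)
  ultimately have "bounded (f ` (cbox 0 1 \<times> {t1..t2}))"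
    by (intro compact_imp_bounded compact_continuous_image)
  then obtain B where B: "\<And>z. z \<in> cbox 0 1 \<times> {t1..t2} \<Longrightarrow> norm (f z) \<le> B"
    unfolding bounded_iff by blast
  show ?thesis
  proof (rule that[of "max B 0"])
    show "f (x, t) \<le> max B 0" if "x \<in> cbox 0 1" "t \<in> {t1..t2}" for x t
      using B[of "(x, t)"] that by simp
  qed simp
qed

lemma I_le_bound:
  assumes "t \<in> {0<..<T}" "continuous_on Om f" "\<And>x. x \<in> cbox 0 1 \<Longrightarrow> f (x, t) \<le> B"
  shows "I f t \<le> B"
proof -
  have "I f t \<le> integral (cbox 0 1) (\<lambda>x :: real ^ 'n. B)"
    unfolding I_def
    by (rule integral_le[OF integrable_slice[OF assms(2,1)] integrable_continuous[OF continuous_on_const] assms(3)])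
  then show ?thesis using content_unit_cube[where 'n = 'n] by simp
qed

text \<open>At a critical point the flux is 0. If m_t \<noteq> 0 there, some component of the flux
  has nonzero derivative along its own axis, hence is nonzero at nearby points of that line, where
  Du cannot vanish.\<close>

lemma negligible_critical_moving:
  assumes t: "t \<in> {0<..<T}"
  shows "negligible {x. s (x, t) = 0 \<and> dird m et (x, t) \<noteq> 0}"
proof -
  have Om: "(x, t) \<in> Om" for x :: "real ^ 'n" using t by (simp add: Om_def)
  \<comment> \<open>The isolation radius depends on the point; the radii
    \<open>1 / real (Suc n)\<close> reduce the claim to a countable union of sets with uniform
    radius.\<close>
  let ?E = "\<lambda>i n. {x. s (x, t) = 0 \<and> (\<forall>r. 0 < \<bar>r\<bar> \<and> \<bar>r\<bar> < 1 / real (Suc n) \<longrightarrow> s (x + r *\<^sub>R axis i 1, t) \<noteq> 0)}"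
  have "negligible (?E i n)" for i n
    by (rule negligible_isolated_zeros[OF continuous_slice[OF continuous_s t]]) simp
  then have "negligible (\<Union>i\<in>UNIV. \<Union>n\<in>UNIV. ?E i n)"
    by (intro negligible_Union_nat negligible_Union) auto
  moreover have "{x. s (x, t) = 0 \<and> dird m et (x, t) \<noteq> 0} \<subseteq> (\<Union>i\<in>UNIV. \<Union>n\<in>UNIV. ?E i n)"
  proof
    fix x assume "x \<in> {x. s (x, t) = 0 \<and> dird m et (x, t) \<noteq> 0}"
    then have s0: "s (x, t) = 0" and mt: "dird m et (x, t) \<noteq> 0" by auto
    let ?F = "\<lambda>i y. flux \<alpha> \<beta> u m t y $ i"
    have F0: "?F i z = 0" if "s (z, t) = 0" for i z
      using that flux_component[OF t] by (simp add: q_def s_eq_0)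
    have "\<exists>i. dird (?F i) (axis i 1) x \<noteq> 0"
    proof (rule ccontr)
      assume "\<not> ?thesis"
      then have "(\<Sum>i\<in>UNIV. dird (?F i) (axis i 1) x) = 0" by simp
      then show False using mt m_t_eq_divergence(1)[OF Om] by simp
    qed
    then obtain i where i: "dird (?F i) (axis i 1) x \<noteq> 0" by blast
    have "((\<lambda>r. ?F i (x + r *\<^sub>R axis i 1)) has_field_derivative dird (?F i) (axis i 1) x) (at 0)"
      using dird_along_line[of "?F i" x 0 "axis i 1"] m_t_eq_divergence(2)[OF Om] by simp
    then have "((\<lambda>r. ?F i (x + r *\<^sub>R axis i 1) / r) \<longlongrightarrow> dird (?F i) (axis i 1) x) (at 0)"
      by (simp add: DERIV_def F0[OF s0])
    then have "\<forall>\<^sub>F r in at 0. ?F i (x + r *\<^sub>R axis i 1) / r \<noteq> 0"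
      using i by (rule tendsto_imp_eventually_ne)
    then obtain d where d: "d > 0" "\<And>r. r \<noteq> 0 \<Longrightarrow> \<bar>r\<bar> < d \<Longrightarrow> ?F i (x + r *\<^sub>R axis i 1) / r \<noteq> 0"
      unfolding eventually_at by (auto simp: dist_real_def)
    obtain n where n: "inverse (real (Suc n)) < d" using reals_Archimedean[OF d(1)] by blast
    have "s (x + r *\<^sub>R axis i 1, t) \<noteq> 0" if "0 < \<bar>r\<bar>" "\<bar>r\<bar> < 1 / real (Suc n)" for r
    proof
      assume "s (x + r *\<^sub>R axis i 1, t) = 0"
      then have "?F i (x + r *\<^sub>R axis i 1) / r = 0" by (simp add: F0)
      moreover have "\<bar>r\<bar> < d" using that(2) n by (simp add: inverse_eq_divide)
      ultimately show False using d(2)[of r] that(1) by simp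
    qed
    then have "x \<in> ?E i n" using s0 by blast
    then show "x \<in> (\<Union>i\<in>UNIV. \<Union>n\<in>UNIV. ?E i n)" by blast
  qed
  ultimately show ?thesis by (rule negligible_subset)
qed

section \<open>Monotonicity of the derivative of the moments as the cutoff is removed\<close>

lemma I_cong:
  assumes "t \<in> {0<..<T}" "\<And>z. z \<in> Om \<Longrightarrow> f z = f' z"
  shows "I f t = I f' t"
proof -
  have "f (x, t) = f' (x, t)" for x by (rule assms(2)) (use assms(1) in \<open>simp add: Om_def\<close>)
  then show ?thesis unfolding I_def by (simp only:)
qed

lemma continuous_sum_dird:
  assumes "\<And>i. Cdiff (Suc 0) (F i) Om"
  shows "continuous_on Om (\<lambda>z. \<Sum>i\<in>UNIV. dird (F i) (ex i) z)"
  by (rule continuous_on_sum) (rule Cdiff_continuous[OF Cdiff_dird[OF assms]])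

text \<open>Integrating \<open>convexity_pointwise\<close> over the cell removes the divergence of
  \<open>R\<close>, and \<open>CB\<close> is bounded on the compact time slab. The constant is
  chosen before \<open>\<iota>\<close>, so the increment vanishes in the limit.\<close>

lemma G_increment:
  assumes \<rho>: "\<rho> > 1" and disc: "a\<^sup>2 \<le> 4 * (1 - 1 / \<rho>) * (a * (\<beta> - 1) / \<beta>)"
    and t: "0 < t1" "t1 \<le> t2" "t2 < T"
  shows "\<exists>C. \<forall>\<iota>. 0 < \<iota> \<and> \<iota> \<le> 1 \<longrightarrow> I (G (\<rho> + a) \<iota>) t2 - I (G (\<rho> + a) \<iota>) t1 \<le> \<iota> * C"
proof -
  obtain B where B: "\<And>x t. x \<in> cbox 0 1 \<Longrightarrow> t \<in> {t1..t2} \<Longrightarrow> CB \<rho> (x, t) \<le> B"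
    using bounded_on_slab[OF continuous_CB t(1,3)] by blast
  have "I (G (\<rho> + a) \<iota>) t2 - I (G (\<rho> + a) \<iota>) t1 \<le> \<iota> * (B * (t2 - t1))" if \<iota>: "0 < \<iota>" "\<iota> \<le> 1" for \<iota>
  proof -
    let ?G = "G (\<rho> + a) \<iota>" and ?R = "R (\<rho> + a) \<rho> \<iota>"
    have le: "I (dird ?G et) t \<le> \<iota> * B" if "t1 \<le> t" "t \<le> t2" for t
    proof -
      have tT: "t \<in> {0<..<T}" using t that by auto
      have cR: "continuous_on Om (\<lambda>z. \<Sum>i\<in>UNIV. dird (?R i) (ex i) z)"
        by (rule continuous_sum_dird[OF Cdiff_R[OF \<iota>(1)]])
      have cC: "continuous_on Om (\<lambda>z. \<iota> * CB \<rho> z)"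
        by (intro continuous_on_mult continuous_on_const continuous_CB)
      have "I (dird ?G et) t \<le> I (\<lambda>z. (\<Sum>i\<in>UNIV. dird (?R i) (ex i) z) + \<iota> * CB \<rho> z) t"
      proof (rule I_mono[OF tT])
        show "continuous_on Om (dird ?G et)"
          by (rule Cdiff_continuous[OF Cdiff_dird[OF Cdiff_G[OF \<iota>(1)]]])
        show "continuous_on Om (\<lambda>z. (\<Sum>i\<in>UNIV. dird (?R i) (ex i) z) + \<iota> * CB \<rho> z)"
          by (rule continuous_on_add[OF cR cC])
        show "dird ?G et (x, t) \<le> (\<Sum>i\<in>UNIV. dird (?R i) (ex i) (x, t)) + \<iota> * CB \<rho> (x, t)" for x
          by (rule convexity_pointwise[OF _ \<iota> \<rho> disc]) (use tT in \<open>simp add: Om_def\<close>)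
      qed
      also have "\<dots> = 0 + \<iota> * I (CB \<rho>) t"
        unfolding I_add[OF tT cR cC] I_div[OF tT Cdiff_R[OF \<iota>(1)] per_R[OF \<iota>(1)]] I_cmult ..
      also have "\<dots> \<le> \<iota> * B"
      proof -
        have "I (CB \<rho>) t \<le> B" by (rule I_le_bound[OF tT continuous_CB]) (rule B, use that in auto)
        then show ?thesis using mult_left_mono[of "I (CB \<rho>) t" B \<iota>] \<iota>(1) by linarith
      qed
      finally show ?thesis .
    qed
    have "I ?G t2 - \<iota> * B * t2 \<le> I ?G t1 - \<iota> * B * t1"
    proof (rule DERIV_nonpos_imp_nonincreasing[OF t(2)])
      fix t assume tt: "t1 \<le> t" "t \<le> t2"
      have "((\<lambda>t. I ?G t - \<iota> * B * t) has_field_derivative I (dird ?G et) t - \<iota> * B) (at t)"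
      proof -
        have tT: "t \<in> {0<..<T}" using tt t by simp
        show ?thesis using DERIV_diff[OF I_deriv[OF tT Cdiff_G[OF \<iota>(1)]] DERIV_cmult_Id[of "\<iota> * B"]] .
      qed
      then show "\<exists>y. ((\<lambda>t. I ?G t - \<iota> * B * t) has_field_derivative y) (at t) \<and> y \<le> 0"
        using le[OF tt] by (intro exI[of _ "I (dird ?G et) t - \<iota> * B"]) simp
    qed
    then show ?thesis by (simp add: algebra_simps)
  qed
  then show ?thesis by blast
qed

lemma continuous_cutoff_s: "\<iota> > 0 \<Longrightarrow> continuous_on Om (\<lambda>z. cutoff \<iota> (s z))"
  by (rule Cdiff_continuous[OF Cdiff_zero_P0[where \<iota> = \<iota>, OF Cdiff_cutoff_s]]) (simp add: P0_def cutoff_eq_0)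

lemma Cdiff_exp_X: "\<iota> > 0 \<Longrightarrow> Cdiff (Suc 0) (\<lambda>z. exp (c * M z) * X \<iota> i z) Om"
  by (rule Cdiff_mult[OF open_Om Cdiff_exp_M Cdiff_X1])

lemma per_exp_X: "per (\<lambda>z. exp (c * M z) * X \<iota> i z)"
  using per_M per_X[of \<iota> i] by (simp add: per_def)

text \<open>\<open>r\<close> times the integral of this function is the time derivative of the
  integral of m^r.\<close>

definition Nf where "Nf r z = exp (r * M z) * dird M et z"

lemma continuous_Nf: "continuous_on Om (Nf r)"
  unfolding Nf_def[abs_def] by (intro continuous_on_mult continuous_on_exp continuous_on_const continuous_M)

lemma continuous_cutoff_Nf: "\<iota> > 0 \<Longrightarrow> continuous_on Om (\<lambda>z. cutoff \<iota> (s z) * Nf r z)"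
  by (rule continuous_on_mult[OF continuous_cutoff_s continuous_Nf])

lemma continuous_rG: "\<iota> > 0 \<Longrightarrow> continuous_on Om (\<lambda>z. b * G c \<iota> z)"
  by (rule continuous_on_mult[OF continuous_on_const Cdiff_continuous[OF Cdiff_G]])

lemma continuous_divEX: "\<iota> > 0 \<Longrightarrow> continuous_on Om (\<lambda>z. (\<Sum>i\<in>UNIV. dird (\<lambda>z. exp (c * M z) * X \<iota> i z) (ex i) z))"
  by (rule continuous_sum_dird[OF Cdiff_exp_X])

lemma Err_eq: "Err r \<iota> = (\<lambda>z. ((\<Sum>i\<in>UNIV. dird (\<lambda>z. exp ((r - a) * M z) * X \<iota> i z) (ex i) z)
    - (r - 1) * G (r - a) \<iota> z) - cutoff \<iota> (s z) * Nf r z)"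
  by (simp add: fun_eq_iff Err_def Nf_def)

lemma continuous_Err: "\<iota> > 0 \<Longrightarrow> continuous_on Om (Err r \<iota>)"
  unfolding Err_eq by (intro continuous_on_diff continuous_divEX continuous_rG continuous_cutoff_Nf)

lemma I_cutoff_Nf:
  assumes t: "t \<in> {0<..<T}" and \<iota>: "\<iota> > 0"
  shows "I (\<lambda>z. cutoff \<iota> (s z) * Nf r z) t = - (r - 1) * I (G (r - a) \<iota>) t - I (Err r \<iota>) t"
proof -
  have "I (Err r \<iota>) t = (0 - (r - 1) * I (G (r - a) \<iota>) t) - I (\<lambda>z. cutoff \<iota> (s z) * Nf r z) t"
    unfolding Err_eq I_diff[OF t continuous_on_diff[OF continuous_divEX[OF \<iota>] continuous_rG[OF \<iota>]] continuous_cutoff_Nf[OF \<iota>]]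
      I_diff[OF t continuous_divEX[OF \<iota>] continuous_rG[OF \<iota>]] I_div[OF t Cdiff_exp_X[OF \<iota>] per_exp_X] I_cmult ..
  then show ?thesis by (simp add: algebra_simps)
qed

text \<open>The bound of \<open>Err_bound\<close> is integrated: \<open>V\<close> drops out as a
  divergence, and the integral of \<open>VB\<close> together with the bound \<open>A\<close> of the
  exponential does not depend on \<open>\<iota>\<close>.\<close>

lemma I_Err_le:
  assumes t: "t \<in> {0<..<T}" and c: "r \<noteq> a"
  shows "\<exists>C. \<forall>\<iota>. 0 < \<iota> \<and> \<iota> \<le> 1 \<longrightarrow> \<bar>I (Err r \<iota>) t\<bar> \<le> sqrt \<iota> * C"
proof -
  have zO: "(x, t) \<in> Om" for x :: "real ^ 'n" using t by (simp add: Om_def)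
  have cE: "continuous_on Om (\<lambda>z. exp ((r - a) * M z))"
    by (rule Cdiff_continuous[OF Cdiff_exp_M])
  have tT: "0 < t" "t < T" using t by auto
  obtain A where
    A': "\<And>x t'. x \<in> cbox 0 1 \<Longrightarrow> t' \<in> {t..t} \<Longrightarrow> exp ((r - a) * M (x, t')) \<le> A"
    using bounded_on_slab[OF cE tT] by blast
  have A: "exp ((r - a) * M (x, t)) \<le> A" if "x \<in> cbox 0 1" for x
    by (rule A'[OF that]) simp
  define C where "C = A * (2 / (\<beta> - 1)) * I VB t"
  have "\<bar>I (Err r \<iota>) t\<bar> \<le> sqrt \<iota> * C" if \<iota>: "0 < \<iota>" "\<iota> \<le> 1" for \<iota>
  proof -
    define K where "K = A * (sqrt \<iota> * (2 / (\<beta> - 1)))"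
    have cdiff1: "Cdiff (Suc 0) (NL (\<lambda>_. 1) \<iota> i) Om" for i
      by (rule Cdiff_NL[OF \<iota>(1) Cdiff_const])
    have cV: "continuous_on Om (V \<iota>)"
      unfolding V_def[abs_def] by (rule continuous_sum_dird[OF cdiff1])
    have per1: "per (NL (\<lambda>_. 1) \<iota> i)" for i
      by (rule per_NL[OF \<iota>(1)]) (simp add: per_def)
    have IV: "I (V \<iota>) t = 0"
      unfolding V_def[abs_def] by (rule I_div[OF t cdiff1 per1])
    have cVV: "continuous_on Om (\<lambda>z. V \<iota> z + VB z)" by (rule continuous_on_add[OF cV continuous_VB])
    have cK: "continuous_on Om (\<lambda>z. b * (V \<iota> z + VB z))" for b
      by (rule continuous_on_mult[OF continuous_on_const cVV])
    have IK: "I (\<lambda>z. b * (V \<iota> z + VB z)) t = b * I VB t" for b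
      unfolding I_cmult I_add[OF t cV continuous_VB] IV by simp
    have le: "\<bar>Err r \<iota> (x, t)\<bar> \<le> K * (V \<iota> (x, t) + VB (x, t))" if "x \<in> cbox 0 1" for x
    proof -
      have "\<bar>Err r \<iota> (x, t)\<bar> \<le> exp ((r - a) * M (x, t)) * (sqrt \<iota> * (2 / (\<beta> - 1) * (V \<iota> (x, t) + VB (x, t))))"
        by (rule Err_bound(2)[OF zO \<iota> c])
      also have "\<dots> \<le> A * (sqrt \<iota> * (2 / (\<beta> - 1) * (V \<iota> (x, t) + VB (x, t))))"
        by (rule mult_right_mono[OF A[OF that]])
           (use Err_bound(1)[OF zO \<iota> c, of x] \<iota> \<beta>_gt in simp)
      finally show ?thesis by (simp only: K_def mult.assoc)
    qed
    have "I (Err r \<iota>) t \<le> I (\<lambda>z. K * (V \<iota> z + VB z)) t"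
      by (rule I_mono[OF t continuous_Err[OF \<iota>(1)] cK]) (use le abs_le_D1 in blast)
    moreover have "I (\<lambda>z. - K * (V \<iota> z + VB z)) t \<le> I (Err r \<iota>) t"
    proof (rule I_mono[OF t cK continuous_Err[OF \<iota>(1)]])
      show "- K * (V \<iota> (x, t) + VB (x, t)) \<le> Err r \<iota> (x, t)" if "x \<in> cbox 0 1" for x
        using le[OF that] by linarith
    qed
    ultimately have "\<bar>I (Err r \<iota>) t\<bar> \<le> K * I VB t" unfolding IK by linarith
    also have "\<dots> = sqrt \<iota> * C" by (simp add: K_def C_def)
    finally show ?thesis .
  qed
  then show ?thesis by blast
qed

text \<open>Dominated convergence: the cutoff tends to 1 where Du \<noteq> 0 and is 0 where Du = 0,
  with a majorant uniform in \<open>n\<close>.\<close>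

lemma I_Nf_limit:
  assumes t: "t \<in> {0<..<T}"
  shows "(\<lambda>n. I (\<lambda>z. cutoff (inverse (real (Suc n))) (s z) * Nf r z) t) \<longlonglongrightarrow> I (Nf r) t"
proof -
  have zO: "(x, t) \<in> Om" for x :: "real ^ 'n" using t by (simp add: Om_def)
  define i where "i n = inverse (real (Suc n))" for n
  have i: "0 < i n" "i n \<le> 1" for n by (auto simp: i_def inverse_le_1_iff)
  have i0: "i \<longlonglongrightarrow> 0" unfolding i_def by (rule LIMSEQ_inverse_real_of_nat)
  define F where "F x = (if s (x, t) > 0 then Nf r (x, t) else 0)" for x
  have "(\<lambda>n. integral (cbox 0 1) (\<lambda>x. cutoff (i n) (s (x, t)) * Nf r (x, t))) \<longlonglongrightarrow> integral (cbox 0 1) F"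
  proof (rule dominated_convergence(2))
    show "(\<lambda>x. cutoff (i n) (s (x, t)) * Nf r (x, t)) integrable_on cbox 0 1" for n
      using integrable_slice[OF continuous_cutoff_Nf[OF i(1)] t] .
    have "continuous_on Om (\<lambda>z. (1 + s z) ^ 3 * \<bar>Nf r z\<bar>)"
      by (intro continuous_on_mult continuous_on_power continuous_on_add continuous_on_const continuous_s
          continuous_on_rabs continuous_Nf)
    from integrable_slice[OF this t]
    show "(\<lambda>x. (1 + s (x, t)) ^ 3 * \<bar>Nf r (x, t)\<bar>) integrable_on cbox 0 1" .
    show "norm (cutoff (i n) (s (x, t)) * Nf r (x, t)) \<le> (1 + s (x, t)) ^ 3 * \<bar>Nf r (x, t)\<bar>" for n x
      using mult_right_mono[OF cutoff_le[OF i zO], of "\<bar>Nf r (x, t)\<bar>"] cutoff_nonneg[of "i n" "s (x, t)"]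
      by (simp add: abs_mult)
    show "(\<lambda>n. cutoff (i n) (s (x, t)) * Nf r (x, t)) \<longlonglongrightarrow> F x" for x
    proof (cases "s (x, t) > 0")
      case True
      have "(\<lambda>n. (max 0 (1 + i n * ln (s (x, t)))) ^ 3) \<longlonglongrightarrow> (max 0 (1 + 0 * ln (s (x, t)))) ^ 3"
        by (intro tendsto_power tendsto_max tendsto_add tendsto_mult tendsto_const i0)
      then have "(\<lambda>n. cutoff (i n) (s (x, t))) \<longlonglongrightarrow> 1" using True by (simp add: cutoff_def)
      from tendsto_mult_right[OF this, of "Nf r (x, t)"] show ?thesis using True by (simp add: F_def)
    next
      case False
      then show ?thesis by (simp add: F_def cutoff_def)
    qed
  qed
  moreover have "integral (cbox 0 1) F = integral (cbox 0 1) (\<lambda>x. Nf r (x, t))"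
  \<comment> \<open>The pointwise limit is 0 on the critical set. It agrees with \<open>Nf\<close>
    there wherever m_t = 0, and the remaining points form a null set.\<close>
  proof (rule integral_spike[OF negligible_critical_moving[OF t]])
    show "Nf r (x, t) = F x" if "x \<in> cbox 0 1 - {x. s (x, t) = 0 \<and> dird m et (x, t) \<noteq> 0}" for x
    proof (cases "s (x, t) > 0")
      case False
      then have "s (x, t) = 0" using s_nonneg[of "(x, t)"] by linarith
      then have "dird m et (x, t) = 0" using that by blast
      then have "dird M et (x, t) = 0" using dird_m[OF zO] m_Om[OF zO, of x] by simp
      then show ?thesis using False by (simp add: F_def Nf_def)
    qed (simp add: F_def)
  qed
  ultimately show ?thesis by (simp add: I_def i_def)
qed

text \<open>For fixed cutoff, \<open>I_cutoff_Nf\<close> turns the difference of the regularized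
  integrals into an increment of \<open>G\<close> plus two errors, of orders \<open>\<iota>\<close>
  and \<open>sqrt \<iota>\<close>; then \<open>\<iota>\<close> tends to 0. Here
  \<open>r - a = \<rho> + a\<close> is the exponent in \<open>G\<close>.\<close>

lemma I_Nf_mono:
  assumes \<rho>: "\<rho> > 1" and disc: "a\<^sup>2 \<le> 4 * (1 - 1 / \<rho>) * (a * (\<beta> - 1) / \<beta>)"
    and t: "0 < t1" "t1 \<le> t2" "t2 < T" and r: "r = \<rho> + 2 * a"
  shows "I (Nf r) t1 \<le> I (Nf r) t2"
proof -
  have t1: "t1 \<in> {0<..<T}" and t2: "t2 \<in> {0<..<T}" using t by auto
  have ra: "r \<noteq> a" "r - a = \<rho> + a" "r - 1 \<ge> 0" using \<rho> a_pos r by auto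
  obtain C where C: "\<And>\<iota>. 0 < \<iota> \<Longrightarrow> \<iota> \<le> 1 \<Longrightarrow> I (G (r - a) \<iota>) t2 - I (G (r - a) \<iota>) t1 \<le> \<iota> * C"
    using G_increment[OF \<rho> disc t] unfolding ra(2) by blast
  obtain C1 where C1: "\<And>\<iota>. 0 < \<iota> \<Longrightarrow> \<iota> \<le> 1 \<Longrightarrow> \<bar>I (Err r \<iota>) t1\<bar> \<le> sqrt \<iota> * C1"
    using I_Err_le[OF t1 ra(1)] by blast
  obtain C2 where C2: "\<And>\<iota>. 0 < \<iota> \<Longrightarrow> \<iota> \<le> 1 \<Longrightarrow> \<bar>I (Err r \<iota>) t2\<bar> \<le> sqrt \<iota> * C2"
    using I_Err_le[OF t2 ra(1)] by blast
  let ?N = "\<lambda>n. I (\<lambda>z. cutoff (inverse (real (Suc n))) (s z) * Nf r z)"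
  let ?\<epsilon> = "\<lambda>n. (r - 1) * (inverse (real (Suc n)) * C) + sqrt (inverse (real (Suc n))) * C1 + sqrt (inverse (real (Suc n))) * C2"
  have step: "?N n t1 - ?N n t2 \<le> ?\<epsilon> n" for n
  proof -
    define \<iota> where "\<iota> = inverse (real (Suc n))"
    have \<iota>: "0 < \<iota>" "\<iota> \<le> 1" by (auto simp: \<iota>_def inverse_le_1_iff)
    have "(r - 1) * (I (G (r - a) \<iota>) t2 - I (G (r - a) \<iota>) t1) \<le> (r - 1) * (\<iota> * C)"
      by (rule mult_left_mono[OF C[OF \<iota>] ra(3)])
    moreover have "?N n t1 - ?N n t2 = (r - 1) * (I (G (r - a) \<iota>) t2 - I (G (r - a) \<iota>) t1) - I (Err r \<iota>) t1 + I (Err r \<iota>) t2"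
      unfolding I_cutoff_Nf[OF t1 \<iota>(1), unfolded \<iota>_def] I_cutoff_Nf[OF t2 \<iota>(1), unfolded \<iota>_def] \<iota>_def
      by (simp add: algebra_simps)
    ultimately show ?thesis using C1[OF \<iota>] C2[OF \<iota>] unfolding \<iota>_def by linarith
  qed
  have "?\<epsilon> \<longlonglongrightarrow> (r - 1) * (0 * C) + sqrt 0 * C1 + sqrt 0 * C2"
    by (intro tendsto_add tendsto_mult tendsto_const tendsto_real_sqrt LIMSEQ_inverse_real_of_nat)
  then have "?\<epsilon> \<longlonglongrightarrow> 0" by simp
  moreover have "(\<lambda>n. ?N n t1 - ?N n t2) \<longlonglongrightarrow> I (Nf r) t1 - I (Nf r) t2"
    by (rule tendsto_diff[OF I_Nf_limit[OF t1] I_Nf_limit[OF t2]])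
  ultimately have "I (Nf r) t1 - I (Nf r) t2 \<le> 0"
    using LIMSEQ_le step by blast
  then show ?thesis by simp
qed

section \<open>From convex moments to the norm bound\<close>

lemma moment_le:
  assumes \<rho>: "\<rho> > 1" and disc: "a\<^sup>2 \<le> 4 * (1 - 1 / \<rho>) * (a * (\<beta> - 1) / \<beta>)"
    and r: "r = \<rho> + 2 * a" and t: "t \<in> {0..T}"
  shows "integral (cbox 0 1) (\<lambda>x. m (x, t) powr r)
    \<le> max (integral (cbox 0 1) (\<lambda>x. m (x, 0) powr r)) (integral (cbox 0 1) (\<lambda>x. m (x, T) powr r))"
proof (rule le_max_of_mono_deriv[where J = "\<lambda>t. integral (cbox 0 1) (\<lambda>x. m (x, t) powr r)" and N = "\<lambda>t. r * I (Nf r) t", OF _ _ _ t])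
  have r0: "r \<ge> 0" using \<rho> a_pos r by simp
  have "Ck_on 0 m (UNIV \<times> {0..T})" using m_smooth unfolding Cinfinity_on_def by blast
  then have cm: "continuous_on (UNIV \<times> {0..T}) m" by simp
  have "continuous_on ({0..T} \<times> cbox 0 1) (m \<circ> (\<lambda>z. (snd z, fst z)))"
  proof (rule continuous_on_compose)
    show "continuous_on ({0..T} \<times> cbox 0 1) (\<lambda>z :: real \<times> (real ^ 'n). (snd z, fst z))"
      by (intro continuous_intros)
    show "continuous_on ((\<lambda>z. (snd z, fst z)) ` ({0..T} \<times> cbox 0 1)) m"
      by (rule continuous_on_subset[OF cm]) auto
  qed
  then have "continuous_on ({0..T} \<times> cbox 0 1) (\<lambda>z. (m \<circ> (\<lambda>z. (snd z, fst z))) z powr r)"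
    by (rule continuous_on_powr[OF _ continuous_on_const]) (use m_pos in \<open>force simp: less_imp_neq[symmetric]\<close>)
  then have "continuous_on ({0..T} \<times> cbox 0 1) (\<lambda>(t, x). m (x, t) powr r)"
    unfolding o_def split_def by simp
  then show "continuous_on {0..T} (\<lambda>t. integral (cbox 0 1) (\<lambda>x. m (x, t) powr r))"
    by (rule integral_continuous_on_param)
  show "((\<lambda>t. integral (cbox 0 1) (\<lambda>x. m (x, t) powr r)) has_field_derivative r * I (Nf r) t) (at t)"
    if "0 < t" "t < T" for t
  proof -
    have tT: "t \<in> {0<..<T}" using that by simp
    have "I (dird (\<lambda>z. exp (r * M z)) et) t = I (\<lambda>z. r * Nf r z) t"
      by (rule I_cong[OF tT]) (simp add: dird_exp_M Nf_def)
    then have e: "I (dird (\<lambda>z. exp (r * M z)) et) t = r * I (Nf r) t" unfolding I_cmult .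
    have "(I (\<lambda>z. exp (r * M z)) has_field_derivative r * I (Nf r) t) (at t)"
      using I_deriv[OF tT Cdiff_exp_M[of "Suc 0" r]] unfolding e .
    then show ?thesis
    proof (rule has_field_derivative_transform_within_open[where S = "{0<..<T}"])
      show "I (\<lambda>z. exp (r * M z)) t' = integral (cbox 0 1) (\<lambda>x. m (x, t') powr r)" if "t' \<in> {0<..<T}" for t'
        unfolding I_def by (rule integral_cong) (use that m_powr in \<open>simp add: Om_def\<close>)
    qed (use tT in auto)
  qed
  \<comment> \<open>As \<open>r\<close> is nonnegative, monotonicity of the integral of
    \<open>Nf\<close> is that of the derivative, that is, convexity of the moment.\<close>
  show "r * I (Nf r) t \<le> r * I (Nf r) t'" if "0 < t" "t \<le> t'" "t' < T" for t t'
    by (rule mult_left_mono[OF I_Nf_mono[OF \<rho> disc that r] r0])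
qed

text \<open>Dividing the second inequality by the positive number \<open>a * (\<beta> - 1)\<close>
  turns it into \<alpha> \<beta> \<le> 4 (1 - 1 / \<rho>). As \<alpha> \<beta> < 4, this holds from
  \<rho> = 4 / (4 - \<alpha> \<beta>) on; the maximum with 2 ensures \<rho> > 1.\<close>

lemma discriminant_eventually:
  assumes "\<alpha> < 4 / \<beta>" and \<rho>: "\<rho> \<ge> max 2 (4 / (4 - \<alpha> * \<beta>))"
  shows "\<rho> > 1" "a\<^sup>2 \<le> 4 * (1 - 1 / \<rho>) * (a * (\<beta> - 1) / \<beta>)"
proof -
  show 1: "\<rho> > 1" using \<rho> by simp
  have ab: "4 - \<alpha> * \<beta> > 0" using assms(1) \<beta>_gt by (simp add: field_simps)
  have "4 / (4 - \<alpha> * \<beta>) \<le> \<rho>" using \<rho> by simp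
  then have "4 \<le> \<rho> * (4 - \<alpha> * \<beta>)" using ab by (simp add: divide_simps)
  then have "\<alpha> * \<beta> \<le> 4 * (1 - 1 / \<rho>)" using 1 by (simp add: field_simps)
  then have "\<alpha> \<le> 4 * (1 - 1 / \<rho>) / \<beta>" using \<beta>_gt by (simp add: field_simps)
  then have "(a * (\<beta> - 1)) * \<alpha> \<le> (a * (\<beta> - 1)) * (4 * (1 - 1 / \<rho>) / \<beta>)"
    by (rule mult_left_mono) (use a_pos \<beta>_gt in simp)
  then show "a\<^sup>2 \<le> 4 * (1 - 1 / \<rho>) * (a * (\<beta> - 1) / \<beta>)"
    by (simp add: a_def power2_eq_square mult_ac)
qed

lemma Linfty_norm_le:
  assumes "\<alpha> < 4 / \<beta>" and t: "t \<in> {0..T}"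
  shows "torus_Linfty_norm (\<lambda>x. m (x, t)) \<le> max (torus_Linfty_norm (\<lambda>x. m (x, 0))) (torus_Linfty_norm (\<lambda>x. m (x, T)))"
proof -
  have "Ck_on 0 m (UNIV \<times> {0..T})" using m_smooth unfolding Cinfinity_on_def by blast
  then have cm: "continuous_on (UNIV \<times> {0..T}) m" by simp
  have c: "continuous_on (cbox 0 1) (\<lambda>x. m (x, r))" if "r \<in> {0..T}" for r
  proof -
    have "continuous_on (cbox 0 1) (m \<circ> (\<lambda>x. (x, r)))"
    proof (rule continuous_on_compose)
      show "continuous_on (cbox 0 1) (\<lambda>x :: real ^ 'n. (x, r))" by (intro continuous_intros)
      show "continuous_on ((\<lambda>x. (x, r)) ` cbox 0 1) m"
        by (rule continuous_on_subset[OF cm]) (use that in auto)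
    qed
    then show ?thesis by (simp add: o_def)
  qed
  have pos: "m (x, r) > 0" if "r \<in> {0..T}" for x r
    using m_pos that by blast
  have T: "0 \<in> {0..T}" "T \<in> {0..T}" using T_pos by auto
  have "integral (cbox 0 1) (\<lambda>x. m (x, t) powr r)
    \<le> max (integral (cbox 0 1) (\<lambda>x. m (x, 0) powr r)) (integral (cbox 0 1) (\<lambda>x. m (x, T) powr r))"
    if "r \<ge> max 2 (4 / (4 - \<alpha> * \<beta>)) + 2 * a" for r
  proof -
    have \<rho>: "r - 2 * a \<ge> max 2 (4 / (4 - \<alpha> * \<beta>))" using that by linarith
    show ?thesis
      by (rule moment_le[OF discriminant_eventually[OF assms(1) \<rho>] _ t]) simp
  qed
  from torus_Linfty_norm_le_moments[OF c[OF t] c[OF T(1)] c[OF T(2)] pos[OF t] pos[OF T(1)] pos[OF T(2)] this]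
  show ?thesis .
qed

end

theorem corollary4p2:
  fixes T \<alpha> \<beta> :: real
    and g :: "real \<Rightarrow> real"
    and u m :: "(real ^ 'n) \<times> real \<Rightarrow> real"
  assumes "T > 0" and "\<alpha> > 0" and "\<beta> > 1"
    and "Cinfinity_on g {0<..}" and "mono_on {0<..} g"
    and "Cinfinity_on u (UNIV \<times> {0..T})" and "Cinfinity_on m (UNIV \<times> {0..T})"
    and "\<forall>t\<in>{0..T}. torus_periodic (\<lambda>x. u (x, t))"
    and "\<forall>t\<in>{0..T}. torus_periodic (\<lambda>x. m (x, t))"
    and "\<forall>x. \<forall>t\<in>{0..T}. m (x, t) > 0"
    and "solves_congestion_MFG T \<alpha> \<beta> g u m"
    and "(\<beta> \<ge> 2 \<and> \<alpha> < 2 / (\<beta> - 1)) \<or> (1 < \<beta> \<and> \<beta> < 2 \<and> \<alpha> < 2)"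
  shows "\<forall>t\<in>{0..T}. torus_Linfty_norm (\<lambda>x. m (x, t)) \<le>
           max (torus_Linfty_norm (\<lambda>x. m (x, 0))) (torus_Linfty_norm (\<lambda>x. m (x, T)))"
proof -
  interpret congestion_MFG T \<alpha> \<beta> g u m
    by unfold_locales (use assms in auto)
  have "\<alpha> < 4 / \<beta>"
  proof (cases "\<beta> \<ge> 2")
    case True
    then have "\<alpha> < 2 / (\<beta> - 1)" using assms(12) by linarith
    \<comment> \<open>After clearing denominators this inequality is exactly \<beta> \<ge>
      2.\<close>
    also have "\<dots> \<le> 4 / \<beta>" using True by (simp add: divide_simps)
    finally show ?thesis .
  next
    case False
    then have "\<alpha> < 2" using assms(12) by linarith
    also have "2 \<le> 4 / \<beta>" using False assms(3) by (simp add: divide_simps)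
    finally show ?thesis .
  qed
  then show ?thesis using Linfty_norm_le by blast
qed

end
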